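(* Let $1<p<\infty$ and $p'=p/(p-1)$. Let $(X,d,\mu)$ be a complete geodesic metric measure space such that $\mu$ is doubling and the space supports a $(p,p)$-Poincaré inequality, and let $\Omega\subset X$ be a nonempty bounded open connected set with $\mu(X\setminus\Omega)>0$. Fix a Cheeger differentiable structure on $X$. Let $(f_k)_{k=1}^\infty$ be a sequence in $L^{p'}(\Omega)$ that converges to $f\in L^{p'}(\Omega)$ in the $L^{p'}(\Omega)$ norm, and let $(g_k)_{k=1}^\infty$ be a sequence in $N^{1,p}(\Omega)$ that converges to $g\in N^{1,p}(\Omega)$ in the $N^{1,p}(\Omega)$ norm. For every $k\ge1$ let $u_k$ be a solution to the Dirichlet problem for the $p$-Poisson equation (in the Cheeger's setting) with source term $f_k$ and boundary data $g_k$, and let $u$ be a solution with source term $f$ and boundary data $g$. Then $(u_k)_{k=1}^\infty$ converges to $u$ in the $N^{1,p}(\Omega)$ norm.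
   Context: A metric measure space $(X,d,\mu)$ is a metric space with a Borel regular measure $\mu$; $B(x,r)$ is the open ball, and $u_E=\frac{1}{\mu(E)}\int_E u\,d\mu$ denotes the integral average when $0<\mu(E)<\infty$. The measure is doubling if there is $C_\mu\ge 1$ with $0<\mu(B(x,2r))\le C_\mu\mu(B(x,r))<\infty$ for all $x\in X$, $r>0$. Upper gradients: a Borel function $h:X\to[0,\infty]$ is an upper gradient of $u:X\to\mathbb{R}$ if $|u(\gamma(a))-u(\gamma(b))|\le\int_\gamma h\,ds$ for all nonconstant compact rectifiable curves $\gamma:[a,b]\to X$. It is a $p$-weak upper gradient if this holds for all such curves except a family of $p$-modulus zero, where the $p$-modulus of a curve family $\Gamma$ is $\inf\int_X\rho^p\,d\mu$ over Borel $\rho\ge0$ with $\int_\gamma\rho\,ds\ge1$ for all $\gamma\in\Gamma$. If $u$ has a $p$-weak upper gradient in $L^p(X)$, then there is a unique (up to a.e. equality) one with smallest $L^p$ norm, the minimal $p$-weak upper gradient, denoted with the function as subscript ($g_u$ for the function $u$); the symbols $g$, $g_k$ with $k$ an integer denote boundary data. Newtonian spaces: $u\in N^{1,p}(X)$ if $u\in L^p(X)$ and $u$ has a $p$-weak upper gradient in $L^p(X)$; $\|u\|_{N^{1,p}(X)}=\left(\int_X|u|^p+g_u^p\,d\mu\right)^{1/p}$. The space $N^{1,p}(\Omega)$ is defined in the same way with $\Omega$ (with restricted metric and measure) in place of $X$. $N_0^{1,p}(\Omega)$ consists of the restrictions to $\Omega$ of functions $u\in N^{1,p}(X)$ with $u=0$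 in $X\setminus\Omega$ (identified with their zero extensions). Poincaré inequality: $X$ supports a $(p,p)$-Poincaré inequality if there are $C_P>0$ and $\lambda\ge1$ such that for every $u\in L^1(X)$, $x\in X$, $r>0$ and every upper gradient $h$ of $u$, $$\left(\frac{1}{\mu(B(x,r))}\int_{B(x,r)}|u-u_{B(x,r)}|^p\,d\mu\right)^{1/p}\le C_P\,r\left(\frac{1}{\mu(B(x,\lambda r))}\int_{B(x,\lambda r)}h^p\,d\mu\right)^{1/p}.$$ Cheeger differentiable structure (known existence theorem for geodesic $X$ as in the claim): A function $u\in N^{1,p}_{\mathrm{loc}}(X)$ is asymptotically generalized linear at $x_0$ if $x_0$ is a Lebesgue point of $g_u^p$ and $\lim_{r\to0}\left(\frac{1}{\mu(B)}\int_{B}g_u^p\,d\mu-\inf_{\varphi}\frac{1}{\mu(B)}\int_{B}g_{u+\varphi}^p\,d\mu\right)=0$, where $B=B(x_0,r)$ and the infimum is over Newtonian functions $\varphi$ with compact support in $B$. There exist a positive integer $N$ and countably many measurable sets $U_\alpha$, which may be taken pairwise disjoint, with $\mu(U_\alpha)>0$ and $\mu(X\setminus\bigcup_\alpha U_\alpha)=0$, and for each $\alpha$ 1-Lipschitz functions $f_1^\alpha,\dots,f_{N(\alpha)}^\alpha$ on $X$, $N(\alpha)\le N$, with $\vec f^\alpha=(f_1^\alpha,\dots,f_{N(\alpha)}^\alpha)$, such that: (1) each $f^\alpha_j$ is asymptotically generalized linear at each point of $U_\alpha$; (2) $g_{\vec a\cdot\vec f^\alpha}(x_0)>0$ for all $\vec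 a\in\mathbb{R}^{N(\alpha)}\setminus\{0\}$, $x_0\in U_\alpha$; (3) for every Lipschitz $u:X\to\mathbb{R}$ there are $V_\alpha(u)\subset U_\alpha$ with $\mu(U_\alpha\setminus V_\alpha(u))=0$ and a Borel map $D^\alpha u:V_\alpha(u)\to\mathbb{R}^{N(\alpha)}$ such that for $x_0\in V_\alpha(u)$, $g_{\vec a\cdot\vec f^\alpha-u}(x_0)=0$ if and only if $\vec a=D^\alpha u(x_0)$. A structure of this kind (not necessarily unique) is fixed. Associated with it there are, for a.e. $x$, an inner product $\langle\cdot,\cdot\rangle_x$ on $\mathbb{R}^N$ with induced norm $|\cdot|_x$, and a bounded linear operator $\nabla:N^{1,p}(X)\to L^p(X:\mathbb{R}^N)$ (the Cheeger gradient) such that $\nabla u=\sum_\alpha D^\alpha u\,\chi_{U_\alpha}$ for Lipschitz $u$ (with $\mathbb{R}^{N(\alpha)}\subset\mathbb{R}^N$), $\nabla(uv)=u\nabla v+v\nabla u$ for Lipschitz $u,v\in N^{1,p}(X)$, and $|\nabla u(x)|_x\le g_u(x)\le\sqrt N\,|\nabla u(x)|_x$ for a.e. $x$. For $u\in N^{1,p}(\Omega)$, $\nabla u$ is defined a.e. in $\Omega$ by locality: $\nabla u=\nabla(\eta u)$ a.e. on $\{\eta=1\}$ for every Lipschitz cutoff $\eta$ with compact support in $\Omega$; it is linear in $u$ and satisfies the same two-sided comparison with $g_u$. Solution (in the Cheeger's setting): a solution to the Dirichlet problem for the $p$-Poisson equation with source term $f\in L^{p'}(\Omega)$ and boundary data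 $g\in N^{1,p}(\Omega)$ is a function $u\in N^{1,p}(\Omega)$ such that $u-g\in N_0^{1,p}(\Omega)$ and $\int_\Omega|\nabla u|_x^{p-2}\langle\nabla u,\nabla\varphi\rangle_x\,d\mu(x)=\int_\Omega f\varphi\,d\mu$ for all $\varphi\in N_0^{1,p}(\Omega)$. *)

theory Defs
  imports "HOL-Analysis.Analysis"
begin

text \<open>
  A metric measure space is a type of class \<open>metric_space\<close> with a measure \<open>M\<close> such that
  \<open>sets M = sets borel\<close>. A Borel regular outer measure is represented by its restriction to the
  Borel sets; measurability with respect to the outer measure is measurability with respect to
  \<^term>\<open>completion M\<close>.

  Curves, upper gradients and Newtonian spaces are defined for the metric space \<^term>\<open>space M\<close>, so
  that \<open>M\<close> gives the notions on the whole space and \<^term>\<open>restrict_space M \<Omega>\<close> those on \<open>\<Omega>\<close>. Functions on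
  \<open>\<Omega>\<close> are total functions whose values outside \<open>\<Omega>\<close> are irrelevant.
\<close>

section \<open>Powers, averages, Lebesgue spaces\<close>

text \<open>Powers on \<open>[0,\<infinity>]\<close>; used for exponents \<open>p > 0\<close> only.\<close>
definition ennpowr :: "ennreal \<Rightarrow> real \<Rightarrow> ennreal" where
  "ennpowr x p = (if x = \<infinity> then \<infinity> else ennreal (enn2real x powr p))"

definition mean :: "'a measure \<Rightarrow> 'a set \<Rightarrow> ('a \<Rightarrow> real) \<Rightarrow> real" where
  "mean M E u = (LINT x:E|M. u x) / measure M E"

definition nn_mean :: "'a measure \<Rightarrow> 'a set \<Rightarrow> ('a \<Rightarrow> ennreal) \<Rightarrow> ennreal" where
  "nn_mean M E w = (\<integral>\<^sup>+x\<in>E. w x \<partial>M) / emeasure M E"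

definition Lp_norm :: "real \<Rightarrow> 'a measure \<Rightarrow> ('a \<Rightarrow> real) \<Rightarrow> ennreal" where
  "Lp_norm p M u = ennpowr (\<integral>\<^sup>+x. ennreal (\<bar>u x\<bar> powr p) \<partial>completion M) (1 / p)"

definition Lp :: "real \<Rightarrow> 'a measure \<Rightarrow> ('a \<Rightarrow> real) set" where
  "Lp p M = {u \<in> borel_measurable (completion M). Lp_norm p M u < \<infinity>}"

section \<open>Doubling measures and geodesic spaces\<close>

definition doubling :: "'a::metric_space measure \<Rightarrow> bool" where
  "doubling M \<longleftrightarrow> (\<exists>C\<ge>1. \<forall>x. \<forall>r>0.
     0 < emeasure M (ball x (2 * r)) \<and>
     emeasure M (ball x (2 * r)) \<le> ennreal C * emeasure M (ball x r) \<and>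
     ennreal C * emeasure M (ball x r) < \<infinity>)"

text \<open>A curve \<open>\<gamma> : [a,b] \<rightarrow> X\<close> is a triple \<open>(a, b, \<gamma>)\<close>; values of \<open>\<gamma>\<close> outside \<open>[a,b]\<close> are irrelevant.\<close>
type_synonym 'a curve = "real \<times> real \<times> (real \<Rightarrow> 'a)"

definition curve_length :: "'a::metric_space curve \<Rightarrow> ennreal" where
  "curve_length = (\<lambda>(a, b, \<gamma>).
     SUP (n, t) \<in> {(n::nat, t::nat \<Rightarrow> real). t 0 = a \<and> t n = b \<and> (\<forall>i<n. t i \<le> t (Suc i))}.
       \<Sum>i<n. ennreal (dist (\<gamma> (t i)) (\<gamma> (t (Suc i)))))"

definition geodesic_space :: "'a::metric_space itself \<Rightarrow> bool" where
  "geodesic_space _ \<longleftrightarrow> (\<forall>x y::'a. \<exists>a b \<gamma>. a \<le> b \<and> continuous_on {a..b} \<gamma> \<and> \<gamma> a = x \<and> \<gamma> b = y \<and>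
     curve_length (a, b, \<gamma>) = ennreal (dist x y))"

section \<open>Upper gradients\<close>

text \<open>The nonconstant compact rectifiable curves in \<open>S\<close>.\<close>
definition rect_curves :: "'a::metric_space set \<Rightarrow> 'a curve set" where
  "rect_curves S = {(a, b, \<gamma>). a \<le> b \<and> continuous_on {a..b} \<gamma> \<and> \<gamma> ` {a..b} \<subseteq> S \<and>
     curve_length (a, b, \<gamma>) < \<infinity> \<and> \<not> \<gamma> constant_on {a..b}}"

text \<open>
  \<open>arc_length_param c s\<close> is the point of \<open>c\<close> reached after length \<open>s\<close>. It does not depend on the
  chosen parameter, as \<open>\<gamma>\<close> is constant between two parameters with the same length.
\<close>
definition arc_length_param :: "'a::metric_space curve \<Rightarrow> real \<Rightarrow> 'a" where
  "arc_length_param = (\<lambda>(a, b, \<gamma>) s. \<gamma> (SOME t. t \<in> {a..b} \<and> curve_length (a, t, \<gamma>) = ennreal s))"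

definition curve_integral :: "('a::metric_space \<Rightarrow> ennreal) \<Rightarrow> 'a curve \<Rightarrow> ennreal" where
  "curve_integral h c =
     (\<integral>\<^sup>+s\<in>{0..enn2real (curve_length c)}. h (arc_length_param c s) \<partial>lborel)"

definition upper_gradient_along :: "('a::metric_space \<Rightarrow> real) \<Rightarrow> ('a \<Rightarrow> ennreal) \<Rightarrow> 'a curve \<Rightarrow> bool" where
  "upper_gradient_along u h = (\<lambda>(a, b, \<gamma>).
     ennreal \<bar>u (\<gamma> a) - u (\<gamma> b)\<bar> \<le> curve_integral h (a, b, \<gamma>))"

definition upper_gradient :: "'a::metric_space measure \<Rightarrow> ('a \<Rightarrow> real) \<Rightarrow> ('a \<Rightarrow> ennreal) \<Rightarrow> bool" where
  "upper_gradient M u h \<longleftrightarrow> h \<in> borel_measurable M \<and>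
     (\<forall>c \<in> rect_curves (space M). upper_gradient_along u h c)"

definition p_modulus :: "real \<Rightarrow> 'a::metric_space measure \<Rightarrow> 'a curve set \<Rightarrow> ennreal" where
  "p_modulus p M \<Gamma> = (INF \<rho> \<in> {\<rho> \<in> borel_measurable M. \<forall>c\<in>\<Gamma>. 1 \<le> curve_integral \<rho> c}.
     \<integral>\<^sup>+x. ennpowr (\<rho> x) p \<partial>M)"

definition weak_upper_gradient ::
    "real \<Rightarrow> 'a::metric_space measure \<Rightarrow> ('a \<Rightarrow> real) \<Rightarrow> ('a \<Rightarrow> ennreal) \<Rightarrow> bool" where
  "weak_upper_gradient p M u h \<longleftrightarrow> h \<in> borel_measurable M \<and>
     (\<exists>\<Gamma> \<subseteq> rect_curves (space M). p_modulus p M \<Gamma> = 0 \<and>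
       (\<forall>c \<in> rect_curves (space M) - \<Gamma>. upper_gradient_along u h c))"

text \<open>A representative of the \<open>p\<close>-weak upper gradient with smallest \<open>L\<^sup>p\<close> norm.\<close>
definition min_upper_gradient ::
    "real \<Rightarrow> 'a::metric_space measure \<Rightarrow> ('a \<Rightarrow> real) \<Rightarrow> 'a \<Rightarrow> ennreal" where
  "min_upper_gradient p M u = (SOME h. weak_upper_gradient p M u h \<and>
     (\<integral>\<^sup>+x. ennpowr (h x) p \<partial>M) < \<infinity> \<and>
     (\<forall>h'. weak_upper_gradient p M u h' \<longrightarrow>
        (\<integral>\<^sup>+x. ennpowr (h x) p \<partial>M) \<le> (\<integral>\<^sup>+x. ennpowr (h' x) p \<partial>M)))"

definition poincare_inequality :: "real \<Rightarrow> 'a::metric_space measure \<Rightarrow> bool" where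
  "poincare_inequality p M \<longleftrightarrow> (\<exists>C>0. \<exists>\<Lambda>\<ge>1. \<forall>u x r h.
     integrable (completion M) u \<longrightarrow> r > 0 \<longrightarrow> upper_gradient M u h \<longrightarrow>
     ennpowr (nn_mean (completion M) (ball x r)
         (\<lambda>y. ennreal (\<bar>u y - mean (completion M) (ball x r) u\<bar> powr p))) (1 / p)
       \<le> ennreal (C * r) * ennpowr (nn_mean M (ball x (\<Lambda> * r)) (\<lambda>y. ennpowr (h y) p)) (1 / p))"

section \<open>Newtonian spaces\<close>

definition newtonian :: "real \<Rightarrow> 'a::metric_space measure \<Rightarrow> ('a \<Rightarrow> real) set" where
  "newtonian p M = {u \<in> Lp p M.
     \<exists>h. weak_upper_gradient p M u h \<and> (\<integral>\<^sup>+x. ennpowr (h x) p \<partial>M) < \<infinity>}"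

definition newtonian_norm :: "real \<Rightarrow> 'a::metric_space measure \<Rightarrow> ('a \<Rightarrow> real) \<Rightarrow> ennreal" where
  "newtonian_norm p M u = ennpowr
     (\<integral>\<^sup>+x. ennreal (\<bar>u x\<bar> powr p) + ennpowr (min_upper_gradient p M u x) p \<partial>completion M) (1 / p)"

definition newtonian0 :: "real \<Rightarrow> 'a::metric_space measure \<Rightarrow> 'a set \<Rightarrow> ('a \<Rightarrow> real) set" where
  "newtonian0 p M \<Omega> = {u. \<exists>v \<in> newtonian p M. (\<forall>x. x \<notin> \<Omega> \<longrightarrow> v x = 0) \<and> (\<forall>x\<in>\<Omega>. u x = v x)}"

definition newtonian_loc :: "real \<Rightarrow> 'a::metric_space measure \<Rightarrow> ('a \<Rightarrow> real) set" where
  "newtonian_loc p M = {u. \<forall>x. \<exists>r>0. u \<in> newtonian p (restrict_space M (ball x r))}"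

section \<open>Cheeger differentiable structures\<close>

text \<open>
  Coordinate functions and Lipschitz functions are in \<open>N\<^sup>1\<^sup>,\<^sup>p\<close> only locally. For such a function the
  minimal \<open>p\<close>-weak upper gradient is the a.e. smallest one among those in \<open>L\<^sup>p\<^sub>l\<^sub>o\<^sub>c\<close>.
\<close>
definition locally_p_integrable :: "real \<Rightarrow> 'a::metric_space measure \<Rightarrow> ('a \<Rightarrow> ennreal) \<Rightarrow> bool" where
  "locally_p_integrable p M h \<longleftrightarrow> (\<forall>x. \<exists>r>0. (\<integral>\<^sup>+y\<in>ball x r. ennpowr (h y) p \<partial>M) < \<infinity>)"

definition min_upper_gradient_loc ::
    "real \<Rightarrow> 'a::metric_space measure \<Rightarrow> ('a \<Rightarrow> real) \<Rightarrow> 'a \<Rightarrow> ennreal" where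
  "min_upper_gradient_loc p M u = (SOME h. weak_upper_gradient p M u h \<and> locally_p_integrable p M h \<and>
     (\<forall>h'. weak_upper_gradient p M u h' \<longrightarrow> locally_p_integrable p M h' \<longrightarrow> (AE x in M. h x \<le> h' x)))"

text \<open>
  The value \<open>g\<^sub>u(x)\<close> at a given point, independent of the representative of \<open>g\<^sub>u\<close>. At a Lebesgue
  point of \<open>g\<^sub>u\<^sup>p\<close> the upper limit is a limit.
\<close>
definition min_upper_gradient_at ::
    "real \<Rightarrow> 'a::metric_space measure \<Rightarrow> ('a \<Rightarrow> real) \<Rightarrow> 'a \<Rightarrow> ennreal" where
  "min_upper_gradient_at p M u x = ennpowr (Limsup (at_right 0)
     (\<lambda>r. nn_mean M (ball x r) (\<lambda>y. ennpowr (min_upper_gradient_loc p M u y) p))) (1 / p)"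

definition lebesgue_point :: "'a::metric_space measure \<Rightarrow> ('a \<Rightarrow> ennreal) \<Rightarrow> 'a \<Rightarrow> bool" where
  "lebesgue_point M w x \<longleftrightarrow> (\<exists>c::real.
     ((\<lambda>r. nn_mean M (ball x r) (\<lambda>y. ennreal \<bar>enn2real (w y) - c\<bar>)) \<longlongrightarrow> 0) (at_right 0))"

definition newtonian_compact_support ::
    "real \<Rightarrow> 'a::metric_space measure \<Rightarrow> 'a set \<Rightarrow> ('a \<Rightarrow> real) set" where
  "newtonian_compact_support p M B =
     {\<phi> \<in> newtonian p M. compact (closure {x. \<phi> x \<noteq> 0}) \<and> closure {x. \<phi> x \<noteq> 0} \<subseteq> B}"

definition asymptotically_generalized_linear ::
    "real \<Rightarrow> 'a::metric_space measure \<Rightarrow> ('a \<Rightarrow> real) \<Rightarrow> 'a \<Rightarrow> bool" where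
  "asymptotically_generalized_linear p M u x \<longleftrightarrow> u \<in> newtonian_loc p M \<and>
     lebesgue_point M (\<lambda>y. ennpowr (min_upper_gradient_loc p M u y) p) x \<and>
     ((\<lambda>r. nn_mean M (ball x r) (\<lambda>y. ennpowr (min_upper_gradient_loc p M u y) p) -
         (INF \<phi> \<in> newtonian_compact_support p M (ball x r). nn_mean M (ball x r)
            (\<lambda>y. ennpowr (min_upper_gradient_loc p M (\<lambda>z. u z + \<phi> z) y) p))) \<longlongrightarrow> 0) (at_right 0)"

text \<open>
  The charts are \<open>U \<alpha>\<close> for \<open>\<alpha>\<close> in a set \<open>A\<close> of naturals. \<open>\<real>\<^sup>N\<close> is \<^typ>\<open>real^'n\<close>, and the subspace
  \<open>\<real>\<^bsup>N(\<alpha>)\<^esup>\<close> consists of the vectors supported on a set \<open>J \<alpha>\<close> of \<open>N(\<alpha>)\<close> coordinates.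
  The coordinate functions are \<open>F \<alpha> j\<close> for \<open>j \<in> J \<alpha>\<close>.
\<close>
definition coord_space :: "'n set \<Rightarrow> (real^'n) set" where
  "coord_space J = {a. \<forall>j. j \<notin> J \<longrightarrow> a $ j = 0}"

definition coord_comb :: "'n::finite set \<Rightarrow> ('n \<Rightarrow> 'a \<Rightarrow> real) \<Rightarrow> real^'n \<Rightarrow> 'a \<Rightarrow> real" where
  "coord_comb J F a y = (\<Sum>j\<in>J. a $ j * F j y)"

definition cheeger_charts :: "real \<Rightarrow> 'a::metric_space measure \<Rightarrow> nat set \<Rightarrow> (nat \<Rightarrow> 'a set) \<Rightarrow>
    (nat \<Rightarrow> 'n::finite set) \<Rightarrow> (nat \<Rightarrow> 'n \<Rightarrow> 'a \<Rightarrow> real) \<Rightarrow>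
    (nat \<Rightarrow> ('a \<Rightarrow> real) \<Rightarrow> 'a \<Rightarrow> real^'n) \<Rightarrow> bool" where
  "cheeger_charts p M A U J F D \<longleftrightarrow>
     (\<forall>\<alpha>\<in>A. U \<alpha> \<in> sets (completion M) \<and> 0 < emeasure (completion M) (U \<alpha>)) \<and>
     disjoint_family_on U A \<and>
     UNIV - (\<Union>\<alpha>\<in>A. U \<alpha>) \<in> null_sets (completion M) \<and>
     (\<forall>\<alpha>\<in>A.
       (\<forall>j\<in>J \<alpha>. 1-lipschitz_on UNIV (F \<alpha> j)) \<and>
       (\<forall>j\<in>J \<alpha>. \<forall>x\<in>U \<alpha>. asymptotically_generalized_linear p M (F \<alpha> j) x) \<and>
       (\<forall>a \<in> coord_space (J \<alpha>) - {0}. \<forall>x\<in>U \<alpha>.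
          0 < min_upper_gradient_at p M (coord_comb (J \<alpha>) (F \<alpha>) a) x) \<and>
       (\<forall>u. (\<exists>L. L-lipschitz_on UNIV u) \<longrightarrow>
          (\<exists>V \<subseteq> U \<alpha>. U \<alpha> - V \<in> null_sets (completion M) \<and>
             D \<alpha> u \<in> borel_measurable (restrict_space borel V) \<and>
             (\<forall>x\<in>V. D \<alpha> u x \<in> coord_space (J \<alpha>) \<and>
                (\<forall>a \<in> coord_space (J \<alpha>).
                   min_upper_gradient_at p M (\<lambda>y. coord_comb (J \<alpha>) (F \<alpha>) a y - u y) x = 0
                     \<longleftrightarrow> a = D \<alpha> u x)))))"

definition is_inner_product :: "(real^'n \<Rightarrow> real^'n \<Rightarrow> real) \<Rightarrow> bool" where
  "is_inner_product b \<longleftrightarrow> bilinear b \<and> (\<forall>v w. b v w = b w v) \<and> (\<forall>v. v \<noteq> 0 \<longrightarrow> 0 < b v v)"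

definition fibre_norm :: "('a \<Rightarrow> real^'n \<Rightarrow> real^'n \<Rightarrow> real) \<Rightarrow> 'a \<Rightarrow> real^'n \<Rightarrow> real" where
  "fibre_norm ip x v = sqrt (ip x v v)"

text \<open>
  The inner products \<open>ip x\<close> and the Cheeger gradient \<open>G\<close> of a structure. Measurability of
  \<open>x \<mapsto> ip x v w\<close> is what makes the integrals in the \<open>p\<close>-Poisson equation meaningful. As the
  \<open>U \<alpha>\<close> are disjoint, \<open>\<nabla>u = (\<Sum>\<alpha>. D\<^sup>\<alpha>u \<chi>\<^bsub>U\<alpha>\<^esub>)\<close> a.e. says \<open>\<nabla>u = D\<^sup>\<alpha>u\<close> a.e. in \<open>U \<alpha>\<close>.
\<close>
definition cheeger_gradient :: "real \<Rightarrow> 'a::metric_space measure \<Rightarrow> nat set \<Rightarrow> (nat \<Rightarrow> 'a set) \<Rightarrow>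
    (nat \<Rightarrow> ('a \<Rightarrow> real) \<Rightarrow> 'a \<Rightarrow> real^'n::finite) \<Rightarrow> ('a \<Rightarrow> real^'n \<Rightarrow> real^'n \<Rightarrow> real) \<Rightarrow>
    (('a \<Rightarrow> real) \<Rightarrow> 'a \<Rightarrow> real^'n) \<Rightarrow> bool" where
  "cheeger_gradient p M A U D ip G \<longleftrightarrow>
     (AE x in M. is_inner_product (ip x)) \<and>
     (\<forall>v w. (\<lambda>x. ip x v w) \<in> borel_measurable (completion M)) \<and>
     (\<forall>u \<in> newtonian p M. G u \<in> borel_measurable (completion M)) \<and>
     (\<forall>u \<in> newtonian p M. \<forall>v \<in> newtonian p M. \<forall>a b.
        AE x in M. G (\<lambda>y. a * u y + b * v y) x = a *\<^sub>R G u x + b *\<^sub>R G v x) \<and>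
     (\<exists>C::real. \<forall>u \<in> newtonian p M. Lp_norm p M (\<lambda>x. norm (G u x)) \<le> ennreal C * newtonian_norm p M u) \<and>
     (\<forall>u \<in> newtonian p M. (\<exists>L. L-lipschitz_on UNIV u) \<longrightarrow>
        (AE x in M. \<forall>\<alpha>\<in>A. x \<in> U \<alpha> \<longrightarrow> G u x = D \<alpha> u x)) \<and>
     (\<forall>u \<in> newtonian p M. \<forall>v \<in> newtonian p M.
        (\<exists>L. L-lipschitz_on UNIV u) \<longrightarrow> (\<exists>L. L-lipschitz_on UNIV v) \<longrightarrow>
        (\<lambda>y. u y * v y) \<in> newtonian p M \<longrightarrow>
        (AE x in M. G (\<lambda>y. u y * v y) x = u x *\<^sub>R G v x + v x *\<^sub>R G u x)) \<and>
     (\<forall>u \<in> newtonian p M. AE x in M.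
        ennreal (fibre_norm ip x (G u x)) \<le> min_upper_gradient p M u x \<and>
        min_upper_gradient p M u x \<le> ennreal (sqrt (real CARD('n)) * fibre_norm ip x (G u x)))"

definition lipschitz_cutoff :: "'a::metric_space set \<Rightarrow> ('a \<Rightarrow> real) \<Rightarrow> bool" where
  "lipschitz_cutoff \<Omega> \<eta> \<longleftrightarrow> (\<exists>L. L-lipschitz_on UNIV \<eta>) \<and> (\<forall>x. 0 \<le> \<eta> x \<and> \<eta> x \<le> 1) \<and>
     compact (closure {x. \<eta> x \<noteq> 0}) \<and> closure {x. \<eta> x \<noteq> 0} \<subseteq> \<Omega>"

text \<open>
  The gradient of \<open>u \<in> N\<^sup>1\<^sup>,\<^sup>p(\<Omega>)\<close>, defined a.e. in \<open>\<Omega>\<close> by locality. Since \<open>\<eta> = 0\<close> outside \<open>\<Omega>\<close>, the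
  product below is the zero extension of \<open>\<eta>u\<close>.
\<close>
definition cheeger_gradient_on :: "'a::metric_space measure \<Rightarrow> 'a set \<Rightarrow>
    (('a \<Rightarrow> real) \<Rightarrow> 'a \<Rightarrow> real^'n) \<Rightarrow> ('a \<Rightarrow> real) \<Rightarrow> 'a \<Rightarrow> real^'n" where
  "cheeger_gradient_on M \<Omega> G u = (SOME H. H \<in> borel_measurable (completion (restrict_space M \<Omega>)) \<and>
     (\<forall>\<eta>. lipschitz_cutoff \<Omega> \<eta> \<longrightarrow> (AE x in M. \<eta> x = 1 \<longrightarrow> H x = G (\<lambda>y. \<eta> y * u y) x)))"

section \<open>The \<open>p\<close>-Poisson equation\<close>

text \<open>
  With \<open>0 powr s = 0\<close>, the integrand on the left is \<open>0\<close> where \<open>\<nabla>u = 0\<close>, also for \<open>p < 2\<close>.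
\<close>
definition poisson_solution :: "real \<Rightarrow> 'a::metric_space measure \<Rightarrow> 'a set \<Rightarrow>
    ('a \<Rightarrow> real^'n \<Rightarrow> real^'n \<Rightarrow> real) \<Rightarrow> (('a \<Rightarrow> real) \<Rightarrow> 'a \<Rightarrow> real^'n) \<Rightarrow>
    ('a \<Rightarrow> real) \<Rightarrow> ('a \<Rightarrow> real) \<Rightarrow> ('a \<Rightarrow> real) \<Rightarrow> bool" where
  "poisson_solution p M \<Omega> ip G f g u \<longleftrightarrow>
     u \<in> newtonian p (restrict_space M \<Omega>) \<and>
     (\<lambda>x. u x - g x) \<in> newtonian0 p M \<Omega> \<and>
     (\<forall>\<phi> \<in> newtonian0 p M \<Omega>.
        (LINT x|completion (restrict_space M \<Omega>).
           fibre_norm ip x (cheeger_gradient_on M \<Omega> G u x) powr (p - 2) *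
           ip x (cheeger_gradient_on M \<Omega> G u x) (cheeger_gradient_on M \<Omega> G \<phi> x))
        = (LINT x|completion (restrict_space M \<Omega>). f x * \<phi> x))"

end

theory Submission
  imports Defs
begin

text \<open>
  The idea is to subtract the equations for \<open>u\<^sub>k\<close> and \<open>u\<close>, tested with
  \<open>\<phi> = (u\<^sub>k - u) - (g\<^sub>k - g)\<close>, which belongs to \<open>N\<^sub>0\<^sup>1\<^sup>,\<^sup>p(\<Omega>)\<close>. With \<open>A(v) = |v|\<^sup>p\<^sup>-\<^sup>2v\<close> this gives

  \<open>\<integral> \<langle>A(\<nabla>u\<^sub>k) - A(\<nabla>u), \<nabla>u\<^sub>k - \<nabla>u\<rangle> = \<integral> (f\<^sub>k - f) \<phi> + \<integral> \<langle>A(\<nabla>u\<^sub>k) - A(\<nabla>u), \<nabla>(g\<^sub>k - g)\<rangle>\<close>.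

  The left-hand side controls the \<open>p\<close>th power of \<open>|\<nabla>u\<^sub>k - \<nabla>u|\<close> up to an arbitrarily small multiple of
  the energies (\<open>flux_monotone\<close>). On the right-hand side, Young's inequality leaves a large multiple of the
  distances of the data and a small multiple of the energies, where the norm of \<open>\<phi>\<close> is bounded by its energy
  (\<open>Friedrichs_energy\<close>). The result is \<open>stability_estimate\<close>; the energy of \<open>u\<^sub>k\<close> is expressed
  there by those of \<open>u\<^sub>k - u\<close> and \<open>u\<close>, and the former can be absorbed on the left, so that the energy of
  \<open>u\<^sub>k - u\<close> tends to zero. The Friedrichs inequality for \<open>\<phi>\<close> and the comparison of the Cheeger
  gradient with the minimal weak upper gradient then give convergence in the Newtonian norm.

  For this argument the calculus of \<open>\<nabla>\<close> in \<open>\<Omega>\<close> has to be derived from that in the whole space. A function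
  \<open>u\<close> on \<open>\<Omega>\<close> is multiplied by cutoff functions, which exhaust \<open>\<Omega>\<close> because a complete doubling space
  is proper (\<open>doubling_proper\<close>). The products are Newtonian on the whole space (\<open>cutoff_newtonian\<close>), their
  gradients fit together because \<open>\<nabla>\<close> is local (\<open>G_local\<close>, \<open>gradient_spec\<close>), and a function that
  dominates their gradients is a weak upper gradient of \<open>u\<close> (\<open>weak_upper_gradient_from_cutoffs\<close>).

  All facts on weak upper gradients come from one description: outside an exceptional family, the
  upper gradient inequality holds on all pieces of a curve (\<open>weak_upper_gradient_iff\<close>). This reduces them to
  statements on functions on an interval whose oscillation between two points is bounded by an
  integral. The main one is \<open>oscillation_bound_glue\<close>: two bounds may be combined along any Borel set.
  So the minimum of two weak upper gradients is one, minimal weak upper gradients exist as decreasing limits,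
  and they are smallest almost everywhere.
\<close>

section \<open>Length of curves\<close>

lemma curve_length_upper:
  assumes "t 0 = a" "t n = b" "\<And>i. i < n \<Longrightarrow> t i \<le> t (Suc i)"
  shows "(\<Sum>i<n. ennreal (dist (\<gamma> (t i)) (\<gamma> (t (Suc i))))) \<le> curve_length (a, b, \<gamma>)"
  unfolding curve_length_def prod.case
  by (rule SUP_upper2[where i = "(n, t)"]) (use assms in auto)

lemma curve_length_least:
  assumes "\<And>n t. t 0 = a \<Longrightarrow> t n = b \<Longrightarrow> (\<And>i. i < n \<Longrightarrow> t i \<le> t (Suc i)) \<Longrightarrow>
    (\<Sum>i<n. ennreal (dist (\<gamma> (t i)) (\<gamma> (t (Suc i))))) \<le> X"
  shows "curve_length (a, b, \<gamma>) \<le> X"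
  unfolding curve_length_def prod.case by (rule SUP_least) (use assms in auto)

lemma dist_le_curve_length:
  assumes "a \<le> b"
  shows "ennreal (dist (\<gamma> a) (\<gamma> b)) \<le> curve_length (a, b, \<gamma>)"
  using curve_length_upper[of "\<lambda>i. if i = 0 then a else b" a 1 b \<gamma>] assms by auto

lemma partition_in_interval:
  fixes t :: "nat \<Rightarrow> real"
  assumes "t 0 = a" "t n = b" "\<And>i. i < n \<Longrightarrow> t i \<le> t (Suc i)" "i \<le> n"
  shows "a \<le> t i" "t i \<le> b"
proof -
  show "a \<le> t i"
    using assms(4)
  proof (induction i)
    case (Suc i)
    with assms(3)[of i] show ?case by simp
  qed (simp add: assms)
  show "t i \<le> b"
    using assms(4)
  proof (induction i rule: inc_induct)
    case (step i)
    with assms(3)[of i] show ?case by simp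
  qed (simp add: assms)
qed

lemma curve_length_refl [simp]: "curve_length (a, a, \<gamma>) = 0"
proof -
  have "curve_length (a, a, \<gamma>) \<le> 0"
  proof (rule curve_length_least)
    fix n t assume *: "t 0 = a" "t n = a" "\<And>i. i < n \<Longrightarrow> t i \<le> t (Suc i)"
    have "t i = a" if "i \<le> n" for i
      using partition_in_interval[OF *, of i] that by simp
    then have "(\<Sum>i<n. ennreal (dist (\<gamma> (t i)) (\<gamma> (t (Suc i))))) = 0" by simp
    then show "(\<Sum>i<n. ennreal (dist (\<gamma> (t i)) (\<gamma> (t (Suc i))))) \<le> 0" by (rule eq_refl)
  qed
  then show ?thesis by simp
qed

text \<open>A partition is cut at \<open>c\<close> by taking minima and maxima with \<open>c\<close>; this can only increase the
  sum, by the triangle inequality in the one step that crosses \<open>c\<close>.\<close>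
lemma curve_length_add:
  fixes \<gamma> :: "real \<Rightarrow> 'a::metric_space"
  assumes "a \<le> c" "c \<le> b"
  shows "curve_length (a, b, \<gamma>) = curve_length (a, c, \<gamma>) + curve_length (c, b, \<gamma>)"
proof (rule antisym)
  show "curve_length (a, b, \<gamma>) \<le> curve_length (a, c, \<gamma>) + curve_length (c, b, \<gamma>)"
  proof (rule curve_length_least)
    fix n and t :: "nat \<Rightarrow> real"
    assume *: "t 0 = a" "t n = b" "\<And>i. i < n \<Longrightarrow> t i \<le> t (Suc i)"
    let ?d = "\<lambda>x y. ennreal (dist (\<gamma> x) (\<gamma> y))"
    have step: "?d (t i) (t (Suc i)) \<le>
        ?d (min (t i) c) (min (t (Suc i)) c) + ?d (max (t i) c) (max (t (Suc i)) c)" if "i < n" for i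
    proof -
      have "dist (\<gamma> (t i)) (\<gamma> (t (Suc i))) \<le>
        dist (\<gamma> (min (t i) c)) (\<gamma> (min (t (Suc i)) c)) + dist (\<gamma> (max (t i) c)) (\<gamma> (max (t (Suc i)) c))"
        using *(3)[OF that] dist_triangle[of "\<gamma> (t i)" "\<gamma> (t (Suc i))" "\<gamma> c"]
        by (auto simp: min_def max_def)
      then show ?thesis
        by (simp add: ennreal_plus[symmetric] ennreal_leI del: ennreal_plus)
    qed
    have "(\<Sum>i<n. ?d (t i) (t (Suc i))) \<le>
      (\<Sum>i<n. ?d (min (t i) c) (min (t (Suc i)) c)) + (\<Sum>i<n. ?d (max (t i) c) (max (t (Suc i)) c))"
      unfolding sum.distrib[symmetric] by (rule sum_mono) (use step in auto)
    also have "\<dots> \<le> curve_length (a, c, \<gamma>) + curve_length (c, b, \<gamma>)"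
      using * assms
      by (intro add_mono curve_length_upper min.mono max.mono) (auto simp: min_def max_def)
    finally show "(\<Sum>i<n. ?d (t i) (t (Suc i))) \<le> curve_length (a, c, \<gamma>) + curve_length (c, b, \<gamma>)" .
  qed
next
  let ?d = "\<lambda>x y. ennreal (dist (\<gamma> x) (\<gamma> y))"
  let ?P = "\<lambda>a b. {(n::nat, t::nat \<Rightarrow> real). t 0 = a \<and> t n = b \<and> (\<forall>i<n. t i \<le> t (Suc i))}"
  let ?S = "\<lambda>(n::nat, t). \<Sum>i<n. ?d (t i) (t (Suc i))"
  have len: "curve_length (x, y, \<gamma>) = (SUP q\<in>?P x y. ?S q)" for x y
    by (simp add: curve_length_def)
  have ne: "?P x y \<noteq> {}" if "x \<le> y" for x y
  proof -
    have "(1, \<lambda>i. if i = 0 then x else y) \<in> ?P x y" using that by auto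
    then show ?thesis by blast
  qed
  have *: "?S q + ?S r \<le> curve_length (a, b, \<gamma>)" if qr: "q \<in> ?P a c" "r \<in> ?P c b" for q r
  proof -
    obtain n t where q: "q = (n, t)" and t: "t 0 = a" "t n = c" "\<And>i. i < n \<Longrightarrow> t i \<le> t (Suc i)"
      using qr(1) by auto
    obtain m s where r: "r = (m, s)" and s: "s 0 = c" "s m = b" "\<And>i. i < m \<Longrightarrow> s i \<le> s (Suc i)"
      using qr(2) by auto
    let ?w = "\<lambda>i. if i \<le> n then t i else s (i - n)"
    have "(\<Sum>i<n + m. ?d (?w i) (?w (Suc i))) = (\<Sum>i<n. ?d (?w i) (?w (Suc i))) +
        (\<Sum>i<m. ?d (?w (n + i)) (?w (Suc (n + i))))"
      by (induction m) (auto simp: add.assoc)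
    also have "(\<Sum>i<n. ?d (?w i) (?w (Suc i))) = (\<Sum>i<n. ?d (t i) (t (Suc i)))"
      by (intro sum.cong) auto
    also have "(\<Sum>i<m. ?d (?w (n + i)) (?w (Suc (n + i)))) = (\<Sum>i<m. ?d (s i) (s (Suc i)))"
      using s t by (intro sum.cong) (auto simp: Suc_diff_le)
    finally have "?S q + ?S r = (\<Sum>i<n + m. ?d (?w i) (?w (Suc i)))"
      by (simp add: q r)
    also have "\<dots> \<le> curve_length (a, b, \<gamma>)"
    proof (rule curve_length_upper)
      show "?w 0 = a" using t by simp
      show "?w (n + m) = b" using s t by auto
      fix i assume "i < n + m"
      consider "i < n" | "i = n" "0 < m" | "n < i" "i - n < m" using \<open>i < n + m\<close> by linarith
      then show "?w i \<le> ?w (Suc i)"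
      proof cases
        case 1 then show ?thesis using t by simp
      next
        case 2 then show ?thesis using t s(1) s(3)[of 0] by simp
      next
        case 3 then show ?thesis using s(3)[of "i - n"] by (simp add: Suc_diff_le)
      qed
    qed
    finally show ?thesis .
  qed
  have "curve_length (a, c, \<gamma>) + curve_length (c, b, \<gamma>) = (SUP q\<in>?P a c. ?S q + curve_length (c, b, \<gamma>))"
    unfolding len[of a c] by (rule ennreal_SUP_add_left[OF ne[OF assms(1)], symmetric])
  also have "\<dots> \<le> curve_length (a, b, \<gamma>)"
  proof (rule SUP_least)
    fix q assume q: "q \<in> ?P a c"
    have "?S q + curve_length (c, b, \<gamma>) = (SUP r\<in>?P c b. ?S q + ?S r)"
      unfolding len[of c b] by (rule ennreal_SUP_add_right[OF ne[OF assms(2)]])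
    also have "\<dots> \<le> curve_length (a, b, \<gamma>)"
      by (rule SUP_least) (rule *[OF q])
    finally show "?S q + curve_length (c, b, \<gamma>) \<le> curve_length (a, b, \<gamma>)" .
  qed
  finally show "curve_length (a, c, \<gamma>) + curve_length (c, b, \<gamma>) \<le> curve_length (a, b, \<gamma>)" .
qed

text \<open>Length is lower semicontinuous in each endpoint: the sum over a fixed partition depends
  continuously on the endpoint.\<close>
lemma curve_length_le_left_limit:
  fixes \<gamma> :: "real \<Rightarrow> 'a::metric_space"
  assumes cont: "continuous_on {a..b} \<gamma>" and "a < b"
    and le: "\<And>t. a \<le> t \<Longrightarrow> t < b \<Longrightarrow> curve_length (a, t, \<gamma>) \<le> X"
  shows "curve_length (a, b, \<gamma>) \<le> X"
proof (rule curve_length_least)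
  fix n and t :: "nat \<Rightarrow> real"
  assume t: "t 0 = a" "t n = b" "\<And>i. i < n \<Longrightarrow> t i \<le> t (Suc i)"
  let ?S = "\<lambda>x. \<Sum>i<n. dist (\<gamma> (min (t i) x)) (\<gamma> (min (t (Suc i)) x))"
  have g: "continuous_on {a..b} (\<lambda>x. \<gamma> (min (t i) x))" if "i \<le> n" for i
    by (rule continuous_on_compose2[OF cont])
      (use partition_in_interval[OF t that] in \<open>auto intro!: continuous_intros\<close>)
  have "continuous_on {a..b} ?S"
    by (intro continuous_on_sum continuous_on_dist g) auto
  then have "((\<lambda>x. ennreal (?S x)) \<longlongrightarrow> ennreal (?S b)) (at b within {a..b})"
    using \<open>a < b\<close> by (intro tendsto_ennrealI) (auto simp: continuous_on_def)
  moreover have "eventually (\<lambda>x. ennreal (?S x) \<le> X) (at b within {a..b})"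
    unfolding eventually_at_filter
  proof (rule always_eventually, safe)
    fix x assume "x \<noteq> b" "x \<in> {a..b}"
    then have x: "a \<le> x" "x < b" by auto
    have "ennreal (?S x) = (\<Sum>i<n. ennreal (dist (\<gamma> (min (t i) x)) (\<gamma> (min (t (Suc i)) x))))"
      by simp
    also have "\<dots> \<le> curve_length (a, x, \<gamma>)"
      using t x by (intro curve_length_upper min.mono) (auto simp: min_def)
    finally show "ennreal (?S x) \<le> X" using le[OF x] by simp
  qed
  moreover have "at b within {a..b} \<noteq> bot"
    using \<open>a < b\<close> by (simp add: at_within_Icc_at_left trivial_limit_at_left_real)
  ultimately have "ennreal (?S b) \<le> X"
    by (intro tendsto_upperbound)
  moreover have "?S b = (\<Sum>i<n. dist (\<gamma> (t i)) (\<gamma> (t (Suc i))))"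
    using partition_in_interval(2)[OF t] by (intro sum.cong refl) (simp add: min_absorb1 Suc_leI)
  ultimately show "(\<Sum>i<n. ennreal (dist (\<gamma> (t i)) (\<gamma> (t (Suc i))))) \<le> X"
    by simp
qed

lemma curve_length_le_right_limit:
  fixes \<gamma> :: "real \<Rightarrow> 'a::metric_space"
  assumes cont: "continuous_on {a..b} \<gamma>" and "a < b"
    and le: "\<And>t. a < t \<Longrightarrow> t \<le> b \<Longrightarrow> curve_length (t, b, \<gamma>) \<le> X"
  shows "curve_length (a, b, \<gamma>) \<le> X"
proof (rule curve_length_least)
  fix n and t :: "nat \<Rightarrow> real"
  assume t: "t 0 = a" "t n = b" "\<And>i. i < n \<Longrightarrow> t i \<le> t (Suc i)"
  let ?S = "\<lambda>x. \<Sum>i<n. dist (\<gamma> (max (t i) x)) (\<gamma> (max (t (Suc i)) x))"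
  have g: "continuous_on {a..b} (\<lambda>x. \<gamma> (max (t i) x))" if "i \<le> n" for i
    by (rule continuous_on_compose2[OF cont])
      (use partition_in_interval[OF t that] in \<open>auto intro!: continuous_intros\<close>)
  have "continuous_on {a..b} ?S"
    by (intro continuous_on_sum continuous_on_dist g) auto
  then have "((\<lambda>x. ennreal (?S x)) \<longlongrightarrow> ennreal (?S a)) (at a within {a..b})"
    using \<open>a < b\<close> by (intro tendsto_ennrealI) (auto simp: continuous_on_def)
  moreover have "eventually (\<lambda>x. ennreal (?S x) \<le> X) (at a within {a..b})"
    unfolding eventually_at_filter
  proof (rule always_eventually, safe)
    fix x assume "x \<noteq> a" "x \<in> {a..b}"
    then have x: "a < x" "x \<le> b" by auto
    have "ennreal (?S x) = (\<Sum>i<n. ennreal (dist (\<gamma> (max (t i) x)) (\<gamma> (max (t (Suc i)) x))))"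
      by simp
    also have "\<dots> \<le> curve_length (x, b, \<gamma>)"
      using t x by (intro curve_length_upper max.mono) (auto simp: max_def)
    finally show "ennreal (?S x) \<le> X" using le[OF x] by simp
  qed
  moreover have "at a within {a..b} \<noteq> bot"
    using \<open>a < b\<close> by (simp add: at_within_Icc_at_right trivial_limit_at_right_real)
  ultimately have "ennreal (?S a) \<le> X"
    by (intro tendsto_upperbound)
  moreover have "?S a = (\<Sum>i<n. dist (\<gamma> (t i)) (\<gamma> (t (Suc i))))"
    using partition_in_interval(1)[OF t] by (intro sum.cong refl) (simp add: max_absorb1 Suc_leI)
  ultimately show "(\<Sum>i<n. ennreal (dist (\<gamma> (t i)) (\<gamma> (t (Suc i))))) \<le> X"
    by simp
qed

lemma curve_length_mono:
  assumes "a \<le> s" "s \<le> t" "t \<le> b"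
  shows "curve_length (s, t, \<gamma>) \<le> curve_length (a, b, \<gamma>)"
  using curve_length_add[of a s b \<gamma>] curve_length_add[of s t b \<gamma>] assms
  by (simp add: add_increasing add_increasing2)

text \<open>The last parameter up to which the length is at most \<open>s\<close> has length exactly \<open>s\<close>: not more by
  semicontinuity from the left, and not less by semicontinuity of the remaining length.\<close>
lemma curve_length_surj:
  fixes \<gamma> :: "real \<Rightarrow> 'a::metric_space"
  assumes "a \<le> b" and cont: "continuous_on {a..b} \<gamma>" and fin: "curve_length (a, b, \<gamma>) < \<infinity>"
    and s: "s \<le> curve_length (a, b, \<gamma>)"
  shows "\<exists>t\<in>{a..b}. curve_length (a, t, \<gamma>) = s"
proof -
  define T where "T = Sup {t\<in>{a..b}. curve_length (a, t, \<gamma>) \<le> s}"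
  let ?A = "{t\<in>{a..b}. curve_length (a, t, \<gamma>) \<le> s}"
  have aA: "a \<in> ?A" using \<open>a \<le> b\<close> by simp
  have bdd: "bdd_above ?A" by (auto intro!: bdd_aboveI[of _ b])
  have T: "a \<le> T" "T \<le> b"
    unfolding T_def using aA bdd by (auto intro!: cSup_upper cSup_least)
  have below: "curve_length (a, t, \<gamma>) \<le> s" if t: "a \<le> t" "t < T" for t
  proof -
    obtain r where "r \<in> ?A" "t < r"
      using t less_cSup_iff[of ?A t] aA bdd unfolding T_def by blast
    then show ?thesis using curve_length_mono[of a a t r \<gamma>] t by (auto intro: order.trans)
  qed
  have above: "s < curve_length (a, t, \<gamma>)" if "T < t" "t \<le> b" for t
  proof (rule ccontr)
    assume "\<not> s < curve_length (a, t, \<gamma>)"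
    then have "t \<in> ?A" using that T by auto
    then have "t \<le> T" unfolding T_def by (rule cSup_upper[OF _ bdd])
    then show False using that by simp
  qed
  have le: "curve_length (a, T, \<gamma>) \<le> s"
  proof (cases "a = T")
    case False
    show ?thesis
    proof (rule curve_length_le_left_limit)
      show "continuous_on {a..T} \<gamma>" using T by (intro continuous_on_subset[OF cont]) auto
    qed (use T False below in auto)
  qed (metis curve_length_refl zero_le)
  have "s \<le> curve_length (a, T, \<gamma>)"
  proof (cases "T = b")
    case False
    have "curve_length (T, b, \<gamma>) \<le> curve_length (a, b, \<gamma>) - s"
    proof (rule curve_length_le_right_limit)
      fix t assume t: "T < t" "t \<le> b"
      have "s + curve_length (t, b, \<gamma>) \<le> curve_length (a, b, \<gamma>)"
        using above[OF t] curve_length_add[of a t b \<gamma>] t T by (simp add: add_right_mono)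
      then have "s + curve_length (t, b, \<gamma>) - s \<le> curve_length (a, b, \<gamma>) - s"
        by (rule ennreal_minus_mono) simp
      moreover have "s \<noteq> \<infinity>" using fin s by auto
      ultimately show "curve_length (t, b, \<gamma>) \<le> curve_length (a, b, \<gamma>) - s"
        by simp
    qed (use T False continuous_on_subset[OF cont, of "{T..b}"] in auto)
    then have "s + curve_length (T, b, \<gamma>) \<le> s + (curve_length (a, b, \<gamma>) - s)"
      by (rule add_left_mono)
    also have "\<dots> = curve_length (a, b, \<gamma>)" using s by (rule add_diff_inverse_ennreal)
    also have "\<dots> = curve_length (a, T, \<gamma>) + curve_length (T, b, \<gamma>)"
      using T by (rule curve_length_add)
    finally have "s + curve_length (T, b, \<gamma>) \<le> curve_length (a, T, \<gamma>) + curve_length (T, b, \<gamma>)" .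
    moreover have "curve_length (T, b, \<gamma>) < \<infinity>"
      using curve_length_mono[of a T b b \<gamma>] T fin by (auto intro: order.strict_trans1)
    ultimately show ?thesis
      by (metis add.commute ennreal_add_left_cancel_le infinity_ennreal_def less_irrefl)
  qed (use s in simp)
  with le T show ?thesis by (auto intro!: bexI[of _ T])
qed

section \<open>Arc length parametrization\<close>

lemma rect_curvesD:
  assumes "(a, b, \<gamma>) \<in> rect_curves S"
  shows "a \<le> b" "continuous_on {a..b} \<gamma>" "\<gamma> ` {a..b} \<subseteq> S" "curve_length (a, b, \<gamma>) < \<infinity>"
    "\<not> \<gamma> constant_on {a..b}"
  using assms by (auto simp: rect_curves_def)

definition real_length :: "'a::metric_space curve \<Rightarrow> real" where
  "real_length c = enn2real (curve_length c)"

lemma arc_length_param_obtain: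
  assumes c: "(a, b, \<gamma>) \<in> rect_curves S" and s: "0 \<le> s" "s \<le> real_length (a, b, \<gamma>)"
  obtains t where "t \<in> {a..b}" "curve_length (a, t, \<gamma>) = ennreal s"
    "arc_length_param (a, b, \<gamma>) s = \<gamma> t"
proof -
  note c = rect_curvesD[OF c]
  have "ennreal s \<le> curve_length (a, b, \<gamma>)"
    using s c(4) unfolding real_length_def
    by (metis ennreal_enn2real ennreal_leI infinity_ennreal_def)
  then have "\<exists>t. t \<in> {a..b} \<and> curve_length (a, t, \<gamma>) = ennreal s"
    using curve_length_surj[OF c(1,2,4)] by blast
  from someI_ex[OF this] show ?thesis
    by (intro that[of "SOME t. t \<in> {a..b} \<and> curve_length (a, t, \<gamma>) = ennreal s"])
      (auto simp: arc_length_param_def)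
qed

lemma arc_length_param_at_length:
  assumes c: "(a, b, \<gamma>) \<in> rect_curves S" and t: "t \<in> {a..b}" "curve_length (a, t, \<gamma>) = ennreal s"
    and "0 \<le> s"
  shows "arc_length_param (a, b, \<gamma>) s = \<gamma> t"
proof -
  note c' = rect_curvesD[OF c]
  have "ennreal s \<le> curve_length (a, b, \<gamma>)"
    using t curve_length_mono[of a a t b \<gamma>] by auto
  then have "s \<le> real_length (a, b, \<gamma>)"
    using c'(4) \<open>0 \<le> s\<close> unfolding real_length_def
    by (metis enn2real_mono enn2real_ennreal infinity_ennreal_def)
  then obtain r where r: "r \<in> {a..b}" "curve_length (a, r, \<gamma>) = ennreal s"
    "arc_length_param (a, b, \<gamma>) s = \<gamma> r"
    by (rule arc_length_param_obtain[OF c \<open>0 \<le> s\<close>])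
  have eq: "\<gamma> x = \<gamma> y" if "a \<le> x" "x \<le> y" "y \<le> b"
    "curve_length (a, x, \<gamma>) = ennreal s" "curve_length (a, y, \<gamma>) = ennreal s" for x y
  proof -
    have "ennreal s + curve_length (x, y, \<gamma>) = ennreal s + 0"
      using curve_length_add[of a x y \<gamma>] that by simp
    then have "curve_length (x, y, \<gamma>) = 0"
      by (metis ennreal_add_left_cancel ennreal_neq_top infinity_ennreal_def)
    then show ?thesis using dist_le_curve_length[of x y \<gamma>] that by simp
  qed
  have "\<gamma> r = \<gamma> t"
  proof (cases "r \<le> t")
    case True
    then show ?thesis using r(1) t by (intro eq r(2)) auto
  next
    case False
    then have "\<gamma> t = \<gamma> r" using r(1) t by (intro eq r(2)) auto
    then show ?thesis by simp
  qed
  then show ?thesis using r(3) by simp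
qed

text \<open>This transfers an inequality for the end points of all curves of a family to all subintervals of
  the arc length parameter of one curve.\<close>
lemma subcurve:
  assumes c: "(a, b, \<gamma>) \<in> rect_curves S" and st: "0 \<le> s" "s < t" "t \<le> real_length (a, b, \<gamma>)"
    and S': "arc_length_param (a, b, \<gamma>) ` {s..t} \<subseteq> S'"
  obtains x y where "(x, y, \<gamma>) \<in> rect_curves S'" "curve_length (x, y, \<gamma>) = ennreal (t - s)"
    "\<forall>r\<in>{0..t - s}. arc_length_param (x, y, \<gamma>) r = arc_length_param (a, b, \<gamma>) (s + r)"
    "\<gamma> x = arc_length_param (a, b, \<gamma>) s" "\<gamma> y = arc_length_param (a, b, \<gamma>) t"
proof -
  note c' = rect_curvesD[OF c]
  obtain x where x: "x \<in> {a..b}" "curve_length (a, x, \<gamma>) = ennreal s"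
    "arc_length_param (a, b, \<gamma>) s = \<gamma> x"
    by (rule arc_length_param_obtain[OF c, of s]) (use st in auto)
  obtain y where y: "y \<in> {a..b}" "curve_length (a, y, \<gamma>) = ennreal t"
    "arc_length_param (a, b, \<gamma>) t = \<gamma> y"
    by (rule arc_length_param_obtain[OF c, of t]) (use st in auto)
  have xy: "x \<le> y"
  proof (rule ccontr)
    assume "\<not> x \<le> y"
    then have "ennreal t \<le> ennreal s"
      using curve_length_mono[of a a y x \<gamma>] x y by simp
    then show False using st by (simp add: ennreal_le_iff)
  qed
  have len: "curve_length (x, z, \<gamma>) = ennreal (r - s)" if "x \<le> z" "z \<le> b" "0 \<le> r"
    "curve_length (a, z, \<gamma>) = ennreal r" for z r
  proof -
    have e: "ennreal r = ennreal s + curve_length (x, z, \<gamma>)"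
      using curve_length_add[of a x z \<gamma>] that x by simp
    have "ennreal s \<le> ennreal r" unfolding e by simp
    then have "s \<le> r" using that by (simp add: ennreal_le_iff)
    then have "ennreal r = ennreal s + ennreal (r - s)" using st by (simp add: ennreal_plus[symmetric] del: ennreal_plus)
    with e show ?thesis
      by (metis ennreal_add_left_cancel ennreal_neq_top infinity_ennreal_def)
  qed
  have lxy: "curve_length (x, y, \<gamma>) = ennreal (t - s)"
    using len[of y t] xy y st by auto
  have eqp: "arc_length_param (a, b, \<gamma>) (s + r) = \<gamma> z" if "z \<in> {x..y}" "curve_length (x, z, \<gamma>) = ennreal r" "0 \<le> r" for z r
  proof (rule arc_length_param_at_length[OF c])
    show "z \<in> {a..b}" using that x y by auto
    show "curve_length (a, z, \<gamma>) = ennreal (s + r)"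
      using curve_length_add[of a x z \<gamma>] that x st by (simp add: ennreal_plus)
  qed (use st that in simp)
  have img: "\<gamma> ` {x..y} \<subseteq> S'"
  proof safe
    fix z assume z: "z \<in> {x..y}"
    have "curve_length (x, z, \<gamma>) \<le> ennreal (t - s)"
      using curve_length_mono[of x x z y \<gamma>] z lxy by simp
    then obtain r where r: "curve_length (x, z, \<gamma>) = ennreal r" "0 \<le> r" "r \<le> t - s"
      using st by (cases "curve_length (x, z, \<gamma>)") (auto simp: ennreal_le_iff top_unique)
    then show "\<gamma> z \<in> S'"
      using eqp[OF z r(1,2)] S' st imageI[of "s + r" "{s..t}" "arc_length_param (a, b, \<gamma>)"] by auto
  qed
  have rc: "(x, y, \<gamma>) \<in> rect_curves S'"
  proof -
    have "\<not> \<gamma> constant_on {x..y}"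
    proof
      assume const: "\<gamma> constant_on {x..y}"
      have "curve_length (x, y, \<gamma>) \<le> 0"
      proof (rule curve_length_least)
        fix n q assume q: "q 0 = x" "q n = y" "\<And>i. i < n \<Longrightarrow> q i \<le> q (Suc i)"
        have "(\<Sum>i<n. ennreal (dist (\<gamma> (q i)) (\<gamma> (q (Suc i))))) = 0"
        proof (rule sum.neutral, safe)
          fix i assume "i < n"
          then have "q i \<in> {x..y}" "q (Suc i) \<in> {x..y}"
            using partition_in_interval[OF q, of i] partition_in_interval[OF q, of "Suc i"] by auto
          then show "ennreal (dist (\<gamma> (q i)) (\<gamma> (q (Suc i)))) = 0"
            using const unfolding constant_on_def by force
        qed
        then show "(\<Sum>i<n. ennreal (dist (\<gamma> (q i)) (\<gamma> (q (Suc i))))) \<le> 0" by (rule eq_refl)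
      qed
      then show False using lxy st by simp
    qed
    then show ?thesis
      using xy img lxy continuous_on_subset[OF c'(2), of "{x..y}"] x y by (auto simp: rect_curves_def)
  qed
  show ?thesis
  proof (rule that[OF rc lxy], rule ballI)
    fix r assume "r \<in> {0..t - s}"
    then have r: "0 \<le> r" "r \<le> t - s" by auto
    then have "r \<le> real_length (x, y, \<gamma>)" using lxy st by (simp add: real_length_def)
    then obtain z where "z \<in> {x..y}" "curve_length (x, z, \<gamma>) = ennreal r" "arc_length_param (x, y, \<gamma>) r = \<gamma> z"
      by (rule arc_length_param_obtain[OF rc r(1)])
    then show "arc_length_param (x, y, \<gamma>) r = arc_length_param (a, b, \<gamma>) (s + r)"
      using eqp r by simp
  qed (use x y in simp_all)
qed

text \<open>
  Pieces of arc length parametrizations of rectifiable curves. All curve families below are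
  described through them: they are Lipschitz, and pieces of pieces are pieces.
\<close>
definition arcs :: "'a::metric_space set \<Rightarrow> ((real \<Rightarrow> 'a) \<times> real \<times> real) set" where
  "arcs S = {(\<sigma>, s, t). s \<le> t \<and> \<sigma> ` {s..t} \<subseteq> S \<and>
     (\<exists>c \<in> rect_curves UNIV. 0 \<le> s \<and> t \<le> real_length c \<and> \<sigma> = arc_length_param c)}"

lemma arcs_subinterval:
  assumes "(\<sigma>, s, t) \<in> arcs S" "s \<le> s'" "s' \<le> t'" "t' \<le> t"
  shows "(\<sigma>, s', t') \<in> arcs S"
proof -
  have "{s'..t'} \<subseteq> {s..t}" using assms by auto
  then have "\<sigma> ` {s'..t'} \<subseteq> S" using assms unfolding arcs_def by blast
  moreover obtain c where "c \<in> rect_curves UNIV" "0 \<le> s" "t \<le> real_length c" "\<sigma> = arc_length_param c"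
    using assms(1) unfolding arcs_def by blast
  ultimately show ?thesis
    using assms(2-4) unfolding arcs_def by (auto intro!: bexI[of _ c])
qed

lemma arcs_subset:
  assumes "(\<sigma>, s, t) \<in> arcs S" "\<sigma> ` {s..t} \<subseteq> S'"
  shows "(\<sigma>, s, t) \<in> arcs S'"
  using assms by (auto simp: arcs_def)

lemma arcs_mono: "S \<subseteq> S' \<Longrightarrow> arcs S \<subseteq> arcs S'"
  by (auto simp: arcs_def)

lemma arcs_in: "(\<sigma>, s, t) \<in> arcs S \<Longrightarrow> r \<in> {s..t} \<Longrightarrow> \<sigma> r \<in> S"
  by (auto simp: arcs_def)

lemma arcs_lipschitz:
  assumes "(\<sigma>, s, t) \<in> arcs S"
  shows "1-lipschitz_on {s..t} \<sigma>"
proof -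
  obtain a b \<gamma> where c: "(a, b, \<gamma>) \<in> rect_curves UNIV" and st: "0 \<le> s" "t \<le> real_length (a, b, \<gamma>)"
    and \<sigma>: "\<sigma> = arc_length_param (a, b, \<gamma>)"
    using assms by (auto simp: arcs_def)
  have *: "dist (\<sigma> x) (\<sigma> y) \<le> y - x" if xy': "s \<le> x" "x < y" "y \<le> t" for x y
  proof -
    have xy: "0 \<le> x" "y \<le> real_length (a, b, \<gamma>)" using xy' st by auto
    obtain x' y' where "(x', y', \<gamma>) \<in> rect_curves UNIV" "curve_length (x', y', \<gamma>) = ennreal (y - x)"
       "\<gamma> x' = \<sigma> x" "\<gamma> y' = \<sigma> y"
      unfolding \<sigma> by (rule subcurve[OF c xy(1) xy'(2) xy(2) subset_UNIV])
    then show ?thesis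
      using dist_le_curve_length[of x' y' \<gamma>] rect_curvesD(1)[of x' y' \<gamma> UNIV] xy'
      by (simp add: ennreal_le_iff)
  qed
  show ?thesis
  proof (rule lipschitz_onI)
    fix x y assume "x \<in> {s..t}" "y \<in> {s..t}"
    then show "dist (\<sigma> x) (\<sigma> y) \<le> 1 * dist x y"
      using *[of x y] *[of y x] by (cases x y rule: linorder_cases) (auto simp: dist_real_def dist_commute)
  qed simp
qed

lemma arcs_continuous: "(\<sigma>, s, t) \<in> arcs S \<Longrightarrow> continuous_on {s..t} \<sigma>"
  using arcs_lipschitz lipschitz_on_continuous_on by blast

section \<open>Powers and \<open>p\<close>-integrable functions\<close>

lemma ennpowr_ennreal [simp]: "0 \<le> x \<Longrightarrow> ennpowr (ennreal x) p = ennreal (x powr p)"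
  by (simp add: ennpowr_def)

lemma ennpowr_top [simp]: "ennpowr top p = top" "ennpowr \<infinity> p = top"
  by (simp_all add: ennpowr_def)

lemma ennpowr_zero [simp]: "ennpowr 0 p = 0"
  using ennpowr_ennreal[of 0 p] by simp

lemma ennpowr_mono:
  assumes "0 \<le> p" "x \<le> y"
  shows "ennpowr x p \<le> ennpowr y p"
  using assms by (cases x; cases y) (auto intro!: ennreal_leI powr_mono2 simp: top_unique)

lemma ennpowr_mult: "ennpowr (x * y) p = ennpowr x p * ennpowr y p"
proof -
  have top: "ennpowr (top * y) p = top * ennpowr y p" for y
    by (cases "y = 0") (simp_all add: ennreal_top_mult, cases y, auto simp: ennreal_top_mult ennreal_eq_0_iff powr_def)
  show ?thesis
  proof (cases "x = top \<or> y = top")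
    case True
    then show ?thesis using top[of x] top[of y] by (auto simp: mult.commute)
  next
    case False
    then show ?thesis
      by (cases x; cases y) (auto simp: ennreal_mult[symmetric] powr_mult)
  qed
qed

lemma ennpowr_ennpowr_inverse:
  assumes "0 < p"
  shows "ennpowr (ennpowr x (1 / p)) p = x" "ennpowr (ennpowr x p) (1 / p) = x"
  using assms by (cases x; simp add: powr_powr)+

lemma ennpowr_less_top_iff [simp]: "ennpowr x p < top \<longleftrightarrow> x < top"
  by (cases x) auto

lemma ennpowr_eq_top_iff [simp]: "ennpowr x p = top \<longleftrightarrow> x = top"
  by (cases x) auto

lemma ennpowr_eq_0_iff [simp]: "ennpowr x p = 0 \<longleftrightarrow> x = 0"
  by (cases x) (auto simp: ennreal_eq_0_iff powr_def)

lemma borel_measurable_ennpowr [measurable]: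
  "(\<lambda>x. ennpowr x p) \<in> borel_measurable borel"
  unfolding ennpowr_def by measurable

lemma borel_measurable_ennpowr' [measurable (raw)]:
  "f \<in> borel_measurable M \<Longrightarrow> (\<lambda>x. ennpowr (f x) p) \<in> borel_measurable M"
  by (rule measurable_compose[OF _ borel_measurable_ennpowr])

definition p_integrable :: "real \<Rightarrow> 'a measure \<Rightarrow> ('a \<Rightarrow> ennreal) \<Rightarrow> bool" where
  "p_integrable p N \<rho> \<longleftrightarrow> \<rho> \<in> borel_measurable N \<and> (\<integral>\<^sup>+x. ennpowr (\<rho> x) p \<partial>N) < \<infinity>"

lemma p_integrable_mono:
  assumes "0 \<le> p" "p_integrable p N \<rho>" "\<rho>' \<in> borel_measurable N" "AE x in N. \<rho>' x \<le> \<rho> x"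
  shows "p_integrable p N \<rho>'"
proof -
  have "(\<integral>\<^sup>+x. ennpowr (\<rho>' x) p \<partial>N) \<le> (\<integral>\<^sup>+x. ennpowr (\<rho> x) p \<partial>N)"
    using assms(4) by (intro nn_integral_mono_AE) (auto intro: ennpowr_mono[OF assms(1)])
  with assms show ?thesis by (auto simp: p_integrable_def intro: order.strict_trans1)
qed

lemma p_integrable_cmult:
  assumes "0 \<le> p" "p_integrable p N \<rho>" "c < \<infinity>"
  shows "p_integrable p N (\<lambda>x. c * \<rho> x)"
proof -
  have "(\<integral>\<^sup>+x. ennpowr (c * \<rho> x) p \<partial>N) = ennpowr c p * (\<integral>\<^sup>+x. ennpowr (\<rho> x) p \<partial>N)"
    using assms by (subst nn_integral_cmult[symmetric]) (auto simp: ennpowr_mult p_integrable_def)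
  with assms show ?thesis
    by (auto simp: p_integrable_def ennreal_mult_less_top)
qed

text \<open>The dominating function is the pointwise \<open>\<ell>\<^sup>p\<close> sum, because the integral of its \<open>p\<close>th power is
  the sum of the integrals.\<close>
lemma p_integrable_dominating:
  assumes "0 < p" "\<And>n::nat. \<rho> n \<in> borel_measurable N"
    and "(\<Sum>n. \<integral>\<^sup>+x. ennpowr (\<rho> n x) p \<partial>N) < \<infinity>"
  shows "\<exists>\<rho>'. p_integrable p N \<rho>' \<and> (\<forall>n x. \<rho> n x \<le> \<rho>' x)"
proof -
  let ?r = "\<lambda>x. ennpowr (\<Sum>n. ennpowr (\<rho> n x) p) (1 / p)"
  have [measurable]: "\<rho> n \<in> borel_measurable N" for n by fact
  have "(\<integral>\<^sup>+x. ennpowr (?r x) p \<partial>N) = (\<Sum>n. \<integral>\<^sup>+x. ennpowr (\<rho> n x) p \<partial>N)"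
    using assms(1) by (simp add: ennpowr_ennpowr_inverse nn_integral_suminf)
  then have "p_integrable p N ?r" using assms by (simp add: p_integrable_def)
  moreover have "\<rho> n x \<le> ?r x" for n x
  proof -
    have "ennpowr (\<rho> n x) p \<le> (\<Sum>n. ennpowr (\<rho> n x) p)"
      using sum_le_suminf[of "\<lambda>n. ennpowr (\<rho> n x) p" "{n}"] by auto
    then have "ennpowr (ennpowr (\<rho> n x) p) (1 / p) \<le> ?r x"
      using assms by (intro ennpowr_mono) auto
    then show ?thesis using assms by (simp add: ennpowr_ennpowr_inverse)
  qed
  ultimately show ?thesis by blast
qed

lemma suminf_half_ennreal: "(\<Sum>n. ennreal ((1 / 2) ^ n)) < \<infinity>"
proof -
  have "(\<Sum>n. ennreal ((1 / 2) ^ n)) = ennreal (\<Sum>n. (1 / 2) ^ n)"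
    by (intro suminf_ennreal2) (auto intro: summable_geometric)
  then show ?thesis by simp
qed

text \<open>Scaling by small constants makes the integrals of any sequence summable, and does not affect which
  integrals along curves are finite.\<close>
lemma p_integrable_dominating_scaled:
  assumes "0 < p" "\<And>n::nat. p_integrable p N (\<rho> n)"
  shows "\<exists>\<rho>' \<delta>. p_integrable p N \<rho>' \<and> (\<forall>n. 0 < \<delta> n) \<and> (\<forall>n x. ennreal (\<delta> n) * \<rho> n x \<le> \<rho>' x)"
proof -
  define I where "I n = enn2real (\<integral>\<^sup>+x. ennpowr (\<rho> n x) p \<partial>N)" for n
  have I: "(\<integral>\<^sup>+x. ennpowr (\<rho> n x) p \<partial>N) = ennreal (I n)" "0 \<le> I n" for n
    using assms(2)[of n] by (auto simp: I_def p_integrable_def)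
  define \<delta> where "\<delta> n = ((1 / 2) ^ n / (1 + I n)) powr (1 / p)" for n
  have pos: "0 < (1 / 2) ^ n / (1 + I n)" for n using I(2)[of n] by auto
  have \<delta>: "0 < \<delta> n" "\<delta> n powr p = (1 / 2) ^ n / (1 + I n)" for n
    using pos[of n] assms(1) I(2)[of n] by (auto simp: \<delta>_def powr_powr)
  have [measurable]: "\<rho> n \<in> borel_measurable N" for n
    using assms(2) by (simp add: p_integrable_def)
  have "(\<integral>\<^sup>+x. ennpowr (ennreal (\<delta> n) * \<rho> n x) p \<partial>N) \<le> ennreal ((1 / 2) ^ n)" for n
  proof -
    have "(\<integral>\<^sup>+x. ennpowr (ennreal (\<delta> n) * \<rho> n x) p \<partial>N) = ennreal (\<delta> n powr p) * ennreal (I n)"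
      using assms(1) \<delta>(1)[of n] by (simp add: ennpowr_mult less_imp_le nn_integral_cmult I)
    also have "\<dots> = ennreal ((1 / 2) ^ n * (I n / (1 + I n)))"
      using I(2)[of n] by (simp add: \<delta> ennreal_mult[symmetric] field_simps)
    also have "\<dots> \<le> ennreal ((1 / 2) ^ n)"
      using I(2)[of n] by (intro ennreal_leI mult_right_le_one_le) auto
    finally show ?thesis .
  qed
  then have "(\<Sum>n. \<integral>\<^sup>+x. ennpowr (ennreal (\<delta> n) * \<rho> n x) p \<partial>N) \<le> (\<Sum>n. ennreal ((1 / 2) ^ n))"
    by (intro suminf_le) auto
  then have "(\<Sum>n. \<integral>\<^sup>+x. ennpowr (ennreal (\<delta> n) * \<rho> n x) p \<partial>N) < \<infinity>"
    using suminf_half_ennreal by (rule order.strict_trans1)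
  from p_integrable_dominating[OF assms(1) _ this] \<delta>(1) show ?thesis by auto
qed

section \<open>Integrals along arcs\<close>

text \<open>The measures for which the theory of upper gradients is developed: Borel measures on a metric
  subspace. Both the whole space and an open subset are of this form.\<close>
definition borel_on :: "'a::metric_space measure \<Rightarrow> bool" where
  "borel_on N \<longleftrightarrow> sets N = sets (restrict_space borel (space N))"

abbreviation arc_integral :: "('a \<Rightarrow> ennreal) \<Rightarrow> (real \<Rightarrow> 'a) \<Rightarrow> real \<Rightarrow> real \<Rightarrow> ennreal" where
  "arc_integral h \<sigma> s t \<equiv> (\<integral>\<^sup>+r\<in>{s..t}. h (\<sigma> r) \<partial>lborel)"

lemma arc_measurable:
  fixes h :: "'a::metric_space \<Rightarrow> ennreal"
  assumes "borel_on N" "(\<sigma>, s, t) \<in> arcs (space N)" "h \<in> borel_measurable N"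
  shows "(\<lambda>r. h (\<sigma> r) * indicator {s..t} r) \<in> borel_measurable borel"
proof -
  have "\<sigma> \<in> restrict_space borel {s..t} \<rightarrow>\<^sub>M borel"
    using arcs_continuous[OF assms(2)] by (rule borel_measurable_continuous_on_restrict)
  then have "\<sigma> \<in> restrict_space borel {s..t} \<rightarrow>\<^sub>M restrict_space borel (space N)"
    using arcs_in[OF assms(2)] by (intro measurable_restrict_space2) (auto simp: space_restrict_space)
  moreover have "h \<in> borel_measurable (restrict_space borel (space N))"
    using assms(1,3) measurable_cong_sets[of N "restrict_space borel (space N)" borel borel]
    by (simp add: borel_on_def)
  ultimately have "(\<lambda>r. h (\<sigma> r)) \<in> borel_measurable (restrict_space borel {s..t})"
    by (rule measurable_compose)
  then show ?thesis by (subst (asm) borel_measurable_restrict_space_iff_ennreal) auto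
qed

lemma arc_integral_mono:
  assumes "(\<sigma>, s, t) \<in> arcs S" "\<And>x. x \<in> S \<Longrightarrow> h x \<le> k x"
  shows "arc_integral h \<sigma> s t \<le> arc_integral k \<sigma> s t"
  using assms arcs_in[OF assms(1)] by (intro nn_integral_mono) (auto split: split_indicator)

lemma arc_measurable_lborel:
  fixes h :: "'a::metric_space \<Rightarrow> ennreal"
  assumes "borel_on N" "(\<sigma>, s, t) \<in> arcs (space N)" "h \<in> borel_measurable N"
  shows "(\<lambda>r. h (\<sigma> r) * indicator {s..t} r) \<in> borel_measurable lborel"
  using arc_measurable[OF assms] by simp

lemma arc_integral_cmult:
  assumes "borel_on N" "(\<sigma>, s, t) \<in> arcs (space N)" "h \<in> borel_measurable N"
  shows "arc_integral (\<lambda>x. c * h x) \<sigma> s t = c * arc_integral h \<sigma> s t"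
  using nn_integral_cmult[OF arc_measurable_lborel[OF assms], of c] by (simp add: mult.assoc)

lemma arc_integral_add:
  assumes "borel_on N" "(\<sigma>, s, t) \<in> arcs (space N)" "h \<in> borel_measurable N" "k \<in> borel_measurable N"
  shows "arc_integral (\<lambda>x. h x + k x) \<sigma> s t = arc_integral h \<sigma> s t + arc_integral k \<sigma> s t"
  using nn_integral_add[OF arc_measurable_lborel[OF assms(1-3)] arc_measurable_lborel[OF assms(1,2,4)]]
  by (simp add: distrib_right)

lemma arc_integral_subinterval:
  assumes "s \<le> s'" "t' \<le> t"
  shows "arc_integral h \<sigma> s' t' \<le> arc_integral h \<sigma> s t"
  using assms by (intro nn_integral_mono) (auto split: split_indicator)

lemma whole_curve_arc:
  assumes c: "(a, b, \<gamma>) \<in> rect_curves S"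
  shows "(arc_length_param (a, b, \<gamma>), 0, real_length (a, b, \<gamma>)) \<in> arcs S"
    and "arc_length_param (a, b, \<gamma>) 0 = \<gamma> a"
    and "arc_length_param (a, b, \<gamma>) (real_length (a, b, \<gamma>)) = \<gamma> b"
    and "curve_integral h (a, b, \<gamma>) =
      arc_integral h (arc_length_param (a, b, \<gamma>)) 0 (real_length (a, b, \<gamma>))"
proof -
  note c' = rect_curvesD[OF c]
  have "\<exists>x\<in>{a..b}. arc_length_param (a, b, \<gamma>) r = \<gamma> x"
    if "0 \<le> r" "r \<le> real_length (a, b, \<gamma>)" for r
    using arc_length_param_obtain[OF c that] by metis
  moreover have "(a, b, \<gamma>) \<in> rect_curves UNIV" using c by (simp add: rect_curves_def)
  moreover have "0 \<le> real_length (a, b, \<gamma>)" by (simp add: real_length_def)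
  ultimately show "(arc_length_param (a, b, \<gamma>), 0, real_length (a, b, \<gamma>)) \<in> arcs S"
    using c'(3) unfolding arcs_def by fastforce
  show "arc_length_param (a, b, \<gamma>) 0 = \<gamma> a"
    by (rule arc_length_param_at_length[OF c]) (use c' in auto)
  show "arc_length_param (a, b, \<gamma>) (real_length (a, b, \<gamma>)) = \<gamma> b"
    by (rule arc_length_param_at_length[OF c]) (use c' in \<open>auto simp: real_length_def\<close>)
  show "curve_integral h (a, b, \<gamma>) =
      arc_integral h (arc_length_param (a, b, \<gamma>)) 0 (real_length (a, b, \<gamma>))"
    by (simp add: curve_integral_def real_length_def)
qed

lemma arc_is_curve:
  assumes arc: "(\<sigma>, s, t) \<in> arcs S" and "s < t"
  obtains a b \<gamma> where "(a, b, \<gamma>) \<in> rect_curves S" "\<gamma> a = \<sigma> s" "\<gamma> b = \<sigma> t"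
    "\<forall>N h. borel_on N \<longrightarrow> space N = S \<longrightarrow> h \<in> borel_measurable N \<longrightarrow>
      curve_integral h (a, b, \<gamma>) = arc_integral h \<sigma> s t"
proof -
  obtain a b \<gamma> where c: "(a, b, \<gamma>) \<in> rect_curves UNIV" and st: "0 \<le> s" "t \<le> real_length (a, b, \<gamma>)"
    and \<sigma>: "\<sigma> = arc_length_param (a, b, \<gamma>)" and S: "\<sigma> ` {s..t} \<subseteq> S"
    using arc by (auto simp: arcs_def)
  obtain x y where xy: "(x, y, \<gamma>) \<in> rect_curves S" "curve_length (x, y, \<gamma>) = ennreal (t - s)"
    "\<forall>r\<in>{0..t - s}. arc_length_param (x, y, \<gamma>) r = \<sigma> (s + r)"
    "\<gamma> x = \<sigma> s" "\<gamma> y = \<sigma> t"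
    by (rule subcurve[OF c st(1) \<open>s < t\<close> st(2) S[unfolded \<sigma>], folded \<sigma>])
  show ?thesis
  proof (rule that[OF xy(1,4,5)], intro allI impI)
    fix N :: "'a measure" and h :: "'a \<Rightarrow> ennreal"
    assume N: "borel_on N" "space N = S" "h \<in> borel_measurable N"
    have m: "(\<lambda>r. h (\<sigma> r) * indicator {s..t} r) \<in> borel_measurable borel"
      using arc_measurable[of N \<sigma> s t h] N arc by simp
    have "arc_integral h \<sigma> s t = (\<integral>\<^sup>+r. h (\<sigma> (s + 1 * r)) * indicator {s..t} (s + 1 * r) \<partial>lborel)"
      by (subst nn_integral_real_affine[OF m, of 1 s]) auto
    also have "\<dots> = (\<integral>\<^sup>+r\<in>{0..t - s}. h (arc_length_param (x, y, \<gamma>) r) \<partial>lborel)"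
      using xy(3) by (intro nn_integral_cong) (auto split: split_indicator)
    also have "\<dots> = curve_integral h (x, y, \<gamma>)"
      using xy(2) \<open>s < t\<close> by (simp add: curve_integral_def)
    finally show "curve_integral h (x, y, \<gamma>) = arc_integral h \<sigma> s t" ..
  qed
qed

section \<open>Weak upper gradients on arcs\<close>

text \<open>The exceptional family is encoded by a function \<open>\<rho>\<close>: it consists of the curves along which the
  integral of \<open>\<rho>\<close> is infinite.\<close>
definition gradient_off :: "'a::metric_space measure \<Rightarrow> ('a \<Rightarrow> ennreal) \<Rightarrow> ('a \<Rightarrow> real) \<Rightarrow> ('a \<Rightarrow> ennreal) \<Rightarrow> bool" where
  "gradient_off N \<rho> u h \<longleftrightarrow> (\<forall>(\<sigma>, s, t) \<in> arcs (space N). arc_integral \<rho> \<sigma> s t < \<infinity> \<longrightarrow>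
     ennreal \<bar>u (\<sigma> s) - u (\<sigma> t)\<bar> \<le> arc_integral h \<sigma> s t)"

lemma gradient_offD:
  assumes "gradient_off N \<rho> u h" "(\<sigma>, s, t) \<in> arcs (space N)" "arc_integral \<rho> \<sigma> s t < \<infinity>"
  shows "ennreal \<bar>u (\<sigma> s) - u (\<sigma> t)\<bar> \<le> arc_integral h \<sigma> s t"
  using assms by (auto simp: gradient_off_def)

text \<open>A family of modulus zero has admissible functions \<open>\<rho>\<^sub>n\<close> with arbitrarily small integrals, and a
  \<open>p\<close>-integrable function above all \<open>n\<rho>\<^sub>n\<close> has infinite integral along each curve of the
  family. Conversely, all positive multiples of such a function are admissible.\<close>
lemma modulus_zero_iff:
  assumes "0 < p" "borel_on N" and \<Gamma>: "\<Gamma> \<subseteq> rect_curves (space N)"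
  shows "p_modulus p N \<Gamma> = 0 \<longleftrightarrow> (\<exists>\<rho>. p_integrable p N \<rho> \<and> (\<forall>c\<in>\<Gamma>. curve_integral \<rho> c = \<infinity>))"
proof
  assume 0: "p_modulus p N \<Gamma> = 0"
  \<comment> \<open>small enough that the integrals of the \<open>p\<close>th powers of the multiples by \<open>n + 1\<close> are summable\<close>
  let ?e = "\<lambda>n. (1 / 2) ^ n / real (Suc n) powr p"
  have "\<exists>\<rho>. \<rho> \<in> borel_measurable N \<and> (\<forall>c\<in>\<Gamma>. 1 \<le> curve_integral \<rho> c) \<and>
      (\<integral>\<^sup>+x. ennpowr (\<rho> x) p \<partial>N) < ennreal (?e n)" for n
  proof -
    have "p_modulus p N \<Gamma> < ennreal (?e n)" using 0 by simp
    then show ?thesis unfolding p_modulus_def by (auto simp: INF_less_iff)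
  qed
  then obtain \<rho> where \<rho>: "\<And>n. \<rho> n \<in> borel_measurable N"
    "\<And>n c. c \<in> \<Gamma> \<Longrightarrow> 1 \<le> curve_integral (\<rho> n) c"
    "\<And>n. (\<integral>\<^sup>+x. ennpowr (\<rho> n x) p \<partial>N) < ennreal (?e n)" by metis
  have [measurable]: "\<rho> n \<in> borel_measurable N" for n by (rule \<rho>)
  let ?r = "\<lambda>n x. ennreal (Suc n) * \<rho> n x"
  have "(\<integral>\<^sup>+x. ennpowr (?r n x) p \<partial>N) \<le> ennreal ((1 / 2) ^ n)" for n
  proof -
    have "(\<integral>\<^sup>+x. ennpowr (?r n x) p \<partial>N) = ennreal (real (Suc n) powr p) * (\<integral>\<^sup>+x. ennpowr (\<rho> n x) p \<partial>N)"
      using assms(1) by (simp add: ennpowr_mult nn_integral_cmult del: of_nat_Suc ennreal_of_nat_eq_real_of_nat)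
    also have "\<dots> \<le> ennreal (real (Suc n) powr p) * ennreal (?e n)"
      using \<rho>(3)[of n] by (intro mult_left_mono less_imp_le) auto
    also have "\<dots> = ennreal ((1 / 2) ^ n)" by (simp add: ennreal_mult[symmetric])
    finally show ?thesis .
  qed
  then have "(\<Sum>n. \<integral>\<^sup>+x. ennpowr (?r n x) p \<partial>N) \<le> (\<Sum>n. ennreal ((1 / 2) ^ n))"
    by (intro suminf_le) auto
  then have "(\<Sum>n. \<integral>\<^sup>+x. ennpowr (?r n x) p \<partial>N) < \<infinity>"
    using suminf_half_ennreal by (rule order.strict_trans1)
  then obtain \<rho>' where \<rho>': "p_integrable p N \<rho>'" "\<And>n x. ?r n x \<le> \<rho>' x"
    using p_integrable_dominating[OF assms(1), of ?r N] by auto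
  have "curve_integral \<rho>' c = \<infinity>" if "c \<in> \<Gamma>" for c
  proof -
    obtain a b \<gamma> where c: "c = (a, b, \<gamma>)" "(a, b, \<gamma>) \<in> rect_curves (space N)"
      using \<open>c \<in> \<Gamma>\<close> \<Gamma> by (cases c) auto
    note w = whole_curve_arc[OF c(2)]
    have "ennreal (Suc n) \<le> curve_integral \<rho>' c" for n
    proof -
      have "ennreal (Suc n) * 1 \<le> ennreal (Suc n) * curve_integral (\<rho> n) c"
        by (intro mult_left_mono \<rho>(2) that) auto
      also have "\<dots> = arc_integral (?r n) (arc_length_param c) 0 (real_length c)"
        using arc_integral_cmult[OF assms(2) w(1), of "\<rho> n" "ennreal (Suc n)"] w(4) c(1) \<rho>(1) by simp
      also have "\<dots> \<le> curve_integral \<rho>' c"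
        unfolding c(1) w(4) by (rule arc_integral_mono[OF w(1)]) (rule \<rho>'(2))
      finally show ?thesis by simp
    qed
    then have "(of_nat n :: ennreal) \<le> curve_integral \<rho>' c" for n
      by (cases n) (auto simp: ennreal_of_nat_eq_real_of_nat)
    then show ?thesis
      by (metis ennreal_SUP_of_nat_eq_top SUP_least infinity_ennreal_def top_unique)
  qed
  with \<rho>'(1) show "\<exists>\<rho>. p_integrable p N \<rho> \<and> (\<forall>c\<in>\<Gamma>. curve_integral \<rho> c = \<infinity>)" by blast
next
  assume "\<exists>\<rho>. p_integrable p N \<rho> \<and> (\<forall>c\<in>\<Gamma>. curve_integral \<rho> c = \<infinity>)"
  then obtain \<rho> where \<rho>: "p_integrable p N \<rho>" "\<And>c. c \<in> \<Gamma> \<Longrightarrow> curve_integral \<rho> c = \<infinity>" by blast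
  have [measurable]: "\<rho> \<in> borel_measurable N" using \<rho>(1) by (simp add: p_integrable_def)
  define I where "I = enn2real (\<integral>\<^sup>+x. ennpowr (\<rho> x) p \<partial>N)"
  have I: "(\<integral>\<^sup>+x. ennpowr (\<rho> x) p \<partial>N) = ennreal I" "0 \<le> I"
    using \<rho>(1) by (auto simp: I_def p_integrable_def)
  have "p_modulus p N \<Gamma> \<le> ennreal (d powr p * I)" if "0 < d" for d
  proof -
    have "1 \<le> curve_integral (\<lambda>x. ennreal d * \<rho> x) c" if "c \<in> \<Gamma>" for c
    proof -
      obtain a b \<gamma> where c: "c = (a, b, \<gamma>)" "(a, b, \<gamma>) \<in> rect_curves (space N)"
        using \<open>c \<in> \<Gamma>\<close> \<Gamma> by (cases c) auto
      note w = whole_curve_arc[OF c(2)]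
      have "curve_integral (\<lambda>x. ennreal d * \<rho> x) c = ennreal d * \<infinity>"
        using arc_integral_cmult[OF assms(2) w(1), of \<rho> "ennreal d"] w(4) c(1) \<rho>(2)[OF that] by simp
      then show ?thesis using \<open>0 < d\<close> by (simp add: ennreal_mult_top)
    qed
    then have "p_modulus p N \<Gamma> \<le> (\<integral>\<^sup>+x. ennpowr (ennreal d * \<rho> x) p \<partial>N)"
      unfolding p_modulus_def by (intro INF_lower) auto
    also have "\<dots> = ennreal (d powr p * I)"
      using that assms(1) I by (simp add: ennpowr_mult nn_integral_cmult ennreal_mult)
    finally show ?thesis .
  qed
  then have ev: "eventually (\<lambda>d. p_modulus p N \<Gamma> \<le> ennreal (d powr p * I)) (at_right 0)"
    by (auto simp: eventually_at_filter)
  have "((\<lambda>d. d powr p * I) \<longlongrightarrow> 0 powr p * I) (at_right 0)"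
    using assms(1) by (intro tendsto_intros) (auto simp: eventually_at_filter)
  then have lim: "((\<lambda>d. ennreal (d powr p * I)) \<longlongrightarrow> ennreal 0) (at_right 0)"
    using assms(1) by (intro tendsto_ennrealI) simp
  have "p_modulus p N \<Gamma> \<le> ennreal 0"
    by (rule tendsto_lowerbound[OF lim ev]) simp
  then show "p_modulus p N \<Gamma> = 0" by simp
qed

text \<open>Since a subcurve has a smaller integral, the curves on which a \<open>p\<close>-integrable function has a
  finite integral are closed under passing to subcurves. So a weak upper gradient satisfies the upper
  gradient inequality on all arcs of those curves.\<close>
lemma weak_upper_gradient_iff:
  assumes "0 < p" "borel_on N"
  shows "weak_upper_gradient p N u h \<longleftrightarrow>
    h \<in> borel_measurable N \<and> (\<exists>\<rho>. p_integrable p N \<rho> \<and> gradient_off N \<rho> u h)"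
proof
  assume "weak_upper_gradient p N u h"
  then obtain \<Gamma> where h: "h \<in> borel_measurable N" and \<Gamma>: "\<Gamma> \<subseteq> rect_curves (space N)" "p_modulus p N \<Gamma> = 0"
    "\<And>c. c \<in> rect_curves (space N) - \<Gamma> \<Longrightarrow> upper_gradient_along u h c"
    by (auto simp: weak_upper_gradient_def)
  obtain \<rho> where \<rho>: "p_integrable p N \<rho>" "\<And>c. c \<in> \<Gamma> \<Longrightarrow> curve_integral \<rho> c = \<infinity>"
    using \<Gamma> modulus_zero_iff[OF assms \<Gamma>(1)] by auto
  have "ennreal \<bar>u (\<sigma> s) - u (\<sigma> t)\<bar> \<le> arc_integral h \<sigma> s t"
    if arc: "(\<sigma>, s, t) \<in> arcs (space N)" and fin: "arc_integral \<rho> \<sigma> s t < \<infinity>" for \<sigma> s t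
  proof (cases "s < t")
    case True
    obtain a b \<gamma> where c: "(a, b, \<gamma>) \<in> rect_curves (space N)" "\<gamma> a = \<sigma> s" "\<gamma> b = \<sigma> t"
      "\<forall>N' h. borel_on N' \<longrightarrow> space N' = space N \<longrightarrow> h \<in> borel_measurable N' \<longrightarrow>
        curve_integral h (a, b, \<gamma>) = arc_integral h \<sigma> s t"
      by (rule arc_is_curve[OF arc True])
    have "curve_integral \<rho> (a, b, \<gamma>) < \<infinity>"
      using c(4)[rule_format, OF assms(2) refl, of \<rho>] fin \<rho>(1) by (simp add: p_integrable_def)
    then have "(a, b, \<gamma>) \<notin> \<Gamma>" using \<rho>(2) by force
    then have "upper_gradient_along u h (a, b, \<gamma>)" using \<Gamma>(3) c(1) by blast
    then show ?thesis
      using c(2,3) c(4)[rule_format, OF assms(2) refl h] by (simp add: upper_gradient_along_def)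
  next
    case False
    then have "s = t" using arc by (auto simp: arcs_def)
    then show ?thesis by simp
  qed
  then show "h \<in> borel_measurable N \<and> (\<exists>\<rho>. p_integrable p N \<rho> \<and> gradient_off N \<rho> u h)"
    using h \<rho>(1) unfolding gradient_off_def by blast
next
  assume "h \<in> borel_measurable N \<and> (\<exists>\<rho>. p_integrable p N \<rho> \<and> gradient_off N \<rho> u h)"
  then obtain \<rho> where h: "h \<in> borel_measurable N" and \<rho>: "p_integrable p N \<rho>" "gradient_off N \<rho> u h"
    by blast
  let ?\<Gamma> = "{c \<in> rect_curves (space N). curve_integral \<rho> c = \<infinity>}"
  have "p_modulus p N ?\<Gamma> = 0"
    by (subst modulus_zero_iff[OF assms]) (use \<rho>(1) in auto)
  moreover have "upper_gradient_along u h c" if c: "c \<in> rect_curves (space N) - ?\<Gamma>" for c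
  proof -
    obtain a b \<gamma> where c': "c = (a, b, \<gamma>)" "(a, b, \<gamma>) \<in> rect_curves (space N)"
      using c by (cases c) auto
    note w = whole_curve_arc[OF c'(2)]
    have "curve_integral \<rho> c < \<infinity>" using c by (auto simp: less_top)
    then show ?thesis
      using gradient_offD[OF \<rho>(2) w(1)] by (simp add: w c'(1) upper_gradient_along_def)
  qed
  ultimately show "weak_upper_gradient p N u h"
    unfolding weak_upper_gradient_def using h by (intro conjI exI[of _ ?\<Gamma>]) auto
qed

section \<open>Functions on an interval with controlled oscillation\<close>

text \<open>The trace on an arc of the upper gradient inequality, for \<open>\<phi> = u \<circ> \<sigma>\<close> and \<open>a = h \<circ> \<sigma>\<close>.\<close>
definition oscillation_bound :: "real \<Rightarrow> real \<Rightarrow> (real \<Rightarrow> real) \<Rightarrow> (real \<Rightarrow> ennreal) \<Rightarrow> bool" where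
  "oscillation_bound s t \<phi> a \<longleftrightarrow> (\<forall>x y. s \<le> x \<longrightarrow> x \<le> y \<longrightarrow> y \<le> t \<longrightarrow>
     ennreal \<bar>\<phi> x - \<phi> y\<bar> \<le> (\<integral>\<^sup>+r\<in>{x..y}. a r \<partial>lborel))"

lemma oscillation_boundD:
  "oscillation_bound s t \<phi> a \<Longrightarrow> s \<le> x \<Longrightarrow> x \<le> y \<Longrightarrow> y \<le> t \<Longrightarrow>
    ennreal \<bar>\<phi> x - \<phi> y\<bar> \<le> (\<integral>\<^sup>+r\<in>{x..y}. a r \<partial>lborel)"
  by (auto simp: oscillation_bound_def)

lemma interval_integral_split:
  fixes a :: "real \<Rightarrow> ennreal"
  assumes [measurable]: "a \<in> borel_measurable borel" and "x \<le> c" "c \<le> y"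
  shows "(\<integral>\<^sup>+r\<in>{x..y}. a r \<partial>lborel) = (\<integral>\<^sup>+r\<in>{x..c}. a r \<partial>lborel) + (\<integral>\<^sup>+r\<in>{c..y}. a r \<partial>lborel)"
proof -
  have "(\<integral>\<^sup>+r\<in>{x..y}. a r \<partial>lborel) = (\<integral>\<^sup>+r. a r * indicator {x..c} r + a r * indicator {c..y} r \<partial>lborel)"
    using AE_lborel_singleton[of c]
    by (intro nn_integral_cong_AE, eventually_elim) (use assms(2,3) in \<open>auto split: split_indicator\<close>)
  then show ?thesis by (simp add: nn_integral_add)
qed

lemma oscillation_bound_continuous:
  fixes \<phi> :: "real \<Rightarrow> real"
  assumes [measurable]: "a \<in> borel_measurable borel" and \<phi>: "oscillation_bound s t \<phi> a"
    and fin: "(\<integral>\<^sup>+r\<in>{s..t}. a r \<partial>lborel) < \<infinity>"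
  shows "continuous_on {s..t} \<phi>"
  unfolding continuous_on_sequentially
proof (intro allI ballI impI, elim conjE)
  fix X x assume x: "x \<in> {s..t}" and X: "\<forall>n. X n \<in> {s..t}" and lim: "X \<longlonglongrightarrow> x"
  let ?I = "\<lambda>n. {min (X n) x..max (X n) x}"
  have "(\<lambda>n. \<integral>\<^sup>+r. a r * indicator (?I n) r \<partial>lborel) \<longlonglongrightarrow> (\<integral>\<^sup>+r. 0 \<partial>(lborel :: real measure))"
  proof (rule nn_integral_dominated_convergence[where w = "\<lambda>r. a r * indicator {s..t} r" and u' = "\<lambda>r. 0"])
    show "AE r in lborel. a r * indicator (?I j) r \<le> a r * indicator {s..t} r" for j
      using x X[rule_format, of j] by (intro AE_I2) (auto split: split_indicator)
    show "AE r in lborel. (\<lambda>n. a r * indicator (?I n) r) \<longlonglongrightarrow> 0"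
      using AE_lborel_singleton[of x]
    proof eventually_elim
      case (elim r)
      have "eventually (\<lambda>n. dist (X n) x < dist r x) sequentially"
        using lim elim by (intro tendstoD) auto
      then have "eventually (\<lambda>n. a r * indicator (?I n) r = 0) sequentially"
        by eventually_elim (auto simp: dist_real_def split: split_indicator)
      then show ?case by (rule tendsto_eventually)
    qed
  qed (use fin in auto)
  then have lim0: "(\<lambda>n. \<integral>\<^sup>+r. a r * indicator (?I n) r \<partial>lborel) \<longlonglongrightarrow> 0" by simp
  have "ennreal \<bar>\<phi> (X n) - \<phi> x\<bar> \<le> (\<integral>\<^sup>+r. a r * indicator (?I n) r \<partial>lborel)" for n
    using oscillation_boundD[OF \<phi>, of "X n" x] oscillation_boundD[OF \<phi>, of x "X n"] x X[rule_format, of n]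
    by (cases "X n \<le> x") (auto simp: min_def max_def abs_minus_commute)
  then have "(\<lambda>n. ennreal \<bar>\<phi> (X n) - \<phi> x\<bar>) \<longlonglongrightarrow> 0"
    by (intro tendsto_sandwich[OF _ _ tendsto_const lim0]) auto
  then have "(\<lambda>n. \<bar>\<phi> (X n) - \<phi> x\<bar>) \<longlonglongrightarrow> 0"
    by (simp add: ennreal_0[symmetric] del: ennreal_0)
  then show "(\<phi> \<circ> X) \<longlonglongrightarrow> \<phi> x"
    by (simp add: LIM_zero_cancel tendsto_rabs_zero_iff comp_def)
qed

text \<open>
  Gluing along a half-line is splitting the interval. The sets \<open>E\<close> along which all pairs of bounds can be glued are closed under complements (exchange the
  bounds), under finite unions (glue the first bound with an already glued one), and under increasing
  limits by dominated convergence.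
\<close>
lemma oscillation_bound_glue:
  assumes E: "E \<in> sets borel"
    and "a \<in> borel_measurable borel" "b \<in> borel_measurable borel"
    and "oscillation_bound s t \<phi> a" "oscillation_bound s t \<phi> b"
    and "(\<integral>\<^sup>+r\<in>{s..t}. a r \<partial>lborel) < \<infinity>" "(\<integral>\<^sup>+r\<in>{s..t}. b r \<partial>lborel) < \<infinity>"
  shows "oscillation_bound s t \<phi> (\<lambda>r. if r \<in> E then a r else b r)"
proof -
  have "E \<in> sigma_sets UNIV (range (\<lambda>a::real. {..a}))"
    using E unfolding borel_eq_atMost by simp
  then show ?thesis
    using assms(2-)
  proof (induction arbitrary: a b rule: sigma_sets.induct)
    case (Basic E)
    then obtain c where E: "E = {..c}" by auto
    note [measurable] = Basic(2,3)
    show ?case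
      unfolding oscillation_bound_def
    proof (intro allI impI)
      fix x y assume xy: "s \<le> x" "x \<le> y" "y \<le> t"
      let ?h = "\<lambda>r. if r \<in> E then a r else b r"
      consider "y \<le> c" | "c < x" | "x \<le> c" "c < y" by linarith
      then show "ennreal \<bar>\<phi> x - \<phi> y\<bar> \<le> (\<integral>\<^sup>+r\<in>{x..y}. ?h r \<partial>lborel)"
      proof cases
        case 1
        then have "(\<integral>\<^sup>+r\<in>{x..y}. ?h r \<partial>lborel) = (\<integral>\<^sup>+r\<in>{x..y}. a r \<partial>lborel)"
          by (intro nn_integral_cong) (auto simp: E split: split_indicator)
        then show ?thesis using oscillation_boundD[OF Basic(4) xy] by simp
      next
        case 2
        then have "(\<integral>\<^sup>+r\<in>{x..y}. ?h r \<partial>lborel) = (\<integral>\<^sup>+r\<in>{x..y}. b r \<partial>lborel)"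
          by (intro nn_integral_cong) (auto simp: E split: split_indicator)
        then show ?thesis using oscillation_boundD[OF Basic(5) xy] by simp
      next
        case 3
        have "(\<integral>\<^sup>+r\<in>{x..c}. a r \<partial>lborel) = (\<integral>\<^sup>+r\<in>{x..c}. ?h r \<partial>lborel)"
          by (intro nn_integral_cong) (auto simp: E split: split_indicator)
        moreover have "(\<integral>\<^sup>+r\<in>{c..y}. b r \<partial>lborel) = (\<integral>\<^sup>+r\<in>{c..y}. ?h r \<partial>lborel)"
          using AE_lborel_singleton[of c]
          by (intro nn_integral_cong_AE, eventually_elim) (auto simp: E split: split_indicator)
        moreover have "ennreal \<bar>\<phi> x - \<phi> y\<bar> \<le> ennreal \<bar>\<phi> x - \<phi> c\<bar> + ennreal \<bar>\<phi> c - \<phi> y\<bar>"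
          by (simp add: ennreal_plus[symmetric] ennreal_leI del: ennreal_plus)
        moreover have "E \<in> sets borel" by (simp add: E)
        ultimately show ?thesis
          using oscillation_boundD[OF Basic(4), of x c] oscillation_boundD[OF Basic(5), of c y] xy 3
            interval_integral_split[of ?h x c y]
          by (auto intro: order.trans add_mono)
      qed
    qed
  next
    case Empty
    then show ?case by simp
  next
    case (Compl E)
    have "(\<lambda>r. if r \<in> UNIV - E then a r else b r) = (\<lambda>r. if r \<in> E then b r else a r)"
      by auto
    with Compl show ?case by simp
  next
    case (Union E)
    note [measurable] = Union(3,4)
    have Eb [measurable]: "E i \<in> sets borel" for i
      using Union(1) unfolding borel_eq_atMost by simp
    let ?F = "\<lambda>n r. if r \<in> (\<Union>i<n. E i) then a r else b r"
    have F: "oscillation_bound s t \<phi> (?F n) \<and> (\<integral>\<^sup>+r\<in>{s..t}. ?F n r \<partial>lborel) < \<infinity>" for n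
    proof (induction n)
      case 0
      then show ?case using Union by simp
    next
      case (Suc n)
      have eq: "?F (Suc n) = (\<lambda>r. if r \<in> E n then a r else ?F n r)"
        by (simp add: lessThan_Suc fun_eq_iff)
      have "(\<integral>\<^sup>+r\<in>{s..t}. ?F (Suc n) r \<partial>lborel) \<le> (\<integral>\<^sup>+r. a r * indicator {s..t} r + b r * indicator {s..t} r \<partial>lborel)"
        by (intro nn_integral_mono) (auto split: split_indicator)
      also have "\<dots> < \<infinity>" using Union by (simp add: nn_integral_add)
      finally show ?case
        using Suc Union(2)[of a "?F n" n] Union unfolding eq by simp
    qed
    show ?case
      unfolding oscillation_bound_def
    proof (intro allI impI)
      fix x y assume xy: "s \<le> x" "x \<le> y" "y \<le> t"
      let ?h = "\<lambda>r. if r \<in> (\<Union>i. E i) then a r else b r"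
      have "(\<lambda>n. \<integral>\<^sup>+r. ?F n r * indicator {x..y} r \<partial>lborel) \<longlonglongrightarrow> (\<integral>\<^sup>+r. ?h r * indicator {x..y} r \<partial>lborel)"
      proof (rule nn_integral_dominated_convergence[where w = "\<lambda>r. a r * indicator {s..t} r + b r * indicator {s..t} r"])
        show "AE r in lborel. ?F j r * indicator {x..y} r \<le> a r * indicator {s..t} r + b r * indicator {s..t} r" for j
          using xy by (intro AE_I2) (auto split: split_indicator)
        show "(\<integral>\<^sup>+r. a r * indicator {s..t} r + b r * indicator {s..t} r \<partial>lborel) < \<infinity>"
          using Union by (simp add: nn_integral_add)
        show "AE r in lborel. (\<lambda>n. ?F n r * indicator {x..y} r) \<longlonglongrightarrow> ?h r * indicator {x..y} r"
        proof (rule AE_I2, rule tendsto_eventually)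
          fix r
          show "eventually (\<lambda>n. ?F n r * indicator {x..y} r = ?h r * indicator {x..y} r) sequentially"
          proof (cases "r \<in> (\<Union>i. E i)")
            case True
            then obtain i where "r \<in> E i" by blast
            then have "?F n r = ?h r" if "i < n" for n using that by auto
            then show ?thesis unfolding eventually_sequentially
              by (intro exI[of _ "Suc i"]) auto
          qed auto
        qed
      qed measurable
      then show "ennreal \<bar>\<phi> x - \<phi> y\<bar> \<le> (\<integral>\<^sup>+r\<in>{x..y}. ?h r \<partial>lborel)"
        by (rule tendsto_lowerbound) (use oscillation_boundD[OF conjunct1[OF F] xy] in auto)
    qed
  qed
qed

text \<open>Only the parts before the first and after the last zero of \<open>\<phi>\<close> contribute to the oscillation
  between two points.\<close>
lemma oscillation_bound_off_zeros:
  fixes \<phi> :: "real \<Rightarrow> real"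
  assumes [measurable]: "a \<in> borel_measurable borel" and \<phi>: "oscillation_bound s t \<phi> a"
    and cont: "continuous_on {s..t} \<phi>"
  shows "oscillation_bound s t \<phi> (\<lambda>r. if r \<in> {s..t} \<and> \<phi> r = 0 then 0 else a r)"
  unfolding oscillation_bound_def
proof (intro allI impI)
  fix x y assume xy: "s \<le> x" "x \<le> y" "y \<le> t"
  let ?h = "\<lambda>r. if r \<in> {s..t} \<and> \<phi> r = 0 then 0 else a r"
  have "closed ({s..t} \<inter> \<phi> -` {0})"
    using cont by (intro continuous_closed_preimage) auto
  then have m [measurable]: "{s..t} \<inter> \<phi> -` {0} \<in> sets borel" by (rule borel_closed)
  have "?h = (\<lambda>r. if r \<in> {s..t} \<inter> \<phi> -` {0} then 0 else a r)" by auto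
  also have "\<dots> \<in> borel_measurable borel" by measurable
  finally have hm [measurable]: "?h \<in> borel_measurable borel" .
  show "ennreal \<bar>\<phi> x - \<phi> y\<bar> \<le> (\<integral>\<^sup>+r\<in>{x..y}. ?h r \<partial>lborel)"
  proof (cases "\<exists>r\<in>{x..y}. \<phi> r = 0")
    case False
    then have "(\<integral>\<^sup>+r\<in>{x..y}. ?h r \<partial>lborel) = (\<integral>\<^sup>+r\<in>{x..y}. a r \<partial>lborel)"
      by (intro nn_integral_cong) (auto split: split_indicator)
    then show ?thesis using oscillation_boundD[OF \<phi> xy] by simp
  next
    case True
    let ?Z = "{x..y} \<inter> \<phi> -` {0}"
    have "closed ?Z"
      using continuous_on_subset[OF cont, of "{x..y}"] xy by (intro continuous_closed_preimage) auto
    then have "compact ?Z" by (metis compact_Int_closed compact_Icc inf.left_idem)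
    moreover have "?Z \<noteq> {}" using True by auto
    ultimately have "\<exists>x'\<in>?Z. \<forall>z\<in>?Z. x' \<le> z" "\<exists>y'\<in>?Z. \<forall>z\<in>?Z. z \<le> y'"
      using compact_attains_inf[of ?Z] compact_attains_sup[of ?Z] by blast+
    then obtain x' y' where x': "x' \<in> ?Z" "\<forall>z\<in>?Z. x' \<le> z" and y': "y' \<in> ?Z" "\<forall>z\<in>?Z. z \<le> y'"
      by blast
    have nz: "\<phi> r \<noteq> 0" if "r \<in> {x..x'} \<and> r \<noteq> x' \<or> r \<in> {y'..y} \<and> r \<noteq> y'" for r
      using bspec[OF x'(2), of r] bspec[OF y'(2), of r] x'(1) y'(1) that by auto
    have 1: "(\<integral>\<^sup>+r\<in>{x..x'}. ?h r \<partial>lborel) = (\<integral>\<^sup>+r\<in>{x..x'}. a r \<partial>lborel)"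
      using AE_lborel_singleton[of x']
      by (intro nn_integral_cong_AE, eventually_elim) (use nz in \<open>auto split: split_indicator\<close>)
    have 2: "(\<integral>\<^sup>+r\<in>{y'..y}. ?h r \<partial>lborel) = (\<integral>\<^sup>+r\<in>{y'..y}. a r \<partial>lborel)"
      using AE_lborel_singleton[of y']
      by (intro nn_integral_cong_AE, eventually_elim) (use nz in \<open>auto split: split_indicator\<close>)
    have "ennreal \<bar>\<phi> x - \<phi> y\<bar> \<le> ennreal \<bar>\<phi> x - \<phi> x'\<bar> + ennreal \<bar>\<phi> y' - \<phi> y\<bar>"
      using x' y' by (simp add: ennreal_plus[symmetric] ennreal_leI del: ennreal_plus)
    also have "\<dots> \<le> (\<integral>\<^sup>+r\<in>{x..x'}. ?h r \<partial>lborel) + (\<integral>\<^sup>+r\<in>{y'..y}. ?h r \<partial>lborel)"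
      unfolding 1 2 using x' y' xy by (intro add_mono oscillation_boundD[OF \<phi>]) auto
    also have "\<dots> \<le> (\<integral>\<^sup>+r\<in>{x..x'}. ?h r \<partial>lborel) + (\<integral>\<^sup>+r\<in>{x'..y}. ?h r \<partial>lborel)"
      using bspec[OF x'(2) y'(1)] by (intro add_left_mono nn_integral_mono) (auto split: split_indicator)
    also have "\<dots> = (\<integral>\<^sup>+r\<in>{x..y}. ?h r \<partial>lborel)"
      using x' by (intro interval_integral_split[symmetric] hm) auto
    finally show ?thesis .
  qed
qed

section \<open>Calculus of weak upper gradients\<close>

lemma arc_integral_truncate:
  assumes "s \<le> x" "y \<le> t"
  shows "(\<integral>\<^sup>+r\<in>{x..y}. (h (\<sigma> r) * indicator {s..t} r) \<partial>lborel) = arc_integral h \<sigma> x y"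
  using assms by (intro nn_integral_cong) (auto split: split_indicator)

lemma gradient_off_oscillation:
  assumes "gradient_off N \<rho> u h" "(\<sigma>, s, t) \<in> arcs (space N)" "arc_integral \<rho> \<sigma> s t < \<infinity>"
  shows "oscillation_bound s t (\<lambda>r. u (\<sigma> r)) (\<lambda>r. h (\<sigma> r) * indicator {s..t} r)"
  unfolding oscillation_bound_def
proof (intro allI impI)
  fix x y assume xy: "s \<le> x" "x \<le> y" "y \<le> t"
  have "arc_integral \<rho> \<sigma> x y < \<infinity>"
    using arc_integral_subinterval[of s x y t \<rho> \<sigma>] xy assms(3) by (auto intro: order.strict_trans1)
  then show "ennreal \<bar>u (\<sigma> x) - u (\<sigma> y)\<bar> \<le> (\<integral>\<^sup>+r\<in>{x..y}. (h (\<sigma> r) * indicator {s..t} r) \<partial>lborel)"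
    unfolding arc_integral_truncate[OF xy(1,3)]
    by (rule gradient_offD[OF assms(1) arcs_subinterval[OF assms(2) xy]])
qed

lemma oscillation_bound_ends:
  assumes "oscillation_bound s t \<phi> a" "s \<le> t"
  shows "ennreal \<bar>\<phi> s - \<phi> t\<bar> \<le> (\<integral>\<^sup>+r\<in>{s..t}. a r \<partial>lborel)"
  using oscillation_boundD[OF assms(1)] assms(2) by simp

lemma arcs_le: "(\<sigma>, s, t) \<in> arcs S \<Longrightarrow> s \<le> t"
  by (auto simp: arcs_def)

lemma p_integrable_add:
  assumes "0 \<le> p" "p_integrable p N \<rho>" "p_integrable p N \<rho>'"
  shows "p_integrable p N (\<lambda>x. \<rho> x + \<rho>' x)"
proof -
  have [measurable]: "\<rho> \<in> borel_measurable N" "\<rho>' \<in> borel_measurable N"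
    using assms by (simp_all add: p_integrable_def)
  have le: "ennpowr (x + y) p \<le> ennpowr 2 p * (ennpowr x p + ennpowr y p)" for x y :: ennreal
  proof -
    have "ennpowr (x + y) p \<le> ennpowr (2 * max x y) p"
      by (intro ennpowr_mono assms(1)) (auto simp: mult_2 intro: add_mono)
    also have "\<dots> = ennpowr 2 p * ennpowr (max x y) p" by (rule ennpowr_mult)
    also have "\<dots> \<le> ennpowr 2 p * (ennpowr x p + ennpowr y p)"
      by (intro mult_left_mono) (auto simp: max_def add_increasing add_increasing2)
    finally show ?thesis .
  qed
  have "(\<integral>\<^sup>+x. ennpowr (\<rho> x + \<rho>' x) p \<partial>N) \<le> (\<integral>\<^sup>+x. ennpowr 2 p * (ennpowr (\<rho> x) p + ennpowr (\<rho>' x) p) \<partial>N)"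
    by (intro nn_integral_mono le)
  also have "\<dots> = ennpowr 2 p * ((\<integral>\<^sup>+x. ennpowr (\<rho> x) p \<partial>N) + (\<integral>\<^sup>+x. ennpowr (\<rho>' x) p \<partial>N))"
    by (simp add: nn_integral_cmult nn_integral_add)
  also have "\<dots> < \<infinity>"
    using assms by (auto simp: p_integrable_def ennreal_mult_less_top)
  finally show ?thesis by (simp add: p_integrable_def)
qed

lemma arc_integral_finite_mono:
  assumes "(\<sigma>, s, t) \<in> arcs S" "arc_integral k \<sigma> s t < \<infinity>" "\<And>x. x \<in> S \<Longrightarrow> h x \<le> k x"
  shows "arc_integral h \<sigma> s t < \<infinity>"
  using arc_integral_mono[OF assms(1), of h k] assms by (auto intro: order.strict_trans1)

text \<open>A countable union of exceptional families is exceptional.\<close>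
lemma common_exceptional_function:
  assumes "0 < p" "borel_on N" "\<And>n::nat. p_integrable p N (\<rho> n)"
  obtains \<rho>' where "p_integrable p N \<rho>'"
    "\<forall>n \<sigma> s t. (\<sigma>, s, t) \<in> arcs (space N) \<longrightarrow> arc_integral \<rho>' \<sigma> s t < \<infinity> \<longrightarrow> arc_integral (\<rho> n) \<sigma> s t < \<infinity>"
proof -
  obtain \<rho>' \<delta> where r: "p_integrable p N \<rho>'" "\<And>n. 0 < \<delta> n" "\<And>n x. ennreal (\<delta> n) * \<rho> n x \<le> \<rho>' x"
    using p_integrable_dominating_scaled[of p N \<rho>, OF assms(1,3)] by metis
  show ?thesis
  proof (rule that[OF r(1)], intro allI impI)
    fix n \<sigma> s t assume arc: "(\<sigma>, s, t) \<in> arcs (space N)" "arc_integral \<rho>' \<sigma> s t < \<infinity>"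
    have "arc_integral (\<lambda>x. ennreal (\<delta> n) * \<rho> n x) \<sigma> s t < \<infinity>"
      by (rule arc_integral_finite_mono[OF arc r(3)])
    then have "ennreal (\<delta> n) * arc_integral (\<rho> n) \<sigma> s t < \<infinity>"
      using arc_integral_cmult[OF assms(2) arc(1), of "\<rho> n" "ennreal (\<delta> n)"] assms(3)[of n]
      by (simp add: p_integrable_def)
    then show "arc_integral (\<rho> n) \<sigma> s t < \<infinity>"
      using r(2)[of n] by (auto simp: ennreal_mult_less_top)
  qed
qed

lemma weak_upper_gradient_linear:
  assumes "0 < p" "borel_on N" "weak_upper_gradient p N u h" "weak_upper_gradient p N v k"
  shows "weak_upper_gradient p N (\<lambda>x. \<alpha> * u x + \<beta> * v x) (\<lambda>x. ennreal \<bar>\<alpha>\<bar> * h x + ennreal \<bar>\<beta>\<bar> * k x)"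
proof -
  obtain \<rho> \<rho>' where \<rho>: "p_integrable p N \<rho>" "gradient_off N \<rho> u h"
    and \<rho>': "p_integrable p N \<rho>'" "gradient_off N \<rho>' v k"
    and m [measurable]: "h \<in> borel_measurable N" "k \<in> borel_measurable N"
    using assms by (auto simp: weak_upper_gradient_iff)
  have "gradient_off N (\<lambda>x. \<rho> x + \<rho>' x) (\<lambda>x. \<alpha> * u x + \<beta> * v x) (\<lambda>x. ennreal \<bar>\<alpha>\<bar> * h x + ennreal \<bar>\<beta>\<bar> * k x)"
    unfolding gradient_off_def
  proof safe
    fix \<sigma> s t assume arc: "(\<sigma>, s, t) \<in> arcs (space N)" "arc_integral (\<lambda>x. \<rho> x + \<rho>' x) \<sigma> s t < \<infinity>"
    have uv: "ennreal \<bar>u (\<sigma> s) - u (\<sigma> t)\<bar> \<le> arc_integral h \<sigma> s t"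
      "ennreal \<bar>v (\<sigma> s) - v (\<sigma> t)\<bar> \<le> arc_integral k \<sigma> s t"
      using arc_integral_finite_mono[OF arc, of \<rho>] arc_integral_finite_mono[OF arc, of \<rho>']
      by (auto intro: gradient_offD[OF \<rho>(2) arc(1)] gradient_offD[OF \<rho>'(2) arc(1)])
    have "\<bar>(\<alpha> * u (\<sigma> s) + \<beta> * v (\<sigma> s)) - (\<alpha> * u (\<sigma> t) + \<beta> * v (\<sigma> t))\<bar>
        = \<bar>\<alpha> * (u (\<sigma> s) - u (\<sigma> t)) + \<beta> * (v (\<sigma> s) - v (\<sigma> t))\<bar>"
      by (simp add: algebra_simps)
    also have "\<dots> \<le> \<bar>\<alpha>\<bar> * \<bar>u (\<sigma> s) - u (\<sigma> t)\<bar> + \<bar>\<beta>\<bar> * \<bar>v (\<sigma> s) - v (\<sigma> t)\<bar>"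
      by (simp only: abs_mult[symmetric] abs_triangle_ineq)
    finally have "ennreal \<bar>(\<alpha> * u (\<sigma> s) + \<beta> * v (\<sigma> s)) - (\<alpha> * u (\<sigma> t) + \<beta> * v (\<sigma> t))\<bar>
      \<le> ennreal \<bar>\<alpha>\<bar> * ennreal \<bar>u (\<sigma> s) - u (\<sigma> t)\<bar> + ennreal \<bar>\<beta>\<bar> * ennreal \<bar>v (\<sigma> s) - v (\<sigma> t)\<bar>"
      by (simp add: ennreal_mult[symmetric] ennreal_plus[symmetric] ennreal_leI del: ennreal_plus)
    also have "\<dots> \<le> ennreal \<bar>\<alpha>\<bar> * arc_integral h \<sigma> s t + ennreal \<bar>\<beta>\<bar> * arc_integral k \<sigma> s t"
      by (intro add_mono mult_left_mono uv) auto
    also have "\<dots> = arc_integral (\<lambda>x. ennreal \<bar>\<alpha>\<bar> * h x + ennreal \<bar>\<beta>\<bar> * k x) \<sigma> s t"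
      using arc_integral_add[OF assms(2) arc(1), of "\<lambda>x. ennreal \<bar>\<alpha>\<bar> * h x" "\<lambda>x. ennreal \<bar>\<beta>\<bar> * k x"]
        arc_integral_cmult[OF assms(2) arc(1) m(1)] arc_integral_cmult[OF assms(2) arc(1) m(2)]
      by simp
    finally show "ennreal \<bar>(\<alpha> * u (\<sigma> s) + \<beta> * v (\<sigma> s)) - (\<alpha> * u (\<sigma> t) + \<beta> * v (\<sigma> t))\<bar> \<le>
      arc_integral (\<lambda>x. ennreal \<bar>\<alpha>\<bar> * h x + ennreal \<bar>\<beta>\<bar> * k x) \<sigma> s t" .
  qed
  moreover have "p_integrable p N (\<lambda>x. \<rho> x + \<rho>' x)"
    using assms(1) \<rho>(1) \<rho>'(1) by (intro p_integrable_add) auto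
  ultimately show ?thesis
    using assms(1,2) by (subst weak_upper_gradient_iff) auto
qed

text \<open>The curves that spend a positive length in a given null set are exceptional.\<close>
lemma null_set_exceptional:
  assumes "0 < p" "borel_on N" and Z: "Z \<in> null_sets N"
  shows "p_integrable p N (\<lambda>x. \<infinity> * indicator Z x)"
    and "\<And>\<sigma> s t. (\<sigma>, s, t) \<in> arcs (space N) \<Longrightarrow> arc_integral (\<lambda>x. \<infinity> * indicator Z x) \<sigma> s t < \<infinity> \<Longrightarrow>
      AE r in lborel. r \<in> {s..t} \<longrightarrow> \<sigma> r \<notin> Z"
proof -
  have [measurable]: "Z \<in> sets N" using Z by auto
  have "(\<integral>\<^sup>+x. ennpowr (\<infinity> * indicator Z x) p \<partial>N) = (\<integral>\<^sup>+x. 0 \<partial>N)"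
    using AE_not_in[OF Z] by (intro nn_integral_cong_AE) (auto elim!: eventually_mono)
  then show "p_integrable p N (\<lambda>x. \<infinity> * indicator Z x)"
    by (simp add: p_integrable_def)
  fix \<sigma> s t assume arc: "(\<sigma>, s, t) \<in> arcs (space N)" "arc_integral (\<lambda>x. \<infinity> * indicator Z x) \<sigma> s t < \<infinity>"
  have "AE r in lborel. \<infinity> * indicator Z (\<sigma> r) * indicator {s..t} r \<noteq> (\<infinity>::ennreal)"
    using arc by (intro nn_integral_PInf_AE arc_measurable_lborel[OF assms(2) arc(1)]) auto
  then show "AE r in lborel. r \<in> {s..t} \<longrightarrow> \<sigma> r \<notin> Z"
    by eventually_elim (auto split: split_indicator_asm)
qed

text \<open>On a curve, the two bounds are glued along the Borel set where the first one is the smaller one.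
  Integrability is needed to have both bounds finite on almost every curve.\<close>
lemma weak_upper_gradient_min:
  assumes "0 < p" "borel_on N" "weak_upper_gradient p N u h" "weak_upper_gradient p N u k"
    and fin: "p_integrable p N h" "p_integrable p N k"
  shows "weak_upper_gradient p N u (\<lambda>x. min (h x) (k x))"
proof -
  obtain \<rho> \<rho>' where \<rho>: "p_integrable p N \<rho>" "gradient_off N \<rho> u h"
    and \<rho>': "p_integrable p N \<rho>'" "gradient_off N \<rho>' u k"
    and m [measurable]: "h \<in> borel_measurable N" "k \<in> borel_measurable N"
    using assms by (auto simp: weak_upper_gradient_iff)
  let ?r = "\<lambda>x. (\<rho> x + \<rho>' x) + (h x + k x)"
  have "gradient_off N ?r u (\<lambda>x. min (h x) (k x))"
    unfolding gradient_off_def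
  proof safe
    fix \<sigma> s t assume arc: "(\<sigma>, s, t) \<in> arcs (space N)" "arc_integral ?r \<sigma> s t < \<infinity>"
    let ?a = "\<lambda>r. h (\<sigma> r) * indicator {s..t} r" and ?b = "\<lambda>r. k (\<sigma> r) * indicator {s..t} r"
    have [measurable]: "?a \<in> borel_measurable borel" "?b \<in> borel_measurable borel"
      by (intro arc_measurable[OF assms(2) arc(1)] m)+
    have leq: "\<rho> x \<le> ?r x" "\<rho>' x \<le> ?r x" "h x \<le> ?r x" "k x \<le> ?r x" for x
      by (auto intro: add_increasing add_increasing2)
    have "oscillation_bound s t (\<lambda>r. u (\<sigma> r)) (\<lambda>r. if r \<in> {r. ?a r \<le> ?b r} then ?a r else ?b r)"
    proof (rule oscillation_bound_glue)
      show "oscillation_bound s t (\<lambda>r. u (\<sigma> r)) ?a"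
        by (intro gradient_off_oscillation[OF \<rho>(2) arc(1)] arc_integral_finite_mono[OF arc] leq)
      show "oscillation_bound s t (\<lambda>r. u (\<sigma> r)) ?b"
        by (intro gradient_off_oscillation[OF \<rho>'(2) arc(1)] arc_integral_finite_mono[OF arc] leq)
      show "(\<integral>\<^sup>+r\<in>{s..t}. ?a r \<partial>lborel) < \<infinity>" "(\<integral>\<^sup>+r\<in>{s..t}. ?b r \<partial>lborel) < \<infinity>"
        by (subst arc_integral_truncate; intro order_refl arc_integral_finite_mono[OF arc] leq)+
    qed measurable
    from oscillation_bound_ends[OF this arcs_le[OF arc(1)]]
    have "ennreal \<bar>u (\<sigma> s) - u (\<sigma> t)\<bar> \<le>
        (\<integral>\<^sup>+r\<in>{s..t}. (if r \<in> {r. ?a r \<le> ?b r} then ?a r else ?b r) \<partial>lborel)" .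
    also have "\<dots> = arc_integral (\<lambda>x. min (h x) (k x)) \<sigma> s t"
      by (intro nn_integral_cong) (auto split: split_indicator simp: min_def)
    finally show "ennreal \<bar>u (\<sigma> s) - u (\<sigma> t)\<bar> \<le> arc_integral (\<lambda>x. min (h x) (k x)) \<sigma> s t" .
  qed
  moreover have "p_integrable p N ?r"
    using assms(1) \<rho>(1) \<rho>'(1) fin by (intro p_integrable_add) auto
  ultimately show ?thesis
    using assms(1,2) by (subst weak_upper_gradient_iff) auto
qed

section \<open>Minimal weak upper gradients\<close>

text \<open>By closure under minima, a minimizing sequence can be taken decreasing; its limit is a weak upper
  gradient by monotone convergence on every curve outside a common exceptional family.\<close>
lemma minimal_weak_upper_gradient_exists:
  assumes "0 < p" "borel_on N" "weak_upper_gradient p N u h0" "p_integrable p N h0"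
  shows "\<exists>h. weak_upper_gradient p N u h \<and> (\<integral>\<^sup>+x. ennpowr (h x) p \<partial>N) < \<infinity> \<and>
    (\<forall>h'. weak_upper_gradient p N u h' \<longrightarrow>
        (\<integral>\<^sup>+x. ennpowr (h x) p \<partial>N) \<le> (\<integral>\<^sup>+x. ennpowr (h' x) p \<partial>N))"
proof -
  let ?I = "\<lambda>h. \<integral>\<^sup>+x. ennpowr (h x) p \<partial>N"
  let ?W = "{h. weak_upper_gradient p N u h \<and> p_integrable p N h}"
  have "h0 \<in> ?W" using assms by simp
  then have "?I ` ?W \<noteq> {}" by (metis image_is_empty empty_iff)
  from ennreal_Inf_countable_INF[OF this]
  obtain f where f: "range f \<subseteq> ?I ` ?W" "Inf (?I ` ?W) = (INF i::nat. f i)" by auto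
  have "\<forall>i. \<exists>h. h \<in> ?W \<and> f i = ?I h"
  proof
    fix i
    have "f i \<in> ?I ` ?W" using f(1) by (rule range_subsetD)
    then show "\<exists>h. h \<in> ?W \<and> f i = ?I h" by (rule imageE) (rule exI, rule conjI)
  qed
  from choice[OF this] obtain h where h: "\<And>i. h i \<in> ?W" "\<And>i. f i = ?I (h i)" by auto
  define k where "k = rec_nat (h 0) (\<lambda>n k x. min (k x) (h (Suc n) x))"
  have k_Suc: "k (Suc n) = (\<lambda>x. min (k n x) (h (Suc n) x))" and k_0: "k 0 = h 0" for n
    by (simp_all add: k_def)
  have k: "weak_upper_gradient p N u (k n) \<and> p_integrable p N (k n)" for n
  proof (induction n)
    case 0
    then show ?case using h(1)[of 0] by (simp add: k_0)
  next
    case (Suc n)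
    have "p_integrable p N (k (Suc n))"
      using h(1)[of "Suc n"] Suc assms(1) unfolding k_Suc
      by (intro p_integrable_mono[of p N "k n" "\<lambda>x. min (k n x) (h (Suc n) x)"]) (auto simp: p_integrable_def)
    then show ?case
      using weak_upper_gradient_min[OF assms(1,2), of u "k n" "h (Suc n)"] Suc h(1)[of "Suc n"]
      by (simp add: k_Suc)
  qed
  have kh: "k n x \<le> h n x" for n x by (cases n) (auto simp: k_0 k_Suc)
  have dec: "decseq (\<lambda>n. k n x)" for x by (intro decseq_SucI) (simp add: k_Suc)
  have km [measurable]: "k n \<in> borel_measurable N" for n using k[of n] by (simp add: p_integrable_def)
  define g where "g x = (INF n. k n x)" for x
  have gm [measurable]: "g \<in> borel_measurable N" unfolding g_def by measurable
  have gk: "g x \<le> k n x" for n x unfolding g_def by (rule INF_lower) simp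
  have gint: "p_integrable p N g"
    using assms(1) k[of 0] gk by (intro p_integrable_mono[of p N "k 0" g]) auto
  have "\<forall>n. \<exists>\<rho>. p_integrable p N \<rho> \<and> gradient_off N \<rho> u (k n)"
    using k assms(1,2) by (auto simp: weak_upper_gradient_iff)
  then obtain \<rho> where \<rho>: "\<And>n. p_integrable p N (\<rho> n)" "\<And>n. gradient_off N (\<rho> n) u (k n)" by metis
  obtain \<rho>' where \<rho>': "p_integrable p N \<rho>'" "\<forall>n \<sigma> s t. (\<sigma>, s, t) \<in> arcs (space N) \<longrightarrow>
      arc_integral \<rho>' \<sigma> s t < \<infinity> \<longrightarrow> arc_integral (\<rho> n) \<sigma> s t < \<infinity>"
    by (rule common_exceptional_function[OF assms(1,2) \<rho>(1)])
  have "gradient_off N (\<lambda>x. \<rho>' x + k 0 x) u g"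
    unfolding gradient_off_def
  proof safe
    fix \<sigma> s t assume arc: "(\<sigma>, s, t) \<in> arcs (space N)" "arc_integral (\<lambda>x. \<rho>' x + k 0 x) \<sigma> s t < \<infinity>"
    have fin: "arc_integral (k 0) \<sigma> s t < \<infinity>" "arc_integral \<rho>' \<sigma> s t < \<infinity>"
      by (rule arc_integral_finite_mono[OF arc], simp)+
    have "ennreal \<bar>u (\<sigma> s) - u (\<sigma> t)\<bar> \<le> arc_integral (k n) \<sigma> s t" for n
      using \<rho>'(2) arc(1) fin(2) by (intro gradient_offD[OF \<rho>(2)[of n]]) auto
    then have "ennreal \<bar>u (\<sigma> s) - u (\<sigma> t)\<bar> \<le> (INF n. arc_integral (k n) \<sigma> s t)"
      by (intro INF_greatest)
    also have "\<dots> = (\<integral>\<^sup>+r. (INF n. k n (\<sigma> r) * indicator {s..t} r) \<partial>lborel)"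
    proof (rule nn_integral_monotone_convergence_INF_decseq[symmetric])
      show "decseq (\<lambda>n r. k n (\<sigma> r) * indicator {s..t} r)"
        using decseqD[OF dec] by (intro monotoneI le_funI) (auto split: split_indicator)
      show "arc_integral (k 0) \<sigma> s t < \<infinity>" by (rule fin(1))
    qed (intro arc_measurable_lborel[OF assms(2) arc(1)] km)
    also have "\<dots> = arc_integral g \<sigma> s t"
      by (intro nn_integral_cong) (auto simp: g_def split: split_indicator)
    finally show "ennreal \<bar>u (\<sigma> s) - u (\<sigma> t)\<bar> \<le> arc_integral g \<sigma> s t" .
  qed
  moreover have "p_integrable p N (\<lambda>x. \<rho>' x + k 0 x)"
    using assms(1) \<rho>'(1) k[of 0] by (intro p_integrable_add) auto
  ultimately have g: "weak_upper_gradient p N u g"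
    using assms(1,2) by (subst weak_upper_gradient_iff) auto
  have "?I g \<le> f n" for n
    unfolding h(2) using gk[of _ n] kh[of n] assms(1)
    by (intro nn_integral_mono ennpowr_mono) (auto intro: order.trans)
  then have inf: "?I g \<le> Inf (?I ` ?W)" unfolding f(2) by (intro INF_greatest)
  have "?I g \<le> ?I h'" if h': "weak_upper_gradient p N u h'" for h'
  proof (cases "?I h' < \<infinity>")
    case True
    then have "h' \<in> ?W" using h' by (simp add: p_integrable_def weak_upper_gradient_def)
    then show ?thesis using inf INF_lower[of h' ?W ?I] by simp
  qed (auto simp: less_top[symmetric])
  then show ?thesis using g gint by (auto simp: p_integrable_def)
qed

definition p_weakly_differentiable :: "real \<Rightarrow> 'a::metric_space measure \<Rightarrow> ('a \<Rightarrow> real) \<Rightarrow> bool" where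
  "p_weakly_differentiable p N u \<longleftrightarrow> (\<exists>h. weak_upper_gradient p N u h \<and> p_integrable p N h)"

lemma min_upper_gradient:
  assumes "0 < p" "borel_on N" "p_weakly_differentiable p N u"
  shows "weak_upper_gradient p N u (min_upper_gradient p N u)"
    and "p_integrable p N (min_upper_gradient p N u)"
    and "\<And>h. weak_upper_gradient p N u h \<Longrightarrow>
      (\<integral>\<^sup>+x. ennpowr (min_upper_gradient p N u x) p \<partial>N) \<le> (\<integral>\<^sup>+x. ennpowr (h x) p \<partial>N)"
proof -
  obtain h0 where "weak_upper_gradient p N u h0" "p_integrable p N h0"
    using assms(3) by (auto simp: p_weakly_differentiable_def)
  note * = someI_ex[OF minimal_weak_upper_gradient_exists[OF assms(1,2) this],
      folded min_upper_gradient_def]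
  show "weak_upper_gradient p N u (min_upper_gradient p N u)"
    and "p_integrable p N (min_upper_gradient p N u)"
    and "\<And>h. weak_upper_gradient p N u h \<Longrightarrow>
      (\<integral>\<^sup>+x. ennpowr (min_upper_gradient p N u x) p \<partial>N) \<le> (\<integral>\<^sup>+x. ennpowr (h x) p \<partial>N)"
    using * by (simp_all add: p_integrable_def weak_upper_gradient_def[of p N u "min_upper_gradient p N u"])
qed

text \<open>Smallest norm implies smallest almost everywhere, as the pointwise minimum with a competitor is
  a competitor.\<close>
lemma min_upper_gradient_le_AE:
  assumes "0 < p" "borel_on N" "weak_upper_gradient p N u h" "p_integrable p N h"
  shows "AE x in N. min_upper_gradient p N u x \<le> h x"
proof -
  let ?g = "min_upper_gradient p N u"
  have d: "p_weakly_differentiable p N u" using assms(3,4) by (auto simp: p_weakly_differentiable_def)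
  note g = min_upper_gradient[OF assms(1,2) d]
  have [measurable]: "?g \<in> borel_measurable N" "h \<in> borel_measurable N"
    using g(2) assms(4) by (simp_all add: p_integrable_def)
  let ?m = "\<lambda>x. min (?g x) (h x)"
  have "weak_upper_gradient p N u ?m"
    by (rule weak_upper_gradient_min[OF assms(1,2) g(1) assms(3) g(2) assms(4)])
  then have le: "(\<integral>\<^sup>+x. ennpowr (?g x) p \<partial>N) \<le> (\<integral>\<^sup>+x. ennpowr (?m x) p \<partial>N)" by (rule g(3))
  have mono: "ennpowr (?m x) p \<le> ennpowr (?g x) p" for x
    using assms(1) by (intro ennpowr_mono) auto
  have fin: "(\<integral>\<^sup>+x. ennpowr (?g x) p \<partial>N) < \<infinity>" using g(2) by (simp add: p_integrable_def)
  have finm: "(\<integral>\<^sup>+x. ennpowr (?m x) p \<partial>N) < \<infinity>"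
    using nn_integral_mono[of N "\<lambda>x. ennpowr (?m x) p" "\<lambda>x. ennpowr (?g x) p"] mono fin
    by (auto intro: order.strict_trans1)
  have "(\<integral>\<^sup>+x. (ennpowr (?g x) p - ennpowr (?m x) p) \<partial>N) =
      (\<integral>\<^sup>+x. ennpowr (?g x) p \<partial>N) - (\<integral>\<^sup>+x. ennpowr (?m x) p \<partial>N)"
    using finm mono by (intro nn_integral_diff) auto
  also have "\<dots> = 0" using le fin by (simp add: diff_eq_0_iff_ennreal)
  finally have "AE x in N. ennpowr (?g x) p - ennpowr (?m x) p = 0"
    by (subst (asm) nn_integral_0_iff_AE) auto
  moreover have "AE x in N. ennpowr (?g x) p \<noteq> \<infinity>"
    using fin by (intro nn_integral_PInf_AE) auto
  ultimately show ?thesis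
  proof eventually_elim
    case (elim x)
    then have "ennpowr (?g x) p \<le> ennpowr (?m x) p" by (auto simp: diff_eq_0_iff_ennreal)
    then have "ennpowr (ennpowr (?g x) p) (1 / p) \<le> ennpowr (ennpowr (?m x) p) (1 / p)"
      using assms(1) by (intro ennpowr_mono[of "1 / p"]) auto
    then show ?case unfolding ennpowr_ennpowr_inverse(2)[OF assms(1)] by simp
  qed
qed

section \<open>Functions measurable with respect to the completion\<close>

lemma borel_measurable_completion_cong_AE:
  fixes f g :: "'a \<Rightarrow> 'b::topological_space"
  assumes f: "f \<in> borel_measurable (completion M)" and eq: "AE x in M. f x = g x"
  shows "g \<in> borel_measurable (completion M)"
proof (rule measurableI)
  fix A :: "'b set" assume A: "A \<in> sets borel"
  have eq': "AE x in completion M. f x = g x" using eq by (rule AE_completion)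
  have "g -` A \<inter> space (completion M) \<in> sets (completion M)"
  proof (rule complete_measure.in_sets_AE[of "completion M" "f -` A \<inter> space (completion M)"])
    show "complete_measure (completion M)" by unfold_locales
    show "AE x in completion M. (x \<in> f -` A \<inter> space (completion M)) = (x \<in> g -` A \<inter> space (completion M))"
      using eq' by eventually_elim auto
    show "f -` A \<inter> space (completion M) \<in> sets (completion M)"
      using f A by (rule measurable_sets)
  qed auto
  then show "g -` A \<inter> space (completion M) \<in> sets (completion M)" .
qed simp

text \<open>Curves can see null sets, so a function that is only measurable for the completion is replaced by
  a Borel function that is above it everywhere.\<close>
lemma completion_measurable_borel_majorant:
  fixes u :: "'a \<Rightarrow> real"
  assumes "u \<in> borel_measurable (completion N)"
  obtains v :: "'a \<Rightarrow> ennreal" where "v \<in> borel_measurable N"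
    "\<And>x. x \<in> space N \<Longrightarrow> ennreal \<bar>u x\<bar> \<le> v x" "AE x in N. v x = ennreal \<bar>u x\<bar>"
proof -
  obtain u' where u' [measurable]: "u' \<in> borel_measurable N" and eq: "AE x in N. u x = u' x"
    using completion_ex_borel_measurable_real[OF assms] by blast
  from AE_E[OF eq] obtain Z where Z: "{x \<in> space N. u x \<noteq> u' x} \<subseteq> Z" "emeasure N Z = 0" "Z \<in> sets N"
    by blast
  have [measurable]: "Z \<in> sets N" by fact
  let ?v = "\<lambda>x. if x \<in> Z then \<infinity> else ennreal \<bar>u' x\<bar>"
  have "AE x in N. x \<notin> Z" using Z by (intro AE_not_in) auto
  then have "AE x in N. ?v x = ennreal \<bar>u x\<bar>" using eq by eventually_elim auto
  moreover have "?v \<in> borel_measurable N" by measurable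
  moreover have "ennreal \<bar>u x\<bar> \<le> ?v x" if "x \<in> space N" for x
    using Z(1) that by auto
  ultimately show ?thesis using that by blast
qed

lemma completion_restrict_space_measurable_iff:
  fixes u :: "'a \<Rightarrow> 'b::{second_countable_topology, t2_space, zero}"
  assumes "\<Omega> \<in> sets M"
  shows "u \<in> borel_measurable (completion (restrict_space M \<Omega>)) \<longleftrightarrow>
    (\<lambda>x. if x \<in> \<Omega> then u x else 0) \<in> borel_measurable (completion M)"
proof -
  have \<Omega>: "\<Omega> \<inter> space M = \<Omega>" "\<Omega> \<subseteq> space M" using sets.sets_into_space[OF assms] by auto
  have eq: "sets (completion (restrict_space M \<Omega>)) = sets (restrict_space (completion M) \<Omega>)"
  proof (intro set_eqI iffI)
    fix A assume "A \<in> sets (completion (restrict_space M \<Omega>))"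
    then obtain S Z Z' where A: "A = S \<union> Z" "Z \<subseteq> Z'" "Z' \<in> null_sets (restrict_space M \<Omega>)" "S \<in> sets (restrict_space M \<Omega>)"
      by (auto elim: sets_completionE)
    then have "Z' \<in> null_sets M" "S \<in> sets M" "S \<subseteq> \<Omega>" "Z' \<subseteq> \<Omega>"
      using assms \<Omega> by (auto simp: null_sets_restrict_space sets_restrict_space_iff)
    then have "A \<in> sets (completion M)" "A \<subseteq> \<Omega>" using A sets_completionI[of A S Z Z' M] by auto
    then show "A \<in> sets (restrict_space (completion M) \<Omega>)"
      using assms \<Omega> by (subst sets_restrict_space_iff) auto
  next
    fix A assume "A \<in> sets (restrict_space (completion M) \<Omega>)"
    then have "A \<in> sets (completion M)" "A \<subseteq> \<Omega>"
      using assms \<Omega> by (auto simp: sets_restrict_space_iff)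
    then obtain S Z Z' where A: "A = S \<union> Z" "Z \<subseteq> Z'" "Z' \<in> null_sets M" "S \<in> sets M" "S \<union> Z \<subseteq> \<Omega>"
      by (auto elim: sets_completionE)
    then have "Z' \<inter> \<Omega> \<in> null_sets (restrict_space M \<Omega>)" "S \<in> sets (restrict_space M \<Omega>)"
      using assms \<Omega> by (auto simp: null_sets_restrict_space sets_restrict_space_iff intro: null_set_Int2)
    then show "A \<in> sets (completion (restrict_space M \<Omega>))"
      using A by (intro sets_completionI[of A S Z "Z' \<inter> \<Omega>"]) auto
  qed
  have "u \<in> borel_measurable (completion (restrict_space M \<Omega>)) \<longleftrightarrow>
      u \<in> borel_measurable (restrict_space (completion M) \<Omega>)"
    unfolding measurable_cong_sets[OF eq refl] ..
  also have "\<dots> \<longleftrightarrow> (\<lambda>x. if x \<in> \<Omega> then u x else 0) \<in> borel_measurable (completion M)"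
    using assms \<Omega> by (subst measurable_restrict_space_iff[where c = 0]) auto
  finally show ?thesis .
qed

section \<open>Locality and cutoffs\<close>

text \<open>On a curve, the part between the first and the last zero can be skipped, so a weak upper
  gradient remains one after it is set to zero where \<open>w = 0\<close>; by minimality nothing was lost.\<close>
lemma min_upper_gradient_zero_set:
  assumes "0 < p" "borel_on N" and w: "p_weakly_differentiable p N w"
    and wm: "w \<in> borel_measurable (completion N)"
  shows "AE x in N. w x = 0 \<longrightarrow> min_upper_gradient p N w x = 0"
proof -
  let ?g = "min_upper_gradient p N w"
  note g = min_upper_gradient[OF assms(1,2) w]
  have gm [measurable]: "?g \<in> borel_measurable N" using g(2) by (simp add: p_integrable_def)
  obtain v where vm [measurable]: "v \<in> borel_measurable N"
    and v: "\<And>x. x \<in> space N \<Longrightarrow> ennreal \<bar>w x\<bar> \<le> v x" "AE x in N. v x = ennreal \<bar>w x\<bar>"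
    using completion_measurable_borel_majorant[OF wm] by blast
  obtain \<rho> where \<rho>: "p_integrable p N \<rho>" "gradient_off N \<rho> w ?g"
    using g(1) assms(1,2) by (auto simp: weak_upper_gradient_iff)
  let ?h = "\<lambda>x. if v x = 0 then 0 else ?g x"
  have hm [measurable]: "?h \<in> borel_measurable N" by measurable
  have "gradient_off N (\<lambda>x. \<rho> x + ?g x) w ?h"
    unfolding gradient_off_def
  proof safe
    fix \<sigma> s t assume arc: "(\<sigma>, s, t) \<in> arcs (space N)" "arc_integral (\<lambda>x. \<rho> x + ?g x) \<sigma> s t < \<infinity>"
    let ?a = "\<lambda>r. ?g (\<sigma> r) * indicator {s..t} r"
    have fin: "arc_integral \<rho> \<sigma> s t < \<infinity>" "arc_integral ?g \<sigma> s t < \<infinity>"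
      by (rule arc_integral_finite_mono[OF arc], simp)+
    have am [measurable]: "?a \<in> borel_measurable borel" by (rule arc_measurable[OF assms(2) arc(1) gm])
    note osc = gradient_off_oscillation[OF \<rho>(2) arc(1) fin(1)]
    have "continuous_on {s..t} (\<lambda>r. w (\<sigma> r))"
      using fin(2) by (intro oscillation_bound_continuous[OF am osc]) (simp add: arc_integral_truncate)
    from oscillation_bound_ends[OF oscillation_bound_off_zeros[OF am osc this] arcs_le[OF arc(1)]]
    have "ennreal \<bar>w (\<sigma> s) - w (\<sigma> t)\<bar> \<le>
      (\<integral>\<^sup>+r\<in>{s..t}. (if r \<in> {s..t} \<and> w (\<sigma> r) = 0 then 0 else ?a r) \<partial>lborel)" .
    also have "\<dots> \<le> arc_integral ?h \<sigma> s t"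
    proof (rule nn_integral_mono)
      fix r
      show "(if r \<in> {s..t} \<and> w (\<sigma> r) = 0 then 0 else ?a r) * indicator {s..t} r \<le> ?h (\<sigma> r) * indicator {s..t} r"
        using v(1)[OF arcs_in[OF arc(1)], of r] by (auto split: split_indicator)
    qed
    finally show "ennreal \<bar>w (\<sigma> s) - w (\<sigma> t)\<bar> \<le> arc_integral ?h \<sigma> s t" .
  qed
  moreover have "p_integrable p N (\<lambda>x. \<rho> x + ?g x)"
    using assms(1) \<rho>(1) g(2) by (intro p_integrable_add) auto
  ultimately have h: "weak_upper_gradient p N w ?h"
    using assms(1,2) hm by (subst weak_upper_gradient_iff) auto
  have "p_integrable p N ?h"
    using assms(1) g(2) hm by (intro p_integrable_mono[of p N ?g ?h]) auto
  from min_upper_gradient_le_AE[OF assms(1,2) h this] v(2) show ?thesis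
    by eventually_elim auto
qed

lemma borel_on_whole: "sets M = sets borel \<Longrightarrow> borel_on M"
  by (simp add: borel_on_def sets_eq_imp_space_eq sets_restrict_UNIV)

lemma borel_on_restrict:
  assumes "sets M = sets borel"
  shows "borel_on (restrict_space M \<Omega>)"
  using assms sets_eq_imp_space_eq[OF assms]
    sets_restrict_space_cong[OF assms, of \<Omega>]
  by (simp add: borel_on_def space_restrict_space)

lemma p_integrable_extend:
  assumes "\<Omega> \<in> sets M" "p_integrable p (restrict_space M \<Omega>) \<rho>"
  shows "p_integrable p M (\<lambda>x. \<rho> x * indicator \<Omega> x)"
proof -
  have \<Omega>: "\<Omega> \<inter> space M \<in> sets M" using assms(1) by simp
  have "(\<lambda>x. \<rho> x * indicator \<Omega> x) \<in> borel_measurable M"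
    using assms(2) borel_measurable_restrict_space_iff_ennreal[OF \<Omega>, of \<rho>] by (simp add: p_integrable_def)
  moreover have "(\<integral>\<^sup>+x. ennpowr (\<rho> x * indicator \<Omega> x) p \<partial>M) = (\<integral>\<^sup>+x. ennpowr (\<rho> x) p \<partial>restrict_space M \<Omega>)"
    unfolding nn_integral_restrict_space[OF \<Omega>]
    by (intro nn_integral_cong) (auto split: split_indicator)
  ultimately show ?thesis using assms(2) by (simp add: p_integrable_def)
qed

lemma p_integrable_restrict:
  assumes "\<Omega> \<in> sets M" "p_integrable p M \<rho>"
  shows "p_integrable p (restrict_space M \<Omega>) \<rho>"
proof -
  have \<Omega>: "\<Omega> \<inter> space M \<in> sets M" using assms(1) by simp
  have "(\<integral>\<^sup>+x. ennpowr (\<rho> x) p \<partial>restrict_space M \<Omega>) \<le> (\<integral>\<^sup>+x. ennpowr (\<rho> x) p \<partial>M)"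
    unfolding nn_integral_restrict_space[OF \<Omega>]
    by (intro nn_integral_mono) (auto split: split_indicator)
  with assms(2) show ?thesis
    by (auto simp: p_integrable_def intro: measurable_restrict_space1 order.strict_trans1)
qed

lemma weak_upper_gradient_restrict:
  assumes "0 < p" "sets M = sets borel" "\<Omega> \<in> sets M" "weak_upper_gradient p M u h"
  shows "weak_upper_gradient p (restrict_space M \<Omega>) u h"
proof -
  obtain \<rho> where \<rho>: "p_integrable p M \<rho>" "gradient_off M \<rho> u h" "h \<in> borel_measurable M"
    using assms(1,4) borel_on_whole[OF assms(2)] by (auto simp: weak_upper_gradient_iff)
  have "arcs (space (restrict_space M \<Omega>)) \<subseteq> arcs (space M)"
    by (intro arcs_mono) (auto simp: space_restrict_space)
  then have "gradient_off (restrict_space M \<Omega>) \<rho> u h"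
    using \<rho>(2) unfolding gradient_off_def by blast
  then show ?thesis
    using \<rho>(1,3) p_integrable_restrict[OF assms(3) \<rho>(1)] borel_on_restrict[OF assms(2)] assms(1)
    by (subst weak_upper_gradient_iff) (auto intro: measurable_restrict_space1)
qed

lemma lipschitz_oscillation:
  assumes \<eta>: "L-lipschitz_on UNIV \<eta>" and arc: "(\<sigma>, s, t) \<in> arcs S"
  shows "oscillation_bound s t (\<lambda>r. \<eta> (\<sigma> r)) (\<lambda>r. ennreal L * indicator {s..t} r)"
  unfolding oscillation_bound_def
proof (intro allI impI)
  fix x y assume xy: "s \<le> x" "x \<le> y" "y \<le> t"
  have L: "0 \<le> L" using \<eta> by (rule lipschitz_on_nonneg)
  have "\<bar>\<eta> (\<sigma> x) - \<eta> (\<sigma> y)\<bar> \<le> L * dist (\<sigma> x) (\<sigma> y)"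
    using lipschitz_onD[OF \<eta>, of "\<sigma> x" "\<sigma> y"] by (simp add: dist_real_def)
  also have "\<dots> \<le> L * (y - x)"
    using lipschitz_onD[OF arcs_lipschitz[OF arc], of x y] xy L by (intro mult_left_mono) (auto simp: dist_real_def)
  finally have "ennreal \<bar>\<eta> (\<sigma> x) - \<eta> (\<sigma> y)\<bar> \<le> ennreal L * ennreal (y - x)"
    using L xy by (simp add: ennreal_mult[symmetric] ennreal_leI)
  also have "\<dots> = (\<integral>\<^sup>+r. ennreal L * indicator {x..y} r \<partial>lborel)"
    using xy by (simp add: nn_integral_cmult_indicator)
  also have "\<dots> = (\<integral>\<^sup>+r\<in>{x..y}. (ennreal L * indicator {s..t} r) \<partial>lborel)"
    using xy by (intro nn_integral_cong) (auto split: split_indicator)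
  finally show "ennreal \<bar>\<eta> (\<sigma> x) - \<eta> (\<sigma> y)\<bar> \<le> (\<integral>\<^sup>+r\<in>{x..y}. (ennreal L * indicator {s..t} r) \<partial>lborel)" .
qed

lemma continuous_on_near_open:
  fixes f :: "'b::metric_space \<Rightarrow> 'a::metric_space"
  assumes "continuous_on S f" "z \<in> S" "open W" "f z \<in> W"
  shows "\<exists>d>0. \<forall>r\<in>S. dist r z < d \<longrightarrow> f r \<in> W"
proof -
  obtain e where "0 < e" "ball (f z) e \<subseteq> W" using assms(3,4) by (auto elim: openE)
  moreover from this obtain d where "0 < d" "\<forall>r\<in>S. dist r z < d \<longrightarrow> dist (f r) (f z) < e"
    using assms(1,2) unfolding continuous_on_iff by metis
  ultimately show ?thesis by (auto simp: subset_eq dist_commute)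
qed

text \<open>
  The Leibniz rule for a cutoff function \<open>\<eta>\<close>, on curves that may leave \<open>\<Omega>\<close>. It is a local statement
  along the curve: near a point of \<open>\<Omega>\<close> the function \<open>u\<close> is nearly constant, and near a point
  outside \<open>\<Omega>\<close> the product vanishes. The derivative of \<open>\<eta>\<close> vanishes where \<open>\<eta> = 1\<close>.
\<close>
lemma cutoff_oscillation:
  fixes \<Omega> :: "'a::metric_space set" and u \<eta> :: "'a \<Rightarrow> real"
  assumes M: "sets M = sets borel" and \<Omega>: "open \<Omega>"
    and \<eta>: "L-lipschitz_on UNIV \<eta>" "\<And>x. 0 \<le> \<eta> x" "\<And>x. \<eta> x \<le> 1" "closure {x. \<eta> x \<noteq> 0} \<subseteq> \<Omega>"
    and u: "gradient_off (restrict_space M \<Omega>) \<rho> u h"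
    and hm: "(\<lambda>x. h x * indicator \<Omega> x) \<in> borel_measurable M" and vm: "v \<in> borel_measurable M"
    and v: "\<And>x. x \<in> \<Omega> \<Longrightarrow> ennreal \<bar>u x\<bar> \<le> v x"
    and arc: "(\<sigma>, s, t) \<in> arcs UNIV"
    and fin: "arc_integral (\<lambda>x. \<rho> x * indicator \<Omega> x) \<sigma> s t < \<infinity>"
      "arc_integral (\<lambda>x. h x * indicator \<Omega> x) \<sigma> s t < \<infinity>"
  shows "ennreal \<bar>\<eta> (\<sigma> s) * u (\<sigma> s) - \<eta> (\<sigma> t) * u (\<sigma> t)\<bar> \<le>
    arc_integral (\<lambda>x. h x * indicator \<Omega> x + ennreal L * v x * indicator {x. \<eta> x \<noteq> 1} x) \<sigma> s t"
proof -
  have spM: "space M = UNIV" using sets_eq_imp_space_eq[OF M] by simp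
  note bM = borel_on_whole[OF M]
  have arcM: "(\<sigma>, s, t) \<in> arcs (space M)" using arc by (simp add: spM)
  have st: "s \<le> t" by (rule arcs_le[OF arc])
  have L: "0 \<le> L" using \<eta>(1) by (rule lipschitz_on_nonneg)
  have \<sigma>c: "continuous_on {s..t} \<sigma>" by (rule arcs_continuous[OF arc])
  have \<eta>c: "continuous_on UNIV \<eta>" using \<eta>(1) by (rule lipschitz_on_continuous_on)
  have [measurable]: "\<eta> \<in> borel_measurable M"
    unfolding measurable_cong_sets[OF M refl] by (rule borel_measurable_continuous_onI[OF \<eta>c])
  note [measurable] = vm hm
  let ?E = "{x. \<eta> x \<noteq> 1}"
  have Em [measurable]: "?E \<in> sets M"
  proof -
    have "{x \<in> space M. \<eta> x \<noteq> 1} \<in> sets M" by measurable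
    then show ?thesis by (simp add: spM)
  qed
  let ?a = "\<lambda>r. h (\<sigma> r) * indicator \<Omega> (\<sigma> r) * indicator {s..t} r"
  let ?b = "\<lambda>r. ennreal L * indicator ?E (\<sigma> r) * indicator {s..t} r"
  let ?c = "\<lambda>r. (h (\<sigma> r) * indicator \<Omega> (\<sigma> r) + ennreal L * v (\<sigma> r) * indicator ?E (\<sigma> r)) * indicator {s..t} r"
  let ?\<psi> = "\<lambda>r. \<eta> (\<sigma> r) * u (\<sigma> r)"
  have am [measurable]: "?a \<in> borel_measurable borel"
    using arc_measurable[OF bM arcM hm] .
  have bm [measurable]: "?b \<in> borel_measurable borel"
    by (rule arc_measurable[OF bM arcM]) measurable
  have cm [measurable]: "?c \<in> borel_measurable borel"
    by (rule arc_measurable[OF bM arcM]) measurable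
  have bosc: "oscillation_bound s t (\<lambda>r. \<eta> (\<sigma> r)) ?b"
  proof -
    have "oscillation_bound s t (\<lambda>r. 1 - \<eta> (\<sigma> r)) (\<lambda>r. ennreal L * indicator {s..t} r)"
      using lipschitz_oscillation[OF \<eta>(1) arc] by (simp add: oscillation_bound_def abs_minus_commute)
    moreover have "continuous_on {s..t} (\<lambda>r. 1 - \<eta> (\<sigma> r))"
      by (intro continuous_intros continuous_on_compose2[OF \<eta>c \<sigma>c]) auto
    ultimately have "oscillation_bound s t (\<lambda>r. 1 - \<eta> (\<sigma> r))
        (\<lambda>r. if r \<in> {s..t} \<and> 1 - \<eta> (\<sigma> r) = 0 then 0 else ennreal L * indicator {s..t} r)"
      by (intro oscillation_bound_off_zeros) measurable
    also have "(\<lambda>r. if r \<in> {s..t} \<and> 1 - \<eta> (\<sigma> r) = 0 then 0 else ennreal L * indicator {s..t} r) = ?b"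
      by (auto split: split_indicator)
    finally show ?thesis by (simp add: oscillation_bound_def abs_minus_commute)
  qed
  have eps: "ennreal \<bar>?\<psi> s - ?\<psi> t\<bar> \<le> (\<integral>\<^sup>+r\<in>{s..t}. (?c r + ennreal e * ?b r) \<partial>lborel)" if e: "0 < e" for e
  proof -
    let ?f = "\<lambda>r. ?c r + ennreal e * ?b r"
    have fm: "?f \<in> borel_measurable borel" by measurable
    have "s \<le> s \<longrightarrow> t \<le> t \<longrightarrow> ennreal \<bar>?\<psi> s - ?\<psi> t\<bar> \<le> (\<integral>\<^sup>+r\<in>{s..t}. ?f r \<partial>lborel)"
      using st
      \<comment> \<open>subdivision: the inequality is additive in the interval and holds on short intervals\<close>
    proof (induction s t rule: Bolzano[where P = "\<lambda>x y. s \<le> x \<longrightarrow> y \<le> t \<longrightarrow> ennreal \<bar>?\<psi> x - ?\<psi> y\<bar> \<le> (\<integral>\<^sup>+r\<in>{x..y}. ?f r \<partial>lborel)"])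
      case (trans x y z)
      show ?case
      proof (intro impI)
        assume xz: "s \<le> x" "z \<le> t"
        have "ennreal \<bar>?\<psi> x - ?\<psi> z\<bar> \<le> ennreal \<bar>?\<psi> x - ?\<psi> y\<bar> + ennreal \<bar>?\<psi> y - ?\<psi> z\<bar>"
          by (simp add: ennreal_plus[symmetric] ennreal_leI del: ennreal_plus)
        also have "\<dots> \<le> (\<integral>\<^sup>+r\<in>{x..y}. ?f r \<partial>lborel) + (\<integral>\<^sup>+r\<in>{y..z}. ?f r \<partial>lborel)"
          using trans xz by (intro add_mono) auto
        also have "\<dots> = (\<integral>\<^sup>+r\<in>{x..z}. ?f r \<partial>lborel)"
          using trans by (intro interval_integral_split[symmetric] fm) auto
        finally show "ennreal \<bar>?\<psi> x - ?\<psi> z\<bar> \<le> (\<integral>\<^sup>+r\<in>{x..z}. ?f r \<partial>lborel)" .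
      qed
    next
      case (local z)
      then have z: "z \<in> {s..t}" by simp
      show ?case
      proof (cases "\<sigma> z \<in> \<Omega>")
        case False
        then have "\<sigma> z \<in> - closure {x. \<eta> x \<noteq> 0}" using \<eta>(4) by blast
        then obtain d where d: "0 < d" "\<And>r. r \<in> {s..t} \<Longrightarrow> dist r z < d \<Longrightarrow> \<sigma> r \<in> - closure {x. \<eta> x \<noteq> 0}"
          using continuous_on_near_open[OF \<sigma>c z, of "- closure {x. \<eta> x \<noteq> 0}"] by (auto simp: open_Compl)
        show ?thesis
        proof (intro exI[of _ d] conjI allI impI d(1))
          fix x y assume xy: "x \<le> z \<and> z \<le> y \<and> y - x < d" "s \<le> x" "y \<le> t"
          have "\<sigma> x \<in> - closure {x. \<eta> x \<noteq> 0}" "\<sigma> y \<in> - closure {x. \<eta> x \<noteq> 0}"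
            using d(2)[of x] d(2)[of y] xy by (auto simp: dist_real_def)
          moreover have "\<eta> q = 0" if "q \<in> - closure {x. \<eta> x \<noteq> 0}" for q
            using that closure_subset[of "{x. \<eta> x \<noteq> 0}"] by blast
          ultimately have "\<eta> (\<sigma> x) = 0" "\<eta> (\<sigma> y) = 0" by blast+
          then show "ennreal \<bar>?\<psi> x - ?\<psi> y\<bar> \<le> (\<integral>\<^sup>+r\<in>{x..y}. ?f r \<partial>lborel)" by simp
        qed
      next
        case True
        then obtain d where d: "0 < d" "\<And>r. r \<in> {s..t} \<Longrightarrow> dist r z < d \<Longrightarrow> \<sigma> r \<in> \<Omega>"
          using continuous_on_near_open[OF \<sigma>c z \<Omega>] by auto
        define s1 where "s1 = max s (z - d / 2)"
        define t1 where "t1 = min t (z + d / 2)"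
        have s1t1: "s \<le> s1" "s1 \<le> t1" "t1 \<le> t" "s1 \<le> z" "z \<le> t1"
          using z d(1) by (auto simp: s1_def t1_def)
        have in\<Omega>: "\<sigma> r \<in> \<Omega>" if "r \<in> {s1..t1}" for r
          using that d(1) by (intro d(2)) (auto simp: s1_def t1_def dist_real_def)
        have arc1: "(\<sigma>, s1, t1) \<in> arcs (space (restrict_space M \<Omega>))"
          using arcs_subset[OF arcs_subinterval[OF arc s1t1(1-3)], of \<Omega>] in\<Omega>
          by (auto simp: space_restrict_space spM image_subset_iff)
        have "arc_integral \<rho> \<sigma> s1 t1 = arc_integral (\<lambda>x. \<rho> x * indicator \<Omega> x) \<sigma> s1 t1"
          using in\<Omega> by (intro nn_integral_cong) (auto split: split_indicator)
        also have "\<dots> < \<infinity>"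
          using arc_integral_subinterval[OF s1t1(1,3)] fin(1) by (rule order.strict_trans1)
        finally have osc1: "oscillation_bound s1 t1 (\<lambda>r. u (\<sigma> r)) (\<lambda>r. h (\<sigma> r) * indicator {s1..t1} r)"
          by (rule gradient_off_oscillation[OF u arc1])
        have osc: "oscillation_bound s1 t1 (\<lambda>r. u (\<sigma> r)) ?a"
          unfolding oscillation_bound_def
        proof (intro allI impI)
          fix x y assume xy: "s1 \<le> x" "x \<le> y" "y \<le> t1"
          have "(\<integral>\<^sup>+r\<in>{x..y}. (h (\<sigma> r) * indicator {s1..t1} r) \<partial>lborel) = (\<integral>\<^sup>+r\<in>{x..y}. ?a r \<partial>lborel)"
            using in\<Omega> xy s1t1 by (intro nn_integral_cong) (auto split: split_indicator)
          then show "ennreal \<bar>u (\<sigma> x) - u (\<sigma> y)\<bar> \<le> (\<integral>\<^sup>+r\<in>{x..y}. ?a r \<partial>lborel)"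
            using oscillation_boundD[OF osc1 xy] by simp
        qed
        have "(\<integral>\<^sup>+r\<in>{s1..t1}. ?a r \<partial>lborel) \<le> arc_integral (\<lambda>x. h x * indicator \<Omega> x) \<sigma> s t"
          using s1t1 by (intro nn_integral_mono) (auto split: split_indicator)
        then have "(\<integral>\<^sup>+r\<in>{s1..t1}. ?a r \<partial>lborel) < \<infinity>" using fin(2) by (rule order.strict_trans1)
        then have "continuous_on {s1..t1} (\<lambda>r. u (\<sigma> r))"
          by (rule oscillation_bound_continuous[OF am osc])
        moreover have "z \<in> {s1..t1}" "0 < e / 2" using s1t1 e by auto
        ultimately obtain d' where d': "0 < d'"
          "\<And>r. r \<in> {s1..t1} \<Longrightarrow> dist r z < d' \<Longrightarrow> dist (u (\<sigma> r)) (u (\<sigma> z)) < e / 2"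
          unfolding continuous_on_iff by metis
        show ?thesis
        proof (intro exI[of _ "min (d / 2) d'"] conjI allI impI)
          show "0 < min (d / 2) d'" using d d' by simp
          fix x y assume xy: "x \<le> z \<and> z \<le> y \<and> y - x < min (d / 2) d'" "s \<le> x" "y \<le> t"
          have xy1: "s1 \<le> x" "x \<le> y" "y \<le> t1"
            using xy by (auto simp: s1_def t1_def)
          have close: "ennreal \<bar>u (\<sigma> y)\<bar> \<le> v (\<sigma> r) + ennreal e" if "r \<in> {x..y}" for r
          proof -
            have "dist (u (\<sigma> r)) (u (\<sigma> z)) < e / 2" "dist (u (\<sigma> y)) (u (\<sigma> z)) < e / 2"
              by (rule d'(2); use that xy xy1 in \<open>force simp: dist_real_def\<close>)+
            then have "\<bar>u (\<sigma> y)\<bar> \<le> \<bar>u (\<sigma> r)\<bar> + e"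
              unfolding dist_real_def by linarith
            then have "ennreal \<bar>u (\<sigma> y)\<bar> \<le> ennreal \<bar>u (\<sigma> r)\<bar> + ennreal e"
              using e by (simp add: ennreal_plus[symmetric] ennreal_leI del: ennreal_plus)
            also have "\<dots> \<le> v (\<sigma> r) + ennreal e"
              using that xy1 by (intro add_right_mono v in\<Omega>) auto
            finally show ?thesis .
          qed
          have "\<bar>?\<psi> x - ?\<psi> y\<bar> = \<bar>\<eta> (\<sigma> x) * (u (\<sigma> x) - u (\<sigma> y)) + u (\<sigma> y) * (\<eta> (\<sigma> x) - \<eta> (\<sigma> y))\<bar>"
            by (simp add: algebra_simps)
          also have "\<dots> \<le> \<bar>\<eta> (\<sigma> x)\<bar> * \<bar>u (\<sigma> x) - u (\<sigma> y)\<bar> + \<bar>u (\<sigma> y)\<bar> * \<bar>\<eta> (\<sigma> x) - \<eta> (\<sigma> y)\<bar>"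
            by (simp only: abs_mult[symmetric] abs_triangle_ineq)
          also have "\<dots> \<le> 1 * \<bar>u (\<sigma> x) - u (\<sigma> y)\<bar> + \<bar>u (\<sigma> y)\<bar> * \<bar>\<eta> (\<sigma> x) - \<eta> (\<sigma> y)\<bar>"
            using \<eta>(2,3) by (intro add_mono mult_right_mono) auto
          finally have "ennreal \<bar>?\<psi> x - ?\<psi> y\<bar> \<le>
              ennreal \<bar>u (\<sigma> x) - u (\<sigma> y)\<bar> + ennreal \<bar>u (\<sigma> y)\<bar> * ennreal \<bar>\<eta> (\<sigma> x) - \<eta> (\<sigma> y)\<bar>"
            by (simp add: ennreal_mult[symmetric] ennreal_plus[symmetric] ennreal_leI del: ennreal_plus)
          also have "\<dots> \<le> (\<integral>\<^sup>+r\<in>{x..y}. ?a r \<partial>lborel) + ennreal \<bar>u (\<sigma> y)\<bar> * (\<integral>\<^sup>+r\<in>{x..y}. ?b r \<partial>lborel)"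
            using xy xy1 by (intro add_mono mult_left_mono oscillation_boundD[OF osc] oscillation_boundD[OF bosc]) auto
          also have "\<dots> = (\<integral>\<^sup>+r. ?a r * indicator {x..y} r + ennreal \<bar>u (\<sigma> y)\<bar> * (?b r * indicator {x..y} r) \<partial>lborel)"
            by (subst nn_integral_add) (auto simp: nn_integral_cmult)
          also have "\<dots> \<le> (\<integral>\<^sup>+r\<in>{x..y}. ?f r \<partial>lborel)"
          proof (rule nn_integral_mono)
            fix r
            show "?a r * indicator {x..y} r + ennreal \<bar>u (\<sigma> y)\<bar> * (?b r * indicator {x..y} r) \<le> ?f r * indicator {x..y} r"
            proof (cases "r \<in> {x..y}")
              case True
              have "ennreal \<bar>u (\<sigma> y)\<bar> * ?b r \<le> (v (\<sigma> r) + ennreal e) * ?b r"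
                by (intro mult_right_mono close True) simp
              then have "?a r + ennreal \<bar>u (\<sigma> y)\<bar> * ?b r \<le> ?a r + (v (\<sigma> r) + ennreal e) * ?b r"
                by (rule add_left_mono)
              also have "\<dots> = ?f r" by (simp add: algebra_simps)
              finally show ?thesis using True by simp
            qed simp
          qed
          finally show "ennreal \<bar>?\<psi> x - ?\<psi> y\<bar> \<le> (\<integral>\<^sup>+r\<in>{x..y}. ?f r \<partial>lborel)" .
        qed
      qed
    qed
    then show ?thesis by simp
  qed
  have bfin: "(\<integral>\<^sup>+r\<in>{s..t}. ?b r \<partial>lborel) \<le> ennreal (L * (t - s))"
  proof -
    have "(\<integral>\<^sup>+r\<in>{s..t}. ?b r \<partial>lborel) \<le> (\<integral>\<^sup>+r. ennreal L * indicator {s..t} r \<partial>lborel)"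
      by (intro nn_integral_mono) (auto split: split_indicator)
    also have "\<dots> = ennreal (L * (t - s))"
      using st L by (simp add: nn_integral_cmult_indicator ennreal_mult)
    finally show ?thesis .
  qed
  have "ennreal \<bar>?\<psi> s - ?\<psi> t\<bar> \<le> (\<integral>\<^sup>+r\<in>{s..t}. ?c r \<partial>lborel)"
  proof (rule ennreal_le_epsilon)
    fix e :: real assume e: "0 < e"
    have K: "0 < L * (t - s) + 1" "0 \<le> L * (t - s)" using L st by (auto simp: add_nonneg_pos)
    let ?e = "e / (L * (t - s) + 1)"
    have e': "0 < ?e" using e K by simp
    have "ennreal \<bar>?\<psi> s - ?\<psi> t\<bar> \<le> (\<integral>\<^sup>+r\<in>{s..t}. (?c r + ennreal ?e * ?b r) \<partial>lborel)"
      by (rule eps[OF e'])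
    also have "\<dots> = (\<integral>\<^sup>+r. ?c r * indicator {s..t} r + ennreal ?e * (?b r * indicator {s..t} r) \<partial>lborel)"
      by (intro nn_integral_cong) (auto split: split_indicator)
    also have "\<dots> = (\<integral>\<^sup>+r\<in>{s..t}. ?c r \<partial>lborel) + ennreal ?e * (\<integral>\<^sup>+r\<in>{s..t}. ?b r \<partial>lborel)"
      by (subst nn_integral_add) (auto simp: nn_integral_cmult)
    also have "\<dots> \<le> (\<integral>\<^sup>+r\<in>{s..t}. ?c r \<partial>lborel) + ennreal ?e * ennreal (L * (t - s))"
      by (intro add_left_mono mult_left_mono bfin) simp
    also have "ennreal ?e * ennreal (L * (t - s)) \<le> ennreal e"
      using e K by (subst ennreal_mult[symmetric]) (auto intro!: ennreal_leI simp: divide_simps mult_left_mono)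
    finally show "ennreal \<bar>?\<psi> s - ?\<psi> t\<bar> \<le> (\<integral>\<^sup>+r\<in>{s..t}. ?c r \<partial>lborel) + ennreal e"
      by (simp add: add_left_mono)
  qed
  also have "\<dots> = arc_integral (\<lambda>x. h x * indicator \<Omega> x + ennreal L * v x * indicator ?E x) \<sigma> s t"
    by (intro nn_integral_cong) (auto split: split_indicator)
  finally show ?thesis .
qed

section \<open>Properness and cutoff functions\<close>

lemma doubling_ball_finite:
  assumes "doubling M"
  shows "emeasure M (ball x r) < \<infinity>"
proof (cases "r > 0")
  case True
  obtain C where C: "C \<ge> 1" "ennreal C * emeasure M (ball x r) < \<infinity>"
    using assms True unfolding doubling_def by blast
  have "1 * emeasure M (ball x r) \<le> ennreal C * emeasure M (ball x r)"
    using C(1) by (intro mult_right_mono) auto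
  then show ?thesis using C(2) by (simp add: order.strict_trans1)
next
  case False
  then show ?thesis by (simp add: ball_empty)
qed

text \<open>Disjoint balls of the same radius with centres in a fixed ball all have measure at least a fixed
  multiple of the measure of that ball, so there are boundedly many of them.\<close>
lemma doubling_separated_finite:
  fixes M :: "'a::metric_space measure" and S :: "'a set"
  assumes M: "sets M = sets borel" and dbl: "doubling M"
    and S: "S \<subseteq> ball x0 R" and e: "0 < e"
    and sep: "\<And>x y. x \<in> S \<Longrightarrow> y \<in> S \<Longrightarrow> x \<noteq> y \<Longrightarrow> e \<le> dist x y"
  shows "finite S"
proof (cases "S = {}")
  case False
  then have R: "0 < R" using S by (metis all_not_in_conv ball_eq_empty linorder_not_le subset_empty)
  obtain C where C: "C \<ge> 1" and dC: "\<And>x r. r > 0 \<Longrightarrow> emeasure M (ball x (2 * r)) \<le> ennreal C * emeasure M (ball x r)"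
    and pos: "\<And>x r. r > 0 \<Longrightarrow> 0 < emeasure M (ball x (2 * r))"
    using dbl unfolding doubling_def by metis
  have iter: "emeasure M (ball x (2 ^ k * r)) \<le> ennreal (C ^ k) * emeasure M (ball x r)" if "r > 0" for x r k
  proof (induction k)
    case (Suc k)
    have "emeasure M (ball x (2 ^ Suc k * r)) = emeasure M (ball x (2 * (2 ^ k * r)))"
      by (simp add: mult.assoc)
    also have "\<dots> \<le> ennreal C * emeasure M (ball x (2 ^ k * r))" using that by (intro dC) simp
    also have "\<dots> \<le> ennreal C * (ennreal (C ^ k) * emeasure M (ball x r))"
      by (intro mult_left_mono Suc) simp
    finally show ?case using C by (simp add: ennreal_mult mult.assoc)
  qed simp
  obtain k :: nat where k: "2 * R / (e / 2) < 2 ^ k" using real_arch_pow[of 2] by auto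
  have big: "2 * R \<le> 2 ^ k * (e / 2)" using k e by (simp add: field_simps)
  define m where "m = emeasure M (ball x0 R)"
  have m: "0 < m" "m < \<infinity>"
    using pos[of "R / 2" x0] R doubling_ball_finite[OF dbl] by (auto simp: m_def)
  have low: "m \<le> ennreal (C ^ k) * emeasure M (ball x (e / 2))" if "x \<in> S" for x
  proof -
    have "ball x0 R \<subseteq> ball x (2 ^ k * (e / 2))"
    proof
      fix y assume "y \<in> ball x0 R"
      moreover have "dist x0 x < R" using that S by auto
      ultimately have "dist x y < 2 * R" using dist_triangle[of x y x0] by (simp add: dist_commute)
      then show "y \<in> ball x (2 ^ k * (e / 2))" using big by simp
    qed
    then have "m \<le> emeasure M (ball x (2 ^ k * (e / 2)))"
      unfolding m_def by (intro emeasure_mono) (auto simp: M)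
    also have "\<dots> \<le> ennreal (C ^ k) * emeasure M (ball x (e / 2))" using e by (intro iter) simp
    finally show ?thesis .
  qed
  define K where "K = ennreal (C ^ k) * emeasure M (ball x0 (R + e))"
  have K: "K < \<infinity>" using doubling_ball_finite[OF dbl] by (auto simp: K_def ennreal_mult_less_top)
  have card: "of_nat (card T) * m \<le> K" if T: "finite T" "T \<subseteq> S" for T
  proof -
    have "of_nat (card T) * m = (\<Sum>x\<in>T. m)" by simp
    also have "\<dots> \<le> (\<Sum>x\<in>T. ennreal (C ^ k) * emeasure M (ball x (e / 2)))"
      using T low by (intro sum_mono) auto
    also have "\<dots> = ennreal (C ^ k) * (\<Sum>x\<in>T. emeasure M (ball x (e / 2)))"
      by (simp add: sum_distrib_left)
    also have "(\<Sum>x\<in>T. emeasure M (ball x (e / 2))) = emeasure M (\<Union>x\<in>T. ball x (e / 2))"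
    proof (rule sum_emeasure)
      show "disjoint_family_on (\<lambda>x. ball x (e / 2)) T"
        unfolding disjoint_family_on_def
      proof (intro ballI impI)
        fix x y assume xy: "x \<in> T" "y \<in> T" "x \<noteq> y"
        then have "e \<le> dist x y" using sep T by auto
        then show "ball x (e / 2) \<inter> ball y (e / 2) = {}"
          by (intro disjoint_ballI) simp
      qed
    qed (use T M in auto)
    also have "\<dots> \<le> emeasure M (ball x0 (R + e))"
    proof (rule emeasure_mono)
      show "(\<Union>x\<in>T. ball x (e / 2)) \<subseteq> ball x0 (R + e)"
      proof safe
        fix x y assume "x \<in> T" "y \<in> ball x (e / 2)"
        moreover from this have "dist x0 x < R" using T S by auto
        ultimately show "y \<in> ball x0 (R + e)" using dist_triangle[of x0 y x] e by simp
      qed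
    qed (simp add: M)
    finally show ?thesis by (simp add: K_def mult_left_mono)
  qed
  show ?thesis
  proof (rule ccontr)
    assume "infinite S"
    have "of_nat n * m \<le> K" for n
    proof -
      obtain T where "finite T" "card T = n" "T \<subseteq> S"
        using infinite_arbitrarily_large[OF \<open>infinite S\<close>] by blast
      then show ?thesis using card by blast
    qed
    then have "(SUP n. of_nat n * m) \<le> K" by (intro SUP_least)
    also have "(SUP n. of_nat n * m) = (SUP n. of_nat n) * m"
      by (simp add: SUP_mult_right_ennreal)
    also have "\<dots> = \<infinity>" using m by (simp add: ennreal_SUP_of_nat_eq_top ennreal_top_mult)
    finally show False using K by (simp add: top_unique)
  qed
qed simp

text \<open>A bounded set contains no infinite separated set, so it is totally bounded.\<close>
lemma doubling_proper:
  fixes M :: "'a::metric_space measure" and S :: "'a set"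
  assumes M: "sets M = sets borel" and dbl: "doubling M" and cpl: "complete (UNIV :: 'a set)"
    and S: "closed S" "bounded S"
  shows "compact S"
proof -
  obtain x0 R where R: "S \<subseteq> ball x0 R"
    using S(2) by (metis bounded_subset_ballD)
  have "\<exists>k. finite k \<and> S \<subseteq> (\<Union>x\<in>k. ball x e)" if e: "0 < e" for e
  proof (rule ccontr)
    assume no: "\<not> (\<exists>k. finite k \<and> S \<subseteq> (\<Union>x\<in>k. ball x e))"
    have step: "\<exists>y. y \<in> S \<and> (\<forall>x\<in>T. e \<le> dist x y)" if "finite T" for T
    proof -
      have "\<not> S \<subseteq> (\<Union>x\<in>T. ball x e)" using no that by blast
      then show ?thesis by (auto simp: not_less)
    qed
    \<comment> \<open>a finite separated subset that cannot be extended would be the centres of a finite cover\<close>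
    have "\<exists>f. \<forall>n::nat. f n \<in> S \<and> (\<forall>x\<in>f ` {..<n}. e \<le> dist x (f n))"
    proof (rule dependent_wellorder_choice[where P = "\<lambda>f n y. y \<in> S \<and> (\<forall>x\<in>f ` {..<n}. e \<le> dist x y)"])
      show "\<exists>y. y \<in> S \<and> (\<forall>x\<in>f ` {..<n}. e \<le> dist x y)" for f :: "nat \<Rightarrow> 'a" and n
        using step[of "f ` {..<n}"] by simp
    qed auto
    then obtain f where f: "\<And>n::nat. f n \<in> S" "\<And>m n. m < n \<Longrightarrow> e \<le> dist (f m) (f n)"
      by blast
    have sep: "e \<le> dist (f m) (f n)" if "m \<noteq> n" for m n
      using f(2)[of m n] f(2)[of n m] that by (cases m n rule: linorder_cases) (auto simp: dist_commute)
    have "inj f"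
    proof (rule injI, rule ccontr)
      fix m n assume "f m = f n" "m \<noteq> n"
      then show False using sep[of m n] e by simp
    qed
    then have "infinite (range f)" by (rule range_inj_infinite)
    moreover have "finite (range f)"
    proof (rule doubling_separated_finite[OF M dbl _ e])
      show "range f \<subseteq> ball x0 R" using f(1) R by auto
      fix x y assume "x \<in> range f" "y \<in> range f" "x \<noteq> y"
      then show "e \<le> dist x y" using sep by (metis rangeE)
    qed
    ultimately show False by simp
  qed
  moreover have "complete S" using complete_Int_closed[OF cpl S(1)] by simp
  ultimately show ?thesis by (simp add: compact_eq_totally_bounded)
qed

definition distance_cutoff :: "'a::metric_space set \<Rightarrow> nat \<Rightarrow> 'a \<Rightarrow> real" where
  "distance_cutoff \<Omega> n x = max 0 (min 1 (real n * infdist x (- \<Omega>) - 1))"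

lemma distance_cutoff:
  fixes M :: "'a::metric_space measure" and \<Omega> :: "'a set"
  assumes M: "sets M = sets borel" and dbl: "doubling M" and cpl: "complete (UNIV :: 'a set)"
    and \<Omega>: "open \<Omega>" "bounded \<Omega>" "\<Omega> \<noteq> UNIV"
  shows "lipschitz_cutoff \<Omega> (distance_cutoff \<Omega> n)"
    and "\<And>K. compact K \<Longrightarrow> K \<subseteq> \<Omega> \<Longrightarrow> \<exists>n. \<forall>x\<in>K. distance_cutoff \<Omega> n x = 1"
proof -
  let ?d = "\<lambda>x. infdist x (- \<Omega>)"
  have ne: "- \<Omega> \<noteq> {}" using \<Omega>(3) by auto
  have pos: "?d x \<noteq> 0 \<longleftrightarrow> x \<in> \<Omega>" for x
    using in_closure_iff_infdist_zero[OF ne, of x] \<Omega>(1) by (auto simp: closed_Compl)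
  have "(real n)-lipschitz_on UNIV (distance_cutoff \<Omega> n)"
  proof (rule lipschitz_onI)
    fix x y
    have "\<bar>real n * ?d x - real n * ?d y\<bar> \<le> real n * dist x y"
      using infdist_triangle_abs[of x "- \<Omega>" y]
      by (simp add: right_diff_distrib[symmetric] abs_mult mult_left_mono)
    then show "dist (distance_cutoff \<Omega> n x) (distance_cutoff \<Omega> n y) \<le> real n * dist x y"
      unfolding distance_cutoff_def dist_real_def by linarith
  qed simp
  moreover have sub: "closure {x. distance_cutoff \<Omega> n x \<noteq> 0} \<subseteq> {x. 1 \<le> real n * ?d x}"
  proof (rule closure_minimal)
    show "closed {x. 1 \<le> real n * ?d x}"
      by (intro closed_Collect_le continuous_intros)
  qed (auto simp: distance_cutoff_def)
  have sub\<Omega>: "{x. 1 \<le> real n * ?d x} \<subseteq> \<Omega>"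
    using pos by (metis (no_types, lifting) mem_Collect_eq mult_zero_right not_one_le_zero subsetI)
  have "compact (closure {x. distance_cutoff \<Omega> n x \<noteq> 0})"
    using sub sub\<Omega> bounded_subset[OF \<Omega>(2)] by (intro doubling_proper[OF M dbl cpl]) auto
  ultimately show "lipschitz_cutoff \<Omega> (distance_cutoff \<Omega> n)"
    using sub sub\<Omega> by (auto simp: lipschitz_cutoff_def distance_cutoff_def)
  show "\<exists>n. \<forall>x\<in>K. distance_cutoff \<Omega> n x = 1" if K: "compact K" "K \<subseteq> \<Omega>" for K
  proof (cases "K = {}")
    case False
    have "continuous_on K ?d" by (intro continuous_intros)
    then obtain z where z: "z \<in> K" "\<And>x. x \<in> K \<Longrightarrow> ?d z \<le> ?d x"
      using continuous_attains_inf[OF K(1) False] by blast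
    have dz: "0 < ?d z" using pos[of z] K(2) z(1) infdist_nonneg[of z "- \<Omega>"] by auto
    obtain n where n: "2 / ?d z < real n" using reals_Archimedean2 by blast
    have "distance_cutoff \<Omega> n x = 1" if "x \<in> K" for x
    proof -
      have "2 < real n * ?d z" using n dz by (simp add: field_simps)
      also have "\<dots> \<le> real n * ?d x" using z(2)[OF that] by (intro mult_left_mono) auto
      finally show ?thesis by (simp add: distance_cutoff_def)
    qed
    then show ?thesis by blast
  qed simp
qed

section \<open>Newtonian functions\<close>

lemma Lp_iff:
  assumes "0 < p"
  shows "u \<in> Lp p N \<longleftrightarrow> u \<in> borel_measurable (completion N) \<and> (\<integral>\<^sup>+x. ennreal (\<bar>u x\<bar> powr p) \<partial>N) < \<infinity>"
  by (simp add: Lp_def Lp_norm_def nn_integral_completion)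

lemma newtonian_iff:
  assumes "0 < p"
  shows "u \<in> newtonian p N \<longleftrightarrow> u \<in> borel_measurable (completion N) \<and>
    (\<integral>\<^sup>+x. ennreal (\<bar>u x\<bar> powr p) \<partial>N) < \<infinity> \<and> p_weakly_differentiable p N u"
  unfolding newtonian_def p_weakly_differentiable_def p_integrable_def
  by (auto simp: Lp_iff[OF assms] weak_upper_gradient_def)

lemma powr_add_le:
  fixes a b p :: real
  assumes "0 < p" "0 \<le> a" "0 \<le> b"
  shows "(a + b) powr p \<le> 2 powr p * (a powr p + b powr p)"
proof -
  have "(a + b) powr p \<le> (2 * max a b) powr p"
    using assms by (intro powr_mono2) auto
  also have "\<dots> = 2 powr p * (max a b) powr p" using assms by (simp add: powr_mult)
  also have "\<dots> \<le> 2 powr p * (a powr p + b powr p)"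
    using assms by (intro mult_left_mono) (auto simp: max_def)
  finally show ?thesis .
qed

lemma nn_integral_powr_add_le:
  assumes p: "0 < p" and [measurable]: "u \<in> borel_measurable (completion N)" "v \<in> borel_measurable (completion N)"
  shows "(\<integral>\<^sup>+x. ennreal (\<bar>u x + v x\<bar> powr p) \<partial>N) \<le>
    ennreal (2 powr p) * ((\<integral>\<^sup>+x. ennreal (\<bar>u x\<bar> powr p) \<partial>N) + (\<integral>\<^sup>+x. ennreal (\<bar>v x\<bar> powr p) \<partial>N))"
proof -
  have "\<bar>u x + v x\<bar> powr p \<le> 2 powr p * (\<bar>u x\<bar> powr p + \<bar>v x\<bar> powr p)" for x
  proof -
    have "\<bar>u x + v x\<bar> powr p \<le> (\<bar>u x\<bar> + \<bar>v x\<bar>) powr p" using p by (intro powr_mono2) auto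
    also have "\<dots> \<le> 2 powr p * (\<bar>u x\<bar> powr p + \<bar>v x\<bar> powr p)" using p by (intro powr_add_le) auto
    finally show ?thesis .
  qed
  then have "(\<integral>\<^sup>+x. ennreal (\<bar>u x + v x\<bar> powr p) \<partial>completion N) \<le>
    (\<integral>\<^sup>+x. ennreal (2 powr p) * (ennreal (\<bar>u x\<bar> powr p) + ennreal (\<bar>v x\<bar> powr p)) \<partial>completion N)"
    by (intro nn_integral_mono) (simp add: ennreal_mult[symmetric] ennreal_plus[symmetric] ennreal_leI del: ennreal_plus)
  also have "\<dots> = ennreal (2 powr p) * ((\<integral>\<^sup>+x. ennreal (\<bar>u x\<bar> powr p) \<partial>completion N) + (\<integral>\<^sup>+x. ennreal (\<bar>v x\<bar> powr p) \<partial>completion N))"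
    by (simp add: nn_integral_cmult nn_integral_add)
  finally show ?thesis by (simp add: nn_integral_completion)
qed

lemma nn_integral_powr_cmult:
  assumes "u \<in> borel_measurable (completion N)"
  shows "(\<integral>\<^sup>+x. ennreal (\<bar>c * u x\<bar> powr p) \<partial>N) = ennreal (\<bar>c\<bar> powr p) * (\<integral>\<^sup>+x. ennreal (\<bar>u x\<bar> powr p) \<partial>N)"
proof -
  note [measurable] = assms
  have "(\<integral>\<^sup>+x. ennreal (\<bar>c * u x\<bar> powr p) \<partial>completion N) = ennreal (\<bar>c\<bar> powr p) * (\<integral>\<^sup>+x. ennreal (\<bar>u x\<bar> powr p) \<partial>completion N)"
    by (subst nn_integral_cmult[symmetric]) (auto simp: abs_mult powr_mult ennreal_mult)
  then show ?thesis by (simp add: nn_integral_completion)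
qed

lemma newtonian_linear:
  assumes p: "0 < p" and N: "borel_on N" and u: "u \<in> newtonian p N" and v: "v \<in> newtonian p N"
  shows "(\<lambda>x. a * u x + b * v x) \<in> newtonian p N"
proof -
  have m [measurable]: "u \<in> borel_measurable (completion N)" "v \<in> borel_measurable (completion N)"
    using u v by (simp_all add: newtonian_iff[OF p])
  have "(\<integral>\<^sup>+x. ennreal (\<bar>a * u x + b * v x\<bar> powr p) \<partial>N) \<le>
    ennreal (2 powr p) * ((\<integral>\<^sup>+x. ennreal (\<bar>a * u x\<bar> powr p) \<partial>N) + (\<integral>\<^sup>+x. ennreal (\<bar>b * v x\<bar> powr p) \<partial>N))"
    by (rule nn_integral_powr_add_le[OF p]) measurable
  also have "\<dots> < \<infinity>"
    using u v unfolding nn_integral_powr_cmult[OF m(1)] nn_integral_powr_cmult[OF m(2)] newtonian_iff[OF p]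
    by (auto simp: ennreal_mult_less_top)
  finally have "(\<integral>\<^sup>+x. ennreal (\<bar>a * u x + b * v x\<bar> powr p) \<partial>N) < \<infinity>" .
  moreover obtain h k where hk: "weak_upper_gradient p N u h" "p_integrable p N h"
    "weak_upper_gradient p N v k" "p_integrable p N k"
    using u v by (auto simp: newtonian_iff[OF p] p_weakly_differentiable_def)
  have "p_weakly_differentiable p N (\<lambda>x. a * u x + b * v x)"
    unfolding p_weakly_differentiable_def
    using p weak_upper_gradient_linear[OF p N hk(1,3), of a b]
      p_integrable_add[of p N "\<lambda>x. ennreal \<bar>a\<bar> * h x" "\<lambda>x. ennreal \<bar>b\<bar> * k x"]
      p_integrable_cmult[of p N h "ennreal \<bar>a\<bar>"] p_integrable_cmult[of p N k "ennreal \<bar>b\<bar>"] hk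
    by auto
  ultimately show ?thesis by (simp add: newtonian_iff[OF p])
qed

lemma newtonian_diff:
  assumes "0 < p" "borel_on N" "u \<in> newtonian p N" "v \<in> newtonian p N"
  shows "(\<lambda>x. u x - v x) \<in> newtonian p N"
  using newtonian_linear[OF assms, of 1 "-1"] by simp

lemma newtonian_restrict:
  assumes "0 < p" "sets M = sets borel" "\<Omega> \<in> sets M" "v \<in> newtonian p M" "\<And>x. x \<in> \<Omega> \<Longrightarrow> u x = v x"
  shows "u \<in> newtonian p (restrict_space M \<Omega>)"
proof -
  let ?N = "restrict_space M \<Omega>"
  have \<Omega>: "\<Omega> \<inter> space M \<in> sets M" using assms(3) by simp
  have v: "v \<in> borel_measurable (completion M)" "(\<integral>\<^sup>+x. ennreal (\<bar>v x\<bar> powr p) \<partial>M) < \<infinity>"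
    "p_weakly_differentiable p M v"
    using assms(4) by (simp_all add: newtonian_iff[OF assms(1)])
  have eq: "(\<lambda>x. if x \<in> \<Omega> then u x else 0) = (\<lambda>x. if x \<in> \<Omega> then v x else 0)"
    using assms(5) by auto
  have um: "u \<in> borel_measurable (completion ?N)"
    unfolding completion_restrict_space_measurable_iff[OF assms(3)] eq
    using assms(3) v(1) by (intro measurable_If_set) auto
  have "(\<integral>\<^sup>+x. ennreal (\<bar>u x\<bar> powr p) \<partial>?N) \<le> (\<integral>\<^sup>+x. ennreal (\<bar>v x\<bar> powr p) \<partial>M)"
    unfolding nn_integral_restrict_space[OF \<Omega>] using assms(5)
    by (intro nn_integral_mono) (auto split: split_indicator)
  then have ufin: "(\<integral>\<^sup>+x. ennreal (\<bar>u x\<bar> powr p) \<partial>?N) < \<infinity>" using v(2) by (rule order.strict_trans1)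
  obtain h where h: "weak_upper_gradient p M v h" "p_integrable p M h"
    using v(3) by (auto simp: p_weakly_differentiable_def)
  have "weak_upper_gradient p ?N v h"
    by (rule weak_upper_gradient_restrict[OF assms(1-3) h(1)])
  then obtain \<rho> where \<rho>: "p_integrable p ?N \<rho>" "gradient_off ?N \<rho> v h" "h \<in> borel_measurable ?N"
    using assms(1) borel_on_restrict[OF assms(2)] by (auto simp: weak_upper_gradient_iff)
  have "gradient_off ?N \<rho> u h"
    unfolding gradient_off_def
  proof safe
    fix \<sigma> s t assume arc: "(\<sigma>, s, t) \<in> arcs (space ?N)" "arc_integral \<rho> \<sigma> s t < \<infinity>"
    have "\<sigma> s \<in> \<Omega>" "\<sigma> t \<in> \<Omega>"
      using arcs_in[OF arc(1), of s] arcs_in[OF arc(1), of t] arcs_le[OF arc(1)] by (auto simp: space_restrict_space)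
    then show "ennreal \<bar>u (\<sigma> s) - u (\<sigma> t)\<bar> \<le> arc_integral h \<sigma> s t"
      using gradient_offD[OF \<rho>(2) arc] assms(5) by simp
  qed
  then have "weak_upper_gradient p ?N u h"
    using \<rho> assms(1) borel_on_restrict[OF assms(2)] by (subst weak_upper_gradient_iff) auto
  then have "p_weakly_differentiable p ?N u"
    using p_integrable_restrict[OF assms(3) h(2)] by (auto simp: p_weakly_differentiable_def)
  then show ?thesis using um ufin by (simp add: newtonian_iff[OF assms(1)])
qed

text \<open>The Leibniz rule provides a \<open>p\<close>-integrable weak upper gradient of the product in the whole
  space. It has no contribution from the derivative of \<open>\<eta>\<close> where \<open>\<eta> = 1\<close>, and the minimal one is smaller
  almost everywhere.\<close>
lemma cutoff_newtonian:
  fixes M :: "'a::metric_space measure"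
  assumes p: "0 < p" and M: "sets M = sets borel" and \<Omega>: "open \<Omega>" and \<eta>: "lipschitz_cutoff \<Omega> \<eta>"
    and u: "u \<in> newtonian p (restrict_space M \<Omega>)"
  shows "(\<lambda>x. \<eta> x * u x) \<in> newtonian p M"
    and "AE x in M. \<eta> x = 1 \<longrightarrow>
      min_upper_gradient p M (\<lambda>x. \<eta> x * u x) x \<le> min_upper_gradient p (restrict_space M \<Omega>) u x"
proof -
  let ?N = "restrict_space M \<Omega>" and ?w = "\<lambda>x. \<eta> x * u x"
  have spM: "space M = UNIV" using sets_eq_imp_space_eq[OF M] by simp
  note bM = borel_on_whole[OF M] and bN = borel_on_restrict[OF M, of \<Omega>]
  have \<Omega>M [measurable]: "\<Omega> \<in> sets M" using \<Omega> by (simp add: M)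
  obtain L where L: "L-lipschitz_on UNIV \<eta>" and \<eta>01: "\<And>x. 0 \<le> \<eta> x" "\<And>x. \<eta> x \<le> 1"
    and supp: "closure {x. \<eta> x \<noteq> 0} \<subseteq> \<Omega>"
    using \<eta> by (auto simp: lipschitz_cutoff_def)
  have \<eta>0: "\<eta> x = 0" if "x \<notin> \<Omega>" for x using supp closure_subset[of "{x. \<eta> x \<noteq> 0}"] that by auto
  have [measurable]: "\<eta> \<in> borel_measurable M"
    unfolding measurable_cong_sets[OF M refl]
    by (rule borel_measurable_continuous_onI[OF lipschitz_on_continuous_on[OF L]])
  have um: "u \<in> borel_measurable (completion ?N)" and ufin: "(\<integral>\<^sup>+x. ennreal (\<bar>u x\<bar> powr p) \<partial>?N) < \<infinity>"
    and ud: "p_weakly_differentiable p ?N u"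
    using u by (simp_all add: newtonian_iff[OF p])
  let ?h = "min_upper_gradient p ?N u"
  note h = min_upper_gradient[OF p bN ud]
  obtain \<rho> where \<rho>: "p_integrable p ?N \<rho>" "gradient_off ?N \<rho> u ?h"
    using h(1) p bN by (auto simp: weak_upper_gradient_iff)
  obtain v where vm [measurable]: "v \<in> borel_measurable ?N"
    and v: "\<And>x. x \<in> space ?N \<Longrightarrow> ennreal \<bar>u x\<bar> \<le> v x" "AE x in ?N. v x = ennreal \<bar>u x\<bar>"
    using completion_measurable_borel_majorant[OF um] by blast
  have "(\<integral>\<^sup>+x. ennpowr (v x) p \<partial>?N) = (\<integral>\<^sup>+x. ennreal (\<bar>u x\<bar> powr p) \<partial>?N)"
    using v(2) by (intro nn_integral_cong_AE, eventually_elim) simp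
  then have vint: "p_integrable p ?N v" using ufin by (simp add: p_integrable_def)
  let ?v = "\<lambda>x. v x * indicator \<Omega> x" and ?hO = "\<lambda>x. ?h x * indicator \<Omega> x" and ?r = "\<lambda>x. \<rho> x * indicator \<Omega> x"
  have int: "p_integrable p M ?v" "p_integrable p M ?hO" "p_integrable p M ?r"
    by (intro p_integrable_extend \<Omega>M vint h(2) \<rho>(1))+
  have [measurable]: "?v \<in> borel_measurable M" "?hO \<in> borel_measurable M" "?r \<in> borel_measurable M"
    using int by (simp_all add: p_integrable_def)
  let ?k = "\<lambda>x. ?hO x + ennreal L * ?v x * indicator {x. \<eta> x \<noteq> 1} x"
  have Em [measurable]: "{x. \<eta> x \<noteq> 1} \<in> sets M"
  proof -
    have "{x \<in> space M. \<eta> x \<noteq> 1} \<in> sets M" by measurable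
    then show ?thesis by (simp add: spM)
  qed
  have km [measurable]: "?k \<in> borel_measurable M" by measurable
  have "p_integrable p M (\<lambda>x. ?hO x + ennreal L * ?v x)"
    using p int by (intro p_integrable_add p_integrable_cmult) auto
  then have kint: "p_integrable p M ?k"
    using p km by (rule_tac p_integrable_mono[of p M "\<lambda>x. ?hO x + ennreal L * ?v x" ?k]) (auto split: split_indicator)
  have "gradient_off M (\<lambda>x. ?r x + ?hO x) ?w ?k"
    unfolding gradient_off_def
  proof safe
    fix \<sigma> s t assume arc: "(\<sigma>, s, t) \<in> arcs (space M)" "arc_integral (\<lambda>x. ?r x + ?hO x) \<sigma> s t < \<infinity>"
    have "arc_integral ?r \<sigma> s t < \<infinity>" "arc_integral ?hO \<sigma> s t < \<infinity>"
      by (rule arc_integral_finite_mono[OF arc], simp)+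
    moreover have "ennreal \<bar>u x\<bar> \<le> ?v x" if "x \<in> \<Omega>" for x
      using v(1)[of x] that by (simp add: space_restrict_space spM)
    ultimately show "ennreal \<bar>?w (\<sigma> s) - ?w (\<sigma> t)\<bar> \<le> arc_integral ?k \<sigma> s t"
      using arc(1)
      by (intro cutoff_oscillation[OF M \<Omega> L \<eta>01 supp \<rho>(2)]) (auto simp: spM)
  qed
  moreover have "p_integrable p M (\<lambda>x. ?r x + ?hO x)" using p int by (intro p_integrable_add) auto
  ultimately have kw: "weak_upper_gradient p M ?w ?k"
    using p bM by (subst weak_upper_gradient_iff) auto
  have weq: "?w = (\<lambda>x. \<eta> x * (if x \<in> \<Omega> then u x else 0))" using \<eta>0 by auto
  have "(\<lambda>x. if x \<in> \<Omega> then u x else 0) \<in> borel_measurable (completion M)"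
    using um by (simp add: completion_restrict_space_measurable_iff[OF \<Omega>M])
  moreover have "\<eta> \<in> borel_measurable (completion M)" by (rule measurable_completion) measurable
  ultimately have wm: "?w \<in> borel_measurable (completion M)" unfolding weq by measurable
  have "(\<integral>\<^sup>+x. ennreal (\<bar>?w x\<bar> powr p) \<partial>M) \<le> (\<integral>\<^sup>+x. ennreal (\<bar>u x\<bar> powr p) \<partial>?N)"
  proof -
    have \<Omega>': "\<Omega> \<inter> space M \<in> sets M" by (simp add: \<Omega>M)
    have "ennreal (\<bar>?w x\<bar> powr p) \<le> ennreal (\<bar>u x\<bar> powr p) * indicator \<Omega> x" for x
    proof (cases "x \<in> \<Omega>")
      case True
      have "\<bar>?w x\<bar> \<le> 1 * \<bar>u x\<bar>" unfolding abs_mult using \<eta>01[of x] by (intro mult_right_mono) auto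
      then show ?thesis using True p by (auto intro!: ennreal_leI powr_mono2)
    qed (use \<eta>0 in simp)
    then show ?thesis
      unfolding nn_integral_restrict_space[OF \<Omega>'] by (intro nn_integral_mono)
  qed
  then have "(\<integral>\<^sup>+x. ennreal (\<bar>?w x\<bar> powr p) \<partial>M) < \<infinity>" using ufin by (rule order.strict_trans1)
  then show "?w \<in> newtonian p M"
    using wm kw kint by (auto simp: newtonian_iff[OF p] p_weakly_differentiable_def)
  have "AE x in M. min_upper_gradient p M ?w x \<le> ?k x"
    by (rule min_upper_gradient_le_AE[OF p bM kw kint])
  then show "AE x in M. \<eta> x = 1 \<longrightarrow> min_upper_gradient p M ?w x \<le> ?h x"
    by eventually_elim (auto split: split_indicator_asm)
qed

text \<open>A curve in \<open>\<Omega>\<close> is a compact set, so one of the cutoff functions is one on it, and the inequality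
  for \<open>u\<close> on this curve is the one for the product.\<close>
lemma weak_upper_gradient_from_cutoffs:
  fixes M :: "'a::metric_space measure"
  assumes p: "0 < p" and M: "sets M = sets borel" and \<Omega>: "\<Omega> \<in> sets M"
    and \<eta>: "\<And>K. compact K \<Longrightarrow> K \<subseteq> \<Omega> \<Longrightarrow> \<exists>n::nat. \<forall>x\<in>K. \<eta> n x = 1"
    and q: "\<And>n. weak_upper_gradient p M (\<lambda>x. \<eta> n x * u x) (q n)"
    and km: "k \<in> borel_measurable (restrict_space M \<Omega>)"
    and le: "\<And>n. AE x in M. \<eta> n x = 1 \<longrightarrow> x \<in> \<Omega> \<longrightarrow> q n x \<le> k x"
  shows "weak_upper_gradient p (restrict_space M \<Omega>) u k"
proof -
  let ?N = "restrict_space M \<Omega>"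
  have spM: "space M = UNIV" using sets_eq_imp_space_eq[OF M] by simp
  note bM = borel_on_whole[OF M] and bN = borel_on_restrict[OF M, of \<Omega>]
  have "\<forall>n. \<exists>\<rho>. p_integrable p M \<rho> \<and> gradient_off M \<rho> (\<lambda>x. \<eta> n x * u x) (q n)"
    using q p bM by (auto simp: weak_upper_gradient_iff)
  then obtain \<rho> where \<rho>: "\<And>n. p_integrable p M (\<rho> n)" "\<And>n. gradient_off M (\<rho> n) (\<lambda>x. \<eta> n x * u x) (q n)"
    by metis
  obtain \<rho>' where \<rho>': "p_integrable p M \<rho>'" "\<forall>n \<sigma> s t. (\<sigma>, s, t) \<in> arcs (space M) \<longrightarrow>
      arc_integral \<rho>' \<sigma> s t < \<infinity> \<longrightarrow> arc_integral (\<rho> n) \<sigma> s t < \<infinity>"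
    by (rule common_exceptional_function[OF p bM \<rho>(1)])
  have "AE x in M. \<forall>n. \<eta> n x = 1 \<longrightarrow> x \<in> \<Omega> \<longrightarrow> q n x \<le> k x"
    using le by (simp add: AE_all_countable)
  from AE_E[OF this] obtain Z where Z: "{x \<in> space M. \<not> (\<forall>n. \<eta> n x = 1 \<longrightarrow> x \<in> \<Omega> \<longrightarrow> q n x \<le> k x)} \<subseteq> Z"
    "emeasure M Z = 0" "Z \<in> sets M" by blast
  have Z0: "Z \<in> null_sets M" using Z by auto
  let ?r = "\<lambda>x. \<rho>' x + \<infinity> * indicator Z x"
  have rint: "p_integrable p M ?r"
    using p \<rho>'(1) null_set_exceptional(1)[OF p bM Z0] by (intro p_integrable_add) auto
  have "gradient_off ?N ?r u k"
    unfolding gradient_off_def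
  proof safe
    fix \<sigma> s t assume arcN: "(\<sigma>, s, t) \<in> arcs (space ?N)" and fin: "arc_integral ?r \<sigma> s t < \<infinity>"
    have arc: "(\<sigma>, s, t) \<in> arcs (space M)" using arcN arcs_mono[of "space ?N" "space M"] by (auto simp: spM)
    have in\<Omega>: "\<sigma> ` {s..t} \<subseteq> \<Omega>" using arcs_in[OF arcN] by (auto simp: space_restrict_space)
    have "compact (\<sigma> ` {s..t})" by (intro compact_continuous_image arcs_continuous[OF arc]) simp
    then obtain n where n: "\<And>r. r \<in> {s..t} \<Longrightarrow> \<eta> n (\<sigma> r) = 1" using \<eta> in\<Omega> by fastforce
    have "arc_integral \<rho>' \<sigma> s t < \<infinity>" by (rule arc_integral_finite_mono[OF arc fin]) simp
    then have "arc_integral (\<rho> n) \<sigma> s t < \<infinity>" using \<rho>'(2) arc by blast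
    then have "ennreal \<bar>\<eta> n (\<sigma> s) * u (\<sigma> s) - \<eta> n (\<sigma> t) * u (\<sigma> t)\<bar> \<le> arc_integral (q n) \<sigma> s t"
      by (rule gradient_offD[OF \<rho>(2) arc])
    then have "ennreal \<bar>u (\<sigma> s) - u (\<sigma> t)\<bar> \<le> arc_integral (q n) \<sigma> s t"
      using n[of s] n[of t] arcs_le[OF arc] by simp
    also have "\<dots> \<le> arc_integral k \<sigma> s t"
    proof (rule nn_integral_mono_AE)
      have "AE r in lborel. r \<in> {s..t} \<longrightarrow> \<sigma> r \<notin> Z"
        by (intro null_set_exceptional(2)[OF p bM Z0 arc] arc_integral_finite_mono[OF arc fin]) simp
      then show "AE r in lborel. q n (\<sigma> r) * indicator {s..t} r \<le> k (\<sigma> r) * indicator {s..t} r"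
      proof eventually_elim
        case (elim r)
        show ?case
        proof (cases "r \<in> {s..t}")
          case True
          then have "\<sigma> r \<notin> Z" "\<eta> n (\<sigma> r) = 1" "\<sigma> r \<in> \<Omega>" using elim n in\<Omega> by auto
          then have "q n (\<sigma> r) \<le> k (\<sigma> r)" using Z(1) by (auto simp: spM)
          then show ?thesis by (simp add: mult_right_mono)
        qed simp
      qed
    qed
    finally show "ennreal \<bar>u (\<sigma> s) - u (\<sigma> t)\<bar> \<le> arc_integral k \<sigma> s t" .
  qed
  then show ?thesis
    using km p_integrable_restrict[OF \<Omega> rint] p bN by (subst weak_upper_gradient_iff) auto
qed

section \<open>Inner products on the fibres\<close>

text \<open>The norm \<^const>\<open>fibre_norm\<close> at a single point, so that the inner product can be treated on its own.\<close>
definition ip_norm :: "(real^'n \<Rightarrow> real^'n \<Rightarrow> real) \<Rightarrow> real^'n \<Rightarrow> real" where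
  "ip_norm b v = sqrt (b v v)"

lemma fibre_norm_eq: "fibre_norm ip x v = ip_norm (ip x) v"
  by (simp add: fibre_norm_def ip_norm_def)

lemma inner_productD:
  assumes "is_inner_product b"
  shows "b (u + v) w = b u w + b v w" "b w (u + v) = b w u + b w v"
    "b (c *\<^sub>R v) w = c * b v w" "b w (c *\<^sub>R v) = c * b w v"
    "b (u - v) w = b u w - b v w" "b w (u - v) = b w u - b w v"
    "b 0 w = 0" "b w 0 = 0" "b v w = b w v" "v \<noteq> 0 \<Longrightarrow> 0 < b v v" "0 \<le> b v v"
proof -
  have b: "bilinear b" and sym: "\<And>v w. b v w = b w v" and pos: "\<And>v. v \<noteq> 0 \<Longrightarrow> 0 < b v v"
    using assms unfolding is_inner_product_def by blast+
  show "b (u + v) w = b u w + b v w" "b w (u + v) = b w u + b w v"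
    "b (c *\<^sub>R v) w = c * b v w" "b w (c *\<^sub>R v) = c * b w v"
    "b (u - v) w = b u w - b v w" "b w (u - v) = b w u - b w v"
    "b 0 w = 0" "b w 0 = 0"
    using b by (simp_all add: bilinear_ladd bilinear_radd bilinear_lmul bilinear_rmul
        bilinear_lsub bilinear_rsub bilinear_lzero bilinear_rzero)
  have "b 0 0 = 0" using b by (rule bilinear_lzero)
  then show "0 \<le> b v v" using pos[of v] by (cases "v = 0") auto
  show "b v w = b w v" by (rule sym)
  show "v \<noteq> 0 \<Longrightarrow> 0 < b v v" by (rule pos)
qed

lemma inner_product_Cauchy_Schwarz:
  assumes b: "is_inner_product b"
  shows "\<bar>b v w\<bar> \<le> ip_norm b v * ip_norm b w"
proof (cases "w = 0")
  case False
  note D = inner_productD[OF b]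
  have w: "0 < b w w" using D(10) False .
  let ?t = "b v w / b w w"
  have "0 \<le> b (v - ?t *\<^sub>R w) (v - ?t *\<^sub>R w)" by (rule D(11))
  also have "\<dots> = b v v - 2 * ?t * b v w + ?t * ?t * b w w"
    using D(9)[of w v] by (simp add: D algebra_simps)
  also have "\<dots> = b v v - (b v w)\<^sup>2 / b w w"
    using w by (simp add: field_simps power2_eq_square)
  finally have "(b v w)\<^sup>2 \<le> b v v * b w w" using w by (simp add: field_simps)
  then have "sqrt ((b v w)\<^sup>2) \<le> sqrt (b v v * b w w)" by (rule real_sqrt_le_mono)
  then show ?thesis by (simp add: ip_norm_def real_sqrt_mult)
qed (simp add: inner_productD[OF b] ip_norm_def)

lemma ip_norm_properties:
  assumes b: "is_inner_product b"
  shows "0 \<le> ip_norm b v" "ip_norm b v ^ 2 = b v v" "ip_norm b v = 0 \<longleftrightarrow> v = 0"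
    "ip_norm b (u + v) \<le> ip_norm b u + ip_norm b v" "ip_norm b (u - v) \<le> ip_norm b u + ip_norm b v"
proof -
  note D = inner_productD[OF b]
  show nn: "0 \<le> ip_norm b v" for v using D(11)[of v] by (simp add: ip_norm_def)
  show sq: "ip_norm b v ^ 2 = b v v" for v using D(11)[of v] by (simp add: ip_norm_def)
  show "ip_norm b v = 0 \<longleftrightarrow> v = 0" using D(10)[of v] D(7)[of 0] by (cases "v = 0") (auto simp: ip_norm_def)
  have cs: "\<bar>b u v\<bar> \<le> ip_norm b u * ip_norm b v" by (rule inner_product_Cauchy_Schwarz[OF b])
  have "ip_norm b (u + v) ^ 2 = b u u + 2 * b u v + b v v"
    unfolding sq using D(9)[of v u] by (simp add: D)
  also have "\<dots> \<le> (ip_norm b u + ip_norm b v) ^ 2"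
    using cs by (simp add: power2_sum sq)
  finally show "ip_norm b (u + v) \<le> ip_norm b u + ip_norm b v"
    by (rule power2_le_imp_le) (use nn in \<open>simp add: add_nonneg_nonneg\<close>)
  have "ip_norm b (u - v) ^ 2 = b u u - 2 * b u v + b v v"
    unfolding sq using D(9)[of v u] by (simp add: D)
  also have "\<dots> \<le> (ip_norm b u + ip_norm b v) ^ 2"
    using cs by (simp add: power2_sum sq)
  finally show "ip_norm b (u - v) \<le> ip_norm b u + ip_norm b v"
    by (rule power2_le_imp_le) (use nn in \<open>simp add: add_nonneg_nonneg\<close>)
qed

section \<open>The Cheeger gradient in the domain\<close>

text \<open>The standing assumptions on the space and the domain, with a Cheeger structure given by its
  inner products and its gradient operator.\<close>
locale cheeger_domain =
  fixes p :: real and M :: "'a::metric_space measure" and \<Omega> :: "'a set"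
    and ip :: "'a \<Rightarrow> real^'n::finite \<Rightarrow> real^'n \<Rightarrow> real"
    and G :: "('a \<Rightarrow> real) \<Rightarrow> 'a \<Rightarrow> real^'n"
  assumes p_gt_1: "1 < p" and complete_space: "complete (UNIV :: 'a set)" and sets_M: "sets M = sets borel"
    and doubling_M: "doubling M" and poincare: "poincare_inequality p M"
    and bounded_\<Omega>: "bounded \<Omega>" and open_\<Omega>: "open \<Omega>" and outside: "emeasure M (UNIV - \<Omega>) > 0"
    and ip_AE: "AE x in M. is_inner_product (ip x)"
    and ip_measurable: "\<And>v w. (\<lambda>x. ip x v w) \<in> borel_measurable (completion M)"
    and G_measurable: "\<And>u. u \<in> newtonian p M \<Longrightarrow> G u \<in> borel_measurable (completion M)"
    and G_linear: "\<And>u v a b. u \<in> newtonian p M \<Longrightarrow> v \<in> newtonian p M \<Longrightarrow>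
      AE x in M. G (\<lambda>y. a * u y + b * v y) x = a *\<^sub>R G u x + b *\<^sub>R G v x"
    and G_bounds: "\<And>u. u \<in> newtonian p M \<Longrightarrow> AE x in M.
      ennreal (fibre_norm ip x (G u x)) \<le> min_upper_gradient p M u x \<and>
      min_upper_gradient p M u x \<le> ennreal (sqrt (real CARD('n)) * fibre_norm ip x (G u x))"
begin

abbreviation "N \<equiv> restrict_space M \<Omega>"
abbreviation "gradient \<equiv> cheeger_gradient_on M \<Omega> G"
abbreviation "cutoff \<equiv> distance_cutoff \<Omega>"

lemma p_pos: "0 < p"
  using p_gt_1 by simp

lemma \<Omega>_in_M: "\<Omega> \<in> sets M"
  using open_\<Omega> by (simp add: sets_M)

lemma \<Omega>_space_in_M: "\<Omega> \<inter> space M \<in> sets M"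
  using \<Omega>_in_M by simp

lemmas borel_on_M = borel_on_whole[OF sets_M]
lemmas borel_on_N = borel_on_restrict[OF sets_M, of \<Omega>]

lemma AE_N_iff: "(AE x in N. P x) \<longleftrightarrow> (AE x in M. x \<in> \<Omega> \<longrightarrow> P x)"
  by (rule AE_restrict_space_iff[OF \<Omega>_space_in_M])

lemma AE_N: "AE x in M. P x \<Longrightarrow> AE x in N. P x"
  unfolding AE_N_iff by (auto elim: eventually_mono)

lemma ip_AE_N: "AE x in N. is_inner_product (ip x)"
  using ip_AE by (rule AE_N)

lemma \<Omega>_not_UNIV: "\<Omega> \<noteq> UNIV"
  using outside by auto

lemma cutoff_lipschitz: "lipschitz_cutoff \<Omega> (cutoff n)"
  by (rule distance_cutoff(1)[OF sets_M doubling_M complete_space open_\<Omega> bounded_\<Omega> \<Omega>_not_UNIV])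

lemma cutoff_exhausts: "compact K \<Longrightarrow> K \<subseteq> \<Omega> \<Longrightarrow> \<exists>n. \<forall>x\<in>K. cutoff n x = 1"
  by (rule distance_cutoff(2)[OF sets_M doubling_M complete_space open_\<Omega> bounded_\<Omega> \<Omega>_not_UNIV])

lemma cutoff_exhausts_point: "x \<in> \<Omega> \<Longrightarrow> \<exists>n. cutoff n x = 1"
  using cutoff_exhausts[of "{x}"] by auto

lemma lipschitz_cutoff_outside: "lipschitz_cutoff \<Omega> \<eta> \<Longrightarrow> x \<notin> \<Omega> \<Longrightarrow> \<eta> x = 0"
  using closure_subset[of "{x. \<eta> x \<noteq> 0}"] unfolding lipschitz_cutoff_def by blast

lemma AE_from_cutoffs:
  assumes "\<And>n. AE x in M. cutoff n x = 1 \<longrightarrow> P x"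
  shows "AE x in N. P x"
proof -
  have "AE x in M. \<forall>n. cutoff n x = 1 \<longrightarrow> P x"
    using assms unfolding AE_all_countable by blast
  then show ?thesis
    unfolding AE_N_iff using cutoff_exhausts_point by (auto elim!: eventually_mono)
qed

text \<open>The measurability of \<open>x \<mapsto> ip x v w\<close> is given for fixed vectors, so the fields are expanded in the
  standard basis.\<close>
lemma ip_field_measurable_M:
  assumes f: "f \<in> borel_measurable (completion M)" and g: "g \<in> borel_measurable (completion M)"
  shows "(\<lambda>x. ip x (f x) (g x)) \<in> borel_measurable (completion M)"
proof (rule borel_measurable_completion_cong_AE)
  have comp: "(\<lambda>x. f x $ i) \<in> borel_measurable (completion M)" if "f \<in> borel_measurable (completion M)" for f i
    using that by (rule measurable_compose) (intro borel_measurable_continuous_onI continuous_intros)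
  show "(\<lambda>x. \<Sum>i\<in>UNIV. \<Sum>j\<in>UNIV. f x $ i * (g x $ j * ip x (axis i 1) (axis j 1))) \<in> borel_measurable (completion M)"
    by (intro borel_measurable_sum borel_measurable_times comp f g ip_measurable)
  show "AE x in M. (\<Sum>i\<in>UNIV. \<Sum>j\<in>UNIV. f x $ i * (g x $ j * ip x (axis i 1) (axis j 1))) = ip x (f x) (g x)"
    using ip_AE
  proof eventually_elim
    case (elim x)
    then have b: "bilinear (ip x)" by (simp add: is_inner_product_def)
    note D = inner_productD[OF elim]
    have e: "(\<Sum>i\<in>UNIV. (v $ i) *\<^sub>R axis i 1) = v" for v :: "real^'n"
      using basis_expansion[of v] by (simp add: scalar_mult_eq_scaleR)
    have "ip x (f x) (g x) = ip x (\<Sum>i\<in>UNIV. (f x $ i) *\<^sub>R axis i 1) (\<Sum>j\<in>UNIV. (g x $ j) *\<^sub>R axis j 1)"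
      by (simp only: e)
    also have "\<dots> = (\<Sum>(i, j)\<in>UNIV \<times> UNIV. ip x ((f x $ i) *\<^sub>R axis i 1) ((g x $ j) *\<^sub>R axis j 1))"
      by (rule bilinear_sum[OF b])
    also have "\<dots> = (\<Sum>i\<in>UNIV. \<Sum>j\<in>UNIV. f x $ i * (g x $ j * ip x (axis i 1) (axis j 1)))"
      by (simp add: sum.cartesian_product D mult.left_commute)
    finally show ?case by simp
  qed
qed

lemma ip_field_measurable [measurable (raw)]:
  assumes f: "f \<in> borel_measurable (completion N)" and g: "g \<in> borel_measurable (completion N)"
  shows "(\<lambda>x. ip x (f x) (g x)) \<in> borel_measurable (completion N)"
proof -
  let ?f = "\<lambda>x. if x \<in> \<Omega> then f x else 0" and ?g = "\<lambda>x. if x \<in> \<Omega> then g x else 0"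
  have "?f \<in> borel_measurable (completion M)" "?g \<in> borel_measurable (completion M)"
    using f g by (simp_all add: completion_restrict_space_measurable_iff[OF \<Omega>_in_M])
  then have "(\<lambda>x. ip x (?f x) (?g x)) \<in> borel_measurable (completion M)" by (rule ip_field_measurable_M)
  then have "(\<lambda>x. if x \<in> \<Omega> then ip x (?f x) (?g x) else 0) \<in> borel_measurable (completion M)"
    using \<Omega>_in_M by (intro measurable_If_set) auto
  moreover have "(\<lambda>x. if x \<in> \<Omega> then ip x (?f x) (?g x) else 0) = (\<lambda>x. if x \<in> \<Omega> then ip x (f x) (g x) else 0)"
    by auto
  ultimately show ?thesis by (simp add: completion_restrict_space_measurable_iff[OF \<Omega>_in_M])
qed

lemma fibre_norm_field_measurable [measurable (raw)]:
  "f \<in> borel_measurable (completion N) \<Longrightarrow> (\<lambda>x. fibre_norm ip x (f x)) \<in> borel_measurable (completion N)"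
  unfolding fibre_norm_def by measurable

text \<open>Applied to the difference of two functions, the vanishing of the minimal weak upper gradient on
  the zero set shows that the gradient is local.\<close>
lemma G_local:
  assumes "v \<in> newtonian p M" "w \<in> newtonian p M"
  shows "AE x in M. v x = w x \<longrightarrow> G v x = G w x"
proof -
  let ?d = "\<lambda>y. 1 * v y + (-1) * w y"
  have d: "?d \<in> newtonian p M" by (rule newtonian_linear[OF p_pos borel_on_M assms])
  have "AE x in M. ?d x = 0 \<longrightarrow> min_upper_gradient p M ?d x = 0"
    using d by (intro min_upper_gradient_zero_set p_pos borel_on_M) (simp_all add: newtonian_iff[OF p_pos])
  with G_bounds[OF d] G_linear[OF assms, of 1 "-1"] ip_AE show ?thesis
  proof eventually_elim
    case (elim x)
    show ?case
    proof
      assume "v x = w x"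
      then have "min_upper_gradient p M ?d x = 0" using elim(4) by simp
      then have "ennreal (fibre_norm ip x (G ?d x)) = 0" using elim(1) by simp
      then have "fibre_norm ip x (G ?d x) = 0"
        using ip_norm_properties(1)[OF elim(3), of "G ?d x"] by (simp add: fibre_norm_eq ennreal_eq_0_iff)
      then have "G ?d x = 0" using ip_norm_properties(3)[OF elim(3)] by (simp add: fibre_norm_eq)
      then show "G v x = G w x" using elim(2) by simp
    qed
  qed
qed

text \<open>By locality the gradients of the products with the cutoff functions fit together, so that the
  choice in the definition of the gradient in \<open>\<Omega>\<close> is from a nonempty set.\<close>
lemma gradient_spec:
  assumes u: "u \<in> newtonian p N"
  shows "gradient u \<in> borel_measurable (completion N)"
    and "\<And>\<eta>. lipschitz_cutoff \<Omega> \<eta> \<Longrightarrow> AE x in M. \<eta> x = 1 \<longrightarrow> gradient u x = G (\<lambda>y. \<eta> y * u y) x"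
proof -
  let ?w = "\<lambda>\<eta> y. \<eta> y * u y"
  have w: "?w \<eta> \<in> newtonian p M" if "lipschitz_cutoff \<Omega> \<eta>" for \<eta>
    by (rule cutoff_newtonian(1)[OF p_pos sets_M open_\<Omega> that u])
  define first where "first x = (LEAST n. cutoff n x = 1)" for x
  define H where "H x = G (?w (cutoff (first x))) x" for x
  have cm: "cutoff n \<in> borel_measurable (completion M)" for n
  proof (rule measurable_completion)
    obtain L where "L-lipschitz_on UNIV (cutoff n)" using cutoff_lipschitz[of n] by (auto simp: lipschitz_cutoff_def)
    then show "cutoff n \<in> borel_measurable M"
      unfolding measurable_cong_sets[OF sets_M refl]
      by (intro borel_measurable_continuous_onI lipschitz_on_continuous_on)
  qed
  have "first \<in> completion M \<rightarrow>\<^sub>M count_space UNIV"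
    unfolding first_def
  proof (rule measurable_Least)
    fix n
    note [measurable] = cm
    show "Measurable.pred (completion M) (\<lambda>x. cutoff n x = 1)" by measurable
  qed
  then have "H \<in> borel_measurable (completion M)"
    unfolding H_def
    by (rule measurable_compose_countable[where f = "\<lambda>n. G (?w (cutoff n))", OF G_measurable[OF w[OF cutoff_lipschitz]]])
  then have "(\<lambda>x. if x \<in> \<Omega> then H x else 0) \<in> borel_measurable (completion M)"
    using \<Omega>_in_M by (intro measurable_If_set) auto
  then have Hm: "H \<in> borel_measurable (completion N)"
    by (simp add: completion_restrict_space_measurable_iff[OF \<Omega>_in_M])
  have "AE x in M. \<eta> x = 1 \<longrightarrow> H x = G (?w \<eta>) x" if \<eta>: "lipschitz_cutoff \<Omega> \<eta>" for \<eta>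
  proof -
    have "AE x in M. \<forall>n. ?w (cutoff n) x = ?w \<eta> x \<longrightarrow> G (?w (cutoff n)) x = G (?w \<eta>) x"
      by (simp only: AE_all_countable) (intro allI G_local w cutoff_lipschitz \<eta>)
    then show ?thesis
    proof eventually_elim
      case (elim x)
      show ?case
      proof
        assume 1: "\<eta> x = 1"
        then have "x \<in> \<Omega>" using lipschitz_cutoff_outside[OF \<eta>, of x] by auto
        then have "cutoff (first x) x = 1"
          unfolding first_def using cutoff_exhausts_point by (metis (mono_tags, lifting) LeastI)
        then show "H x = G (?w \<eta>) x" using elim 1 unfolding H_def by simp
      qed
    qed
  qed
  then have "\<exists>H. H \<in> borel_measurable (completion N) \<and>
     (\<forall>\<eta>. lipschitz_cutoff \<Omega> \<eta> \<longrightarrow> (AE x in M. \<eta> x = 1 \<longrightarrow> H x = G (?w \<eta>) x))"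
    using Hm by blast
  from someI_ex[OF this, folded cheeger_gradient_on_def]
  show "gradient u \<in> borel_measurable (completion N)"
    and "\<And>\<eta>. lipschitz_cutoff \<Omega> \<eta> \<Longrightarrow> AE x in M. \<eta> x = 1 \<longrightarrow> gradient u x = G (\<lambda>y. \<eta> y * u y) x"
    by blast+
qed

lemma gradient_linear:
  assumes u: "u \<in> newtonian p N" and v: "v \<in> newtonian p N"
  shows "AE x in N. gradient (\<lambda>y. a * u y + b * v y) x = a *\<^sub>R gradient u x + b *\<^sub>R gradient v x"
proof (rule AE_from_cutoffs)
  fix n
  have uv: "(\<lambda>y. a * u y + b * v y) \<in> newtonian p N"
    by (rule newtonian_linear[OF p_pos borel_on_N u v])
  have eq: "(\<lambda>y. cutoff n y * (a * u y + b * v y)) = (\<lambda>y. a * (cutoff n y * u y) + b * (cutoff n y * v y))"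
    by (simp add: algebra_simps)
  have "AE x in M. G (\<lambda>y. a * (cutoff n y * u y) + b * (cutoff n y * v y)) x =
      a *\<^sub>R G (\<lambda>y. cutoff n y * u y) x + b *\<^sub>R G (\<lambda>y. cutoff n y * v y) x"
    by (intro G_linear cutoff_newtonian(1)[OF p_pos sets_M open_\<Omega> cutoff_lipschitz] u v)
  with gradient_spec(2)[OF u cutoff_lipschitz[of n]] gradient_spec(2)[OF v cutoff_lipschitz[of n]]
    gradient_spec(2)[OF uv cutoff_lipschitz[of n]]
  show "AE x in M. cutoff n x = 1 \<longrightarrow>
      gradient (\<lambda>y. a * u y + b * v y) x = a *\<^sub>R gradient u x + b *\<^sub>R gradient v x"
    unfolding eq by eventually_elim simp
qed

lemma gradient_diff:
  assumes "u \<in> newtonian p N" "v \<in> newtonian p N"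
  shows "AE x in N. gradient (\<lambda>y. u y - v y) x = gradient u x - gradient v x"
  using gradient_linear[OF assms, of 1 "-1"] by simp

text \<open>The two comparisons in \<open>\<Omega>\<close> come from those for the products with cutoff functions. For the first
  one, the minimal weak upper gradient does not increase where the cutoff is one.\<close>
lemma gradient_le:
  assumes u: "u \<in> newtonian p N"
  shows "AE x in N. ennreal (fibre_norm ip x (gradient u x)) \<le> min_upper_gradient p N u x"
proof (rule AE_from_cutoffs)
  fix n
  have w: "(\<lambda>y. cutoff n y * u y) \<in> newtonian p M"
    by (rule cutoff_newtonian(1)[OF p_pos sets_M open_\<Omega> cutoff_lipschitz u])
  from gradient_spec(2)[OF u cutoff_lipschitz[of n]] G_bounds[OF w]
    cutoff_newtonian(2)[OF p_pos sets_M open_\<Omega> cutoff_lipschitz[of n] u]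
  show "AE x in M. cutoff n x = 1 \<longrightarrow>
      ennreal (fibre_norm ip x (gradient u x)) \<le> min_upper_gradient p N u x"
  proof eventually_elim
    case (elim x)
    show ?case
    proof
      assume 1: "cutoff n x = 1"
      have "ennreal (fibre_norm ip x (gradient u x)) = ennreal (fibre_norm ip x (G (\<lambda>y. cutoff n y * u y) x))"
        using elim(1) 1 by simp
      also have "\<dots> \<le> min_upper_gradient p M (\<lambda>y. cutoff n y * u y) x" using elim(2) by blast
      also have "\<dots> \<le> min_upper_gradient p N u x" using elim(3) 1 by blast
      finally show "ennreal (fibre_norm ip x (gradient u x)) \<le> min_upper_gradient p N u x" .
    qed
  qed
qed

text \<open>The right-hand side dominates the minimal weak upper gradients of all the products, so a Borel
  representative of it is a weak upper gradient in \<open>\<Omega>\<close>.\<close>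
lemma gradient_ge:
  assumes u: "u \<in> newtonian p N"
  shows "AE x in N. min_upper_gradient p N u x \<le>
    ennreal (sqrt (real CARD('n)) * fibre_norm ip x (gradient u x))"
proof -
  let ?F = "\<lambda>x. ennreal (sqrt (real CARD('n)) * fibre_norm ip x (gradient u x))"
  have [measurable]: "gradient u \<in> borel_measurable (completion N)" by (rule gradient_spec(1)[OF u])
  have "?F \<in> borel_measurable (completion N)" by measurable
  then obtain k where km: "k \<in> borel_measurable N" and kF: "AE x in N. ?F x = k x"
    using completion_ex_borel_measurable by blast
  have w: "(\<lambda>y. cutoff n y * u y) \<in> newtonian p M" for n
    by (rule cutoff_newtonian(1)[OF p_pos sets_M open_\<Omega> cutoff_lipschitz u])
  have kw: "weak_upper_gradient p N u k"
  proof (rule weak_upper_gradient_from_cutoffs[OF p_pos sets_M \<Omega>_in_M cutoff_exhausts _ km])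
    fix n
    show "weak_upper_gradient p M (\<lambda>x. cutoff n x * u x) (min_upper_gradient p M (\<lambda>x. cutoff n x * u x))"
      using w[of n] by (intro min_upper_gradient p_pos borel_on_M) (simp add: newtonian_iff[OF p_pos])
    have "AE x in M. x \<in> \<Omega> \<longrightarrow> ?F x = k x" using kF by (simp add: AE_N_iff)
    with gradient_spec(2)[OF u cutoff_lipschitz[of n]] G_bounds[OF w[of n]]
    show "AE x in M. cutoff n x = 1 \<longrightarrow> x \<in> \<Omega> \<longrightarrow> min_upper_gradient p M (\<lambda>x. cutoff n x * u x) x \<le> k x"
    proof eventually_elim
      case (elim x)
      show ?case
      proof (intro impI)
        assume 1: "cutoff n x = 1" "x \<in> \<Omega>"
        have "min_upper_gradient p M (\<lambda>x. cutoff n x * u x) x \<le>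
            ennreal (sqrt (real CARD('n)) * fibre_norm ip x (G (\<lambda>y. cutoff n y * u y) x))"
          using elim(2) by blast
        also have "\<dots> = k x" using elim(1,3) 1 by simp
        finally show "min_upper_gradient p M (\<lambda>x. cutoff n x * u x) x \<le> k x" .
      qed
    qed
  qed
  have d: "p_weakly_differentiable p N u" using u by (simp add: newtonian_iff[OF p_pos])
  have "p_integrable p N k"
  proof (rule p_integrable_mono[OF less_imp_le[OF p_pos] _ km])
    show "p_integrable p N (\<lambda>x. ennreal (sqrt (real CARD('n))) * min_upper_gradient p N u x)"
      using min_upper_gradient(2)[OF p_pos borel_on_N d] p_pos by (intro p_integrable_cmult) auto
    from gradient_le[OF u] kF
    show "AE x in N. k x \<le> ennreal (sqrt (real CARD('n))) * min_upper_gradient p N u x"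
    proof eventually_elim
      case (elim x)
      then show ?case by (simp add: ennreal_mult' elim(2)[symmetric] mult_left_mono)
    qed
  qed
  from min_upper_gradient_le_AE[OF p_pos borel_on_N kw this] kF show ?thesis
    by eventually_elim simp
qed

lemma newtonian0_newtonian:
  assumes "\<phi> \<in> newtonian0 p M \<Omega>"
  shows "\<phi> \<in> newtonian p N"
  using assms newtonian_restrict[OF p_pos sets_M \<Omega>_in_M] by (auto simp: newtonian0_def)

text \<open>Where a cutoff function is one, both sides are the gradient of the product with it: the left-hand
  side by definition and the right-hand side by locality.\<close>
lemma gradient_zero_extension:
  assumes v: "v \<in> newtonian p M" "\<And>x. x \<notin> \<Omega> \<Longrightarrow> v x = 0" and \<phi>: "\<And>x. x \<in> \<Omega> \<Longrightarrow> \<phi> x = v x"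
  shows "AE x in N. gradient \<phi> x = G v x"
proof (rule AE_from_cutoffs)
  fix n
  have \<phi>N: "\<phi> \<in> newtonian p N" by (rule newtonian_restrict[OF p_pos sets_M \<Omega>_in_M v(1) \<phi>])
  have eq: "(\<lambda>y. cutoff n y * \<phi> y) = (\<lambda>y. cutoff n y * v y)"
    using \<phi> lipschitz_cutoff_outside[OF cutoff_lipschitz] by (metis mult_eq_0_iff)
  have "(\<lambda>y. cutoff n y * v y) \<in> newtonian p M"
    using cutoff_newtonian(1)[OF p_pos sets_M open_\<Omega> cutoff_lipschitz \<phi>N, of n] by (simp only: eq)
  from G_local[OF this v(1)] gradient_spec(2)[OF \<phi>N cutoff_lipschitz[of n]]
  show "AE x in M. cutoff n x = 1 \<longrightarrow> gradient \<phi> x = G v x"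
    unfolding eq by eventually_elim simp
qed

end

section \<open>Pointwise inequalities\<close>

text \<open>Either \<open>t\<close> is at most \<open>\<delta>s\<close>, or \<open>s\<close> can be replaced by the larger \<open>t / \<delta>\<close>.\<close>
lemma Young_powr_le:
  fixes p \<delta> s t :: real
  assumes p: "1 < p" and \<delta>: "0 < \<delta>" and st: "0 \<le> s" "0 \<le> t"
  shows "s powr (p - 1) * t \<le> \<delta> * s powr p + \<delta> powr (1 - p) * t powr p"
proof (cases "t \<le> \<delta> * s")
  case True
  have "s powr (p - 1) * t \<le> s powr (p - 1) * (\<delta> * s)" using True by (intro mult_left_mono) auto
  also have "\<dots> = \<delta> * s powr p"
    using st powr_add[of s "p - 1" 1] by (cases "s = 0") auto
  finally show ?thesis by (simp add: add_increasing2)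
next
  case False
  have "0 \<le> \<delta> * s" using \<delta> st by simp
  then have t: "s < t / \<delta>" "0 < t" using False \<delta> by (auto simp: field_simps)
  have "s powr (p - 1) * t \<le> (t / \<delta>) powr (p - 1) * t"
    using t st p by (intro mult_right_mono powr_mono2) auto
  also have "\<dots> = \<delta> powr (1 - p) * t powr p"
    using t(2) \<delta> by (simp add: powr_divide powr_diff powr_minus field_simps)
  finally show ?thesis using \<delta> by (simp add: add_increasing)
qed

lemma Young_conjugate_powr_le:
  fixes p q \<delta> s t :: real
  assumes p: "1 < p" and q: "q = p / (p - 1)" and \<delta>: "0 < \<delta>" and st: "0 \<le> s" "0 \<le> t"
  shows "t * s \<le> \<delta> * s powr p + \<delta> powr (1 - q) * t powr q"
proof (cases "t \<le> \<delta> * s powr (p - 1)")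
  case True
  have "t * s \<le> \<delta> * s powr (p - 1) * s" using True st by (intro mult_right_mono) auto
  also have "\<dots> = \<delta> * s powr p"
    using st powr_add[of s "p - 1" 1] by (cases "s = 0") auto
  finally show ?thesis by (simp add: add_increasing2)
next
  case False
  have e: "(p - 1) * (q - 1) = 1" using p q by (simp add: field_simps)
  have "q - 1 = 1 / (p - 1)" using p q by (simp add: field_simps)
  then have q1: "0 < q - 1" using p by simp
  have "0 \<le> \<delta> * s powr (p - 1)" using \<delta> by simp
  then have "0 < t" using False by linarith
  moreover have "s powr (p - 1) < t / \<delta>" using False \<delta> by (simp add: field_simps)
  ultimately have t: "s powr (p - 1) < t / \<delta>" "0 < t" by auto
  have "s = (s powr (p - 1)) powr (q - 1)" using st by (cases "s = 0") (simp_all add: powr_powr e)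
  also have "\<dots> \<le> (t / \<delta>) powr (q - 1)" using t q1 by (intro powr_mono2) auto
  finally have "t * s \<le> t * (t / \<delta>) powr (q - 1)" using t by (intro mult_left_mono) auto
  also have "\<dots> = \<delta> powr (1 - q) * t powr q"
    using t(2) \<delta> by (simp add: powr_divide powr_diff powr_minus field_simps)
  finally show ?thesis using \<delta> by (simp add: add_increasing)
qed

text \<open>
  For vectors of length \<open>\<alpha>\<close> and \<open>\<beta>\<close> with cosine \<open>\<tau>\<close>, this bounds the \<open>p\<close>th power of the distance by
  the monotonicity expression of the \<open>p\<close>-Laplacian, up to a small error. Both sides are homogeneous, so
  it is enough to prove it for \<open>max \<alpha> \<beta> = 1\<close>. There the monotonicity expression is nonnegative, with
  zeros only for equal vectors, and the claim follows by compactness, for all \<open>p > 1\<close> alike.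
\<close>
lemma monotonicity_compactness:
  fixes p \<epsilon> :: real
  assumes p: "1 < p" and \<epsilon>: "0 < \<epsilon>"
  shows "\<exists>C\<ge>0. \<forall>\<alpha> \<beta> \<tau>. 0 \<le> \<alpha> \<longrightarrow> 0 \<le> \<beta> \<longrightarrow> \<bar>\<tau>\<bar> \<le> 1 \<longrightarrow>
    (\<alpha>\<^sup>2 + \<beta>\<^sup>2 - 2 * \<alpha> * \<beta> * \<tau>) powr (p / 2) \<le> \<epsilon> * (\<alpha> powr p + \<beta> powr p) +
      C * (\<alpha> powr p + \<beta> powr p - (\<alpha> powr (p - 1) * \<beta> + \<alpha> * \<beta> powr (p - 1)) * \<tau>)"
proof -
  define f :: "real \<times> real \<times> real \<Rightarrow> real" where
    "f = (\<lambda>(\<alpha>, \<beta>, \<tau>). (\<alpha>\<^sup>2 + \<beta>\<^sup>2 - 2 * \<alpha> * \<beta> * \<tau>) powr (p / 2) - \<epsilon> * (\<alpha> powr p + \<beta> powr p))"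
  define D :: "real \<times> real \<times> real \<Rightarrow> real" where
    "D = (\<lambda>(\<alpha>, \<beta>, \<tau>). \<alpha> powr p + \<beta> powr p - (\<alpha> powr (p - 1) * \<beta> + \<alpha> * \<beta> powr (p - 1)) * \<tau>)"
  have pw: "x powr p = x powr (p - 1) * x" if "0 \<le> x" for x :: real
    using that powr_add[of x "p - 1" 1] by (cases "x = 0") auto
  have D_eq: "D (\<alpha>, \<beta>, \<tau>) = (\<alpha> powr (p - 1) - \<beta> powr (p - 1)) * (\<alpha> - \<beta>) +
      (\<alpha> powr (p - 1) * \<beta> + \<alpha> * \<beta> powr (p - 1)) * (1 - \<tau>)" if "0 \<le> \<alpha>" "0 \<le> \<beta>" for \<alpha> \<beta> \<tau>
    using that by (simp add: D_def pw algebra_simps)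
  have mono1: "0 \<le> (\<alpha> powr (p - 1) - \<beta> powr (p - 1)) * (\<alpha> - \<beta>)" if "0 \<le> \<alpha>" "0 \<le> \<beta>" for \<alpha> \<beta>
    using that p powr_mono2[of "p - 1" \<alpha> \<beta>] powr_mono2[of "p - 1" \<beta> \<alpha>]
    by (cases "\<alpha> \<le> \<beta>") (auto intro: mult_nonneg_nonneg mult_nonpos_nonpos)
  have D_nonneg: "0 \<le> D (\<alpha>, \<beta>, \<tau>)" if "0 \<le> \<alpha>" "0 \<le> \<beta>" "\<bar>\<tau>\<bar> \<le> 1" for \<alpha> \<beta> \<tau>
    unfolding D_eq[OF that(1,2)] using that by (intro add_nonneg_nonneg mono1 mult_nonneg_nonneg) auto
  have q_nonneg: "0 \<le> \<alpha>\<^sup>2 + \<beta>\<^sup>2 - 2 * \<alpha> * \<beta> * \<tau>" if "0 \<le> \<alpha>" "0 \<le> \<beta>" "\<bar>\<tau>\<bar> \<le> 1" for \<alpha> \<beta> \<tau> :: real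
  proof -
    have "\<alpha> * \<beta> * \<tau> \<le> \<alpha> * \<beta> * 1" using that by (intro mult_left_mono mult_nonneg_nonneg) auto
    moreover have "0 \<le> (\<alpha> - \<beta>)\<^sup>2" by simp
    ultimately show ?thesis by (simp add: power2_diff)
  qed
  define S :: "(real \<times> real \<times> real) set" where
    "S = ({1} \<times> {0..1} \<times> {-1..1}) \<union> ({0..1} \<times> {1} \<times> {-1..1})"
  have S_bounds: "0 \<le> fst z" "0 \<le> fst (snd z)" "\<bar>snd (snd z)\<bar> \<le> 1" if "z \<in> S" for z
    using that by (auto simp: S_def)
  have compS: "compact S" unfolding S_def by (intro compact_Un compact_Times) auto
  have cf: "continuous_on S (\<lambda>z. fst z powr r)" "continuous_on S (\<lambda>z. fst (snd z) powr r)" if "0 < r" for r :: real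
  proof -
    have c: "continuous_on S (\<lambda>z. fst z)" "continuous_on S (\<lambda>z. fst (snd z))"
      by (intro continuous_intros)+
    show "continuous_on S (\<lambda>z. fst z powr r)"
      by (rule continuous_on_powr'[OF c(1) continuous_on_const]) (use S_bounds that in blast)
    show "continuous_on S (\<lambda>z. fst (snd z) powr r)"
      by (rule continuous_on_powr'[OF c(2) continuous_on_const]) (use S_bounds that in blast)
  qed
  have cq: "continuous_on S (\<lambda>z. ((fst z)\<^sup>2 + (fst (snd z))\<^sup>2 - 2 * fst z * fst (snd z) * snd (snd z)) powr (p / 2))"
  proof (rule continuous_on_powr'[OF _ continuous_on_const])
    show "continuous_on S (\<lambda>z. (fst z)\<^sup>2 + (fst (snd z))\<^sup>2 - 2 * fst z * fst (snd z) * snd (snd z))"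
      by (intro continuous_intros)
    have "0 < p / 2" using p by simp
    then show "\<forall>z\<in>S. 0 \<le> (fst z)\<^sup>2 + (fst (snd z))\<^sup>2 - 2 * fst z * fst (snd z) * snd (snd z) \<and>
      ((fst z)\<^sup>2 + (fst (snd z))\<^sup>2 - 2 * fst z * fst (snd z) * snd (snd z) = 0 \<longrightarrow> 0 < p / 2)"
      using S_bounds q_nonneg by blast
  qed
  have contf: "continuous_on S f"
    unfolding f_def case_prod_unfold
    using p by (intro continuous_on_diff continuous_on_mult continuous_on_add continuous_on_const cf cq) auto
  have contD: "continuous_on S D"
    unfolding D_def case_prod_unfold
    using p by (intro continuous_on_diff continuous_on_mult continuous_on_add cf
        continuous_on_fst continuous_on_snd continuous_on_id) auto
  \<comment> \<open>on the complement of \<open>T\<close> in \<open>S\<close> the error term alone suffices; on \<open>T\<close> the expression \<open>D\<close> has a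
    positive minimum\<close>
  define T where "T = S \<inter> f -` {0..}"
  have "closed T" unfolding T_def
    by (rule continuous_closed_preimage[OF contf compact_imp_closed[OF compS] closed_atLeast])
  then have compT: "compact T"
    using compact_Int_closed[OF compS, of T] by (simp add: T_def Int_assoc[symmetric])
  have subTS: "T \<subseteq> S" by (auto simp: T_def)
  have Dpos: "0 < D z" if zT: "z \<in> T" for z
  proof -
    obtain \<alpha> \<beta> \<tau> where z: "z = (\<alpha>, \<beta>, \<tau>)" by (cases z)
    have zS: "z \<in> S" using zT subTS by blast
    have b: "0 \<le> \<alpha>" "0 \<le> \<beta>" "\<bar>\<tau>\<bar> \<le> 1" using S_bounds[OF zS] z by auto
    have "D z \<noteq> 0"
    proof
      assume "D z = 0"
      then have 1: "(\<alpha> powr (p - 1) - \<beta> powr (p - 1)) * (\<alpha> - \<beta>) = 0"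
        and 2: "(\<alpha> powr (p - 1) * \<beta> + \<alpha> * \<beta> powr (p - 1)) * (1 - \<tau>) = 0"
        using mono1[OF b(1,2)] mult_nonneg_nonneg[of "\<alpha> powr (p - 1) * \<beta> + \<alpha> * \<beta> powr (p - 1)" "1 - \<tau>"] b
        unfolding z D_eq[OF b(1,2)] by (auto simp: add_nonneg_eq_0_iff)
      have "\<alpha> = \<beta>"
      proof (rule ccontr)
        assume ne: "\<alpha> \<noteq> \<beta>"
        then have "\<alpha> powr (p - 1) = \<beta> powr (p - 1)" using 1 by simp
        then show False
          using ne b p powr_less_mono2[of "p - 1" \<alpha> \<beta>] powr_less_mono2[of "p - 1" \<beta> \<alpha>]
          by (cases \<alpha> \<beta> rule: linorder_cases) auto
      qed
      moreover have "\<alpha> = 1 \<or> \<beta> = 1" using zS z by (auto simp: S_def)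
      ultimately have ab: "\<alpha> = 1" "\<beta> = 1" by auto
      then have "\<tau> = 1" using 2 by simp
      then have "f z < 0" using ab \<epsilon> p by (simp add: z f_def)
      then show False using zT by (simp add: T_def)
    qed
    then show ?thesis using D_nonneg[OF b] z by simp
  qed
  obtain C where C: "0 \<le> C" "\<And>z. z \<in> S \<Longrightarrow> f z \<le> C * D z"
  proof (cases "T = {}")
    case True
    then have "f z \<le> 0 * D z" if "z \<in> S" for z using that by (auto simp: T_def vimage_def not_le intro: less_imp_le)
    then show ?thesis using that[of 0] by auto
  next
    case False
    obtain z0 where z0: "z0 \<in> T" "\<And>z. z \<in> T \<Longrightarrow> D z0 \<le> D z"
      using continuous_attains_inf[OF compT False continuous_on_subset[OF contD subTS]] by blast
    obtain z1 where z1: "z1 \<in> T" "\<And>z. z \<in> T \<Longrightarrow> f z \<le> f z1"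
      using continuous_attains_sup[OF compT False continuous_on_subset[OF contf subTS]] by blast
    have d: "0 < D z0" by (rule Dpos[OF z0(1)])
    have f1: "0 \<le> f z1" using z1(1) by (simp add: T_def)
    have "f z \<le> f z1 / D z0 * D z" if zS: "z \<in> S" for z
    proof (cases "z \<in> T")
      case True
      have "f z \<le> f z1 / D z0 * D z0" using z1(2)[OF True] d by simp
      also have "\<dots> \<le> f z1 / D z0 * D z" using z0(2)[OF True] d f1 by (intro mult_left_mono) auto
      finally show ?thesis .
    next
      case False
      then have "f z \<le> 0" using zS by (auto simp: T_def)
      moreover have "0 \<le> D z"
        using D_nonneg[OF S_bounds[OF zS]] by simp
      ultimately show ?thesis using d f1 by (meson divide_nonneg_pos mult_nonneg_nonneg order.trans)
    qed
    then show ?thesis using that[of "f z1 / D z0"] d f1 by auto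
  qed
  show ?thesis
  proof (intro exI[of _ C] conjI allI impI C(1))
    fix \<alpha> \<beta> \<tau> :: real assume b: "0 \<le> \<alpha>" "0 \<le> \<beta>" "\<bar>\<tau>\<bar> \<le> 1"
    show "(\<alpha>\<^sup>2 + \<beta>\<^sup>2 - 2 * \<alpha> * \<beta> * \<tau>) powr (p / 2) \<le> \<epsilon> * (\<alpha> powr p + \<beta> powr p) +
      C * (\<alpha> powr p + \<beta> powr p - (\<alpha> powr (p - 1) * \<beta> + \<alpha> * \<beta> powr (p - 1)) * \<tau>)"
    proof (cases "\<alpha> = 0 \<and> \<beta> = 0")
      case True
      then show ?thesis by simp
    next
      case False
      define m where "m = max \<alpha> \<beta>"
      have m: "0 < m" using False b by (auto simp: m_def max_def)
      define a c where "a = \<alpha> / m" and "c = \<beta> / m"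
      have ac: "\<alpha> = m * a" "\<beta> = m * c" using m by (auto simp: a_def c_def)
      have acb: "0 \<le> a" "0 \<le> c" using b m by (auto simp: a_def c_def)
      have "a \<le> 1" "c \<le> 1" "a = 1 \<or> c = 1"
        using m b by (auto simp: a_def c_def m_def max_def divide_simps split: if_splits)
      then have zS: "(a, c, \<tau>) \<in> S" using acb b by (auto simp: S_def)
      have pm: "m powr p = m powr (p - 1) * m" using pw[of m] m by simp
      have "(\<alpha>\<^sup>2 + \<beta>\<^sup>2 - 2 * \<alpha> * \<beta> * \<tau>) powr (p / 2) = (m powr 2 * (a\<^sup>2 + c\<^sup>2 - 2 * a * c * \<tau>)) powr (p / 2)"
        using m by (simp add: ac power2_eq_square algebra_simps)
      also have "\<dots> = m powr p * (a\<^sup>2 + c\<^sup>2 - 2 * a * c * \<tau>) powr (p / 2)"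
        using q_nonneg[OF acb b(3)] m by (simp add: powr_mult powr_powr del: powr_numeral)
      also have "\<dots> \<le> m powr p * (\<epsilon> * (a powr p + c powr p) + C * D (a, c, \<tau>))"
        using C(2)[OF zS] by (intro mult_left_mono) (auto simp: f_def)
      also have "\<dots> = \<epsilon> * (\<alpha> powr p + \<beta> powr p) +
        C * (\<alpha> powr p + \<beta> powr p - (\<alpha> powr (p - 1) * \<beta> + \<alpha> * \<beta> powr (p - 1)) * \<tau>)"
        using m acb by (simp add: ac D_def powr_mult pm algebra_simps)
      finally show ?thesis .
    qed
  qed
qed

section \<open>The Friedrichs inequality\<close>

text \<open>Adding a multiple of \<open>\<rho>\<close> makes the inequality trivial on the exceptional curves.\<close>
lemma upper_gradient_approx:
  assumes p: "0 < p" and N: "borel_on N" and h: "h \<in> borel_measurable N"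
    and \<rho>: "\<rho> \<in> borel_measurable N" "gradient_off N \<rho> u h" and e: "0 < (e::real)"
  shows "upper_gradient N u (\<lambda>x. h x + ennreal e * \<rho> x)"
  unfolding upper_gradient_def
proof (intro conjI ballI)
  note [measurable] = h \<rho>(1)
  show "(\<lambda>x. h x + ennreal e * \<rho> x) \<in> borel_measurable N" by measurable
  fix c assume c: "c \<in> rect_curves (space N)"
  obtain a b \<gamma> where abc: "c = (a, b, \<gamma>)" by (cases c)
  note w = whole_curve_arc[OF c[unfolded abc]]
  let ?\<sigma> = "arc_length_param (a, b, \<gamma>)" and ?l = "real_length (a, b, \<gamma>)"
  have \<rho>e: "(\<lambda>x. ennreal e * \<rho> x) \<in> borel_measurable N" by measurable
  have I: "curve_integral (\<lambda>x. h x + ennreal e * \<rho> x) c = arc_integral h ?\<sigma> 0 ?l + ennreal e * arc_integral \<rho> ?\<sigma> 0 ?l"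
    using arc_integral_add[OF N w(1) h \<rho>e] arc_integral_cmult[OF N w(1) \<rho>(1), of "ennreal e"]
    by (simp add: abc w(4))
  have "ennreal \<bar>u (\<gamma> a) - u (\<gamma> b)\<bar> \<le> arc_integral h ?\<sigma> 0 ?l + ennreal e * arc_integral \<rho> ?\<sigma> 0 ?l"
  proof (cases "arc_integral \<rho> ?\<sigma> 0 ?l < \<infinity>")
    case True
    have "ennreal \<bar>u (\<gamma> a) - u (\<gamma> b)\<bar> \<le> arc_integral h ?\<sigma> 0 ?l"
      using gradient_offD[OF \<rho>(2) w(1) True] by (simp add: w(2,3))
    then show ?thesis by (simp add: add_increasing2)
  next
    case False
    then have "arc_integral \<rho> ?\<sigma> 0 ?l = \<infinity>" by (simp add: less_top[symmetric])
    then have "ennreal e * arc_integral \<rho> ?\<sigma> 0 ?l = \<infinity>" using e by (simp add: ennreal_mult_top)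
    then show ?thesis by simp
  qed
  then show "upper_gradient_along u (\<lambda>x. h x + ennreal e * \<rho> x) c"
    by (simp add: upper_gradient_along_def abc I[unfolded abc])
qed

lemma ennpowr_add_le:
  assumes "0 < p"
  shows "ennpowr (x + y) p \<le> ennreal (2 powr p) * (ennpowr x p + ennpowr y p)"
proof -
  have "ennpowr (x + y) p \<le> ennpowr (2 * max x y) p"
    using assms by (intro ennpowr_mono) (auto simp: mult_2 intro: add_mono)
  also have "\<dots> = ennreal (2 powr p) * ennpowr (max x y) p"
    using ennpowr_ennreal[of 2 p] by (simp add: ennpowr_mult)
  also have "\<dots> \<le> ennreal (2 powr p) * (ennpowr x p + ennpowr y p)"
    by (intro mult_left_mono) (auto simp: max_def add_increasing add_increasing2)
  finally show ?thesis .
qed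

context cheeger_domain
begin

lemma big_ball:
  obtains x0 R where "0 < R" "\<Omega> \<subseteq> ball x0 R" "0 < emeasure M (ball x0 R - \<Omega>)"
proof -
  obtain x0 :: 'a where True by blast
  obtain R0 where R0: "\<Omega> \<subseteq> ball x0 R0" using bounded_\<Omega> bounded_subset_ballD by blast
  have "\<exists>n::nat. 0 < emeasure M (ball x0 (real n) - \<Omega>)"
  proof (rule ccontr)
    assume "\<not> ?thesis"
    then have "ball x0 (real n) - \<Omega> \<in> null_sets M" for n
      using open_\<Omega> by (auto simp: null_sets_def sets_M not_less)
    then have "(\<Union>n. ball x0 (real n) - \<Omega>) \<in> null_sets M" by (rule null_sets_UN)
    moreover have "(\<Union>n. ball x0 (real n) - \<Omega>) = UNIV - \<Omega>"
      using reals_Archimedean2 by (auto simp: dist_commute)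
    ultimately show False using outside by auto
  qed
  then obtain n where n: "0 < emeasure M (ball x0 (real n) - \<Omega>)" by blast
  let ?R = "max 1 (max R0 (real n))"
  have "emeasure M (ball x0 (real n) - \<Omega>) \<le> emeasure M (ball x0 ?R - \<Omega>)"
    using open_\<Omega> by (intro emeasure_mono) (auto simp: sets_M)
  moreover have "\<Omega> \<subseteq> ball x0 ?R" using R0 by (auto simp: subset_iff)
  ultimately show ?thesis using n by (intro that[of ?R x0]) auto
qed

text \<open>The Poincare inequality on a large ball bounds the oscillation of \<open>v\<close> there. As \<open>v\<close> vanishes on
  a part of the ball of positive measure, its mean is controlled as well. The passage from weak upper
  gradients to upper gradients costs an arbitrarily small \<open>p\<close>-integrable function.\<close>
lemma Friedrichs:
  "\<exists>C\<ge>0. \<forall>v \<in> newtonian p M. (\<forall>x. x \<notin> \<Omega> \<longrightarrow> v x = 0) \<longrightarrow>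
    (\<integral>\<^sup>+x. ennreal (\<bar>v x\<bar> powr p) \<partial>M) \<le> ennreal C * (\<integral>\<^sup>+x. ennpowr (min_upper_gradient p M v x) p \<partial>M)"
proof -
  note p = p_pos
  obtain x0 R where R: "0 < R" "\<Omega> \<subseteq> ball x0 R" "0 < emeasure M (ball x0 R - \<Omega>)" by (rule big_ball)
  obtain CP \<Lambda> where CP: "0 < CP" "1 \<le> \<Lambda>" and poin: "\<And>u x r h. integrable (completion M) u \<Longrightarrow> r > 0 \<Longrightarrow>
     upper_gradient M u h \<Longrightarrow>
     ennpowr (nn_mean (completion M) (ball x r) (\<lambda>y. ennreal (\<bar>u y - mean (completion M) (ball x r) u\<bar> powr p))) (1 / p)
       \<le> ennreal (CP * r) * ennpowr (nn_mean M (ball x (\<Lambda> * r)) (\<lambda>y. ennpowr (h y) p)) (1 / p)"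
    using poincare unfolding poincare_inequality_def by blast
  let ?B = "ball x0 R" and ?B' = "ball x0 (\<Lambda> * R)"
  have BM [measurable]: "?B \<in> sets M" "?B' \<in> sets M" "?B - \<Omega> \<in> sets M"
    using open_\<Omega> by (auto simp: sets_M)
  have BcM [measurable]: "?B \<in> sets (completion M)" using BM(1) by simp
  define m where "m = enn2real (emeasure M ?B)"
  define m0 where "m0 = enn2real (emeasure M (?B - \<Omega>))"
  have fB: "emeasure M ?B < \<infinity>" "emeasure M ?B' < \<infinity>" using doubling_ball_finite[OF doubling_M] by auto
  have m0B: "emeasure M (?B - \<Omega>) \<le> emeasure M ?B" by (intro emeasure_mono) auto
  have BB': "emeasure M ?B \<le> emeasure M ?B'"
  proof (intro emeasure_mono)
    have "1 * R \<le> \<Lambda> * R" using CP R by (intro mult_right_mono) auto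
    then show "?B \<subseteq> ?B'" by (intro subset_ball) simp
  qed auto
  have em: "emeasure M ?B = ennreal m" "emeasure M (?B - \<Omega>) = ennreal m0"
    using fB m0B by (auto simp: m_def m0_def order.strict_trans1)
  have mpos: "0 < m0" "m0 \<le> m"
    using R(3) m0B fB unfolding m_def m0_def
    by (auto simp: enn2real_positive_iff less_top order.strict_trans1 intro!: enn2real_mono)
  define K where "K = (CP * R) powr p"
  have K: "0 < K" using CP R by (simp add: K_def)
  have main: "(\<integral>\<^sup>+x. ennreal (\<bar>v x\<bar> powr p) \<partial>M) \<le>
      ennreal (2 powr p * (1 + m / m0) * (K * 2 powr p)) * (\<integral>\<^sup>+x. ennpowr (min_upper_gradient p M v x) p \<partial>M)"
    if v: "v \<in> newtonian p M" and v0: "\<And>x. x \<notin> \<Omega> \<Longrightarrow> v x = 0" for v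
  proof -
    let ?g = "min_upper_gradient p M v"
    have vm [measurable]: "v \<in> borel_measurable (completion M)"
      and vfin: "(\<integral>\<^sup>+x. ennreal (\<bar>v x\<bar> powr p) \<partial>M) < \<infinity>" and vd: "p_weakly_differentiable p M v"
      using v by (simp_all add: newtonian_iff[OF p])
    note g = min_upper_gradient[OF p borel_on_M vd]
    have gm [measurable]: "?g \<in> borel_measurable M" using g(2) by (simp add: p_integrable_def)
    obtain \<rho> where \<rho>: "p_integrable p M \<rho>" "gradient_off M \<rho> v ?g"
      using g(1) p borel_on_M by (auto simp: weak_upper_gradient_iff)
    have \<rho>m [measurable]: "\<rho> \<in> borel_measurable M" using \<rho>(1) by (simp add: p_integrable_def)
    have vint: "integrable (completion M) v"
    proof (rule integrableI_bounded[OF vm])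
      have "(\<integral>\<^sup>+x. ennreal (norm (v x)) \<partial>M) \<le> (\<integral>\<^sup>+x. indicator ?B x + ennreal (\<bar>v x\<bar> powr p) \<partial>completion M)"
        unfolding nn_integral_completion
      proof (rule nn_integral_mono)
        fix x
        show "ennreal (norm (v x)) \<le> indicator ?B x + ennreal (\<bar>v x\<bar> powr p)"
        proof (cases "\<bar>v x\<bar> \<le> 1")
          case True
          then show ?thesis using v0[of x] R(2)
            by (cases "x \<in> \<Omega>") (auto intro!: add_increasing2 simp: subset_iff ennreal_le_1)
        next
          case False
          then have "\<bar>v x\<bar> powr 1 \<le> \<bar>v x\<bar> powr p" using p_gt_1 by (intro powr_mono) auto
          then have "ennreal \<bar>v x\<bar> \<le> ennreal (\<bar>v x\<bar> powr p)" by (intro ennreal_leI) auto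
          then show ?thesis by (simp add: add_increasing)
        qed
      qed
      also have "\<dots> = emeasure (completion M) ?B + (\<integral>\<^sup>+x. ennreal (\<bar>v x\<bar> powr p) \<partial>M)"
        by (subst nn_integral_add) (auto simp: nn_integral_completion)
      also have "\<dots> < \<infinity>" using vfin fB by simp
      finally show "(\<integral>\<^sup>+x. ennreal (norm (v x)) \<partial>completion M) < \<infinity>" by (simp add: nn_integral_completion)
    qed
    define c where "c = mean (completion M) ?B v"
    define I where "I = (\<integral>\<^sup>+x\<in>?B. ennreal (\<bar>v x - c\<bar> powr p) \<partial>M)"
    define Ig where "Ig = (\<integral>\<^sup>+x. ennpowr (?g x) p \<partial>M)"
    define I\<rho> where "I\<rho> = enn2real (\<integral>\<^sup>+x. ennpowr (\<rho> x) p \<partial>M)"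
    have I\<rho>: "(\<integral>\<^sup>+x. ennpowr (\<rho> x) p \<partial>M) = ennreal I\<rho>" "0 \<le> I\<rho>"
      using \<rho>(1) by (auto simp: I\<rho>_def p_integrable_def)
    have Ie: "I \<le> ennreal (K * 2 powr p) * Ig + ennreal (K * 2 powr p * (e powr p * I\<rho>))" if e: "0 < e" for e
    proof -
      let ?h = "\<lambda>x. ?g x + ennreal e * \<rho> x"
      have "upper_gradient M v ?h"
        by (rule upper_gradient_approx[OF p borel_on_M gm \<rho>m \<rho>(2) e])
      from poin[OF vint R(1) this, of x0]
      have "ennpowr (nn_mean (completion M) ?B (\<lambda>y. ennreal (\<bar>v y - c\<bar> powr p))) (1 / p)
         \<le> ennreal (CP * R) * ennpowr (nn_mean M ?B' (\<lambda>y. ennpowr (?h y) p)) (1 / p)"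
        by (simp add: c_def)
      then have "ennpowr (ennpowr (nn_mean (completion M) ?B (\<lambda>y. ennreal (\<bar>v y - c\<bar> powr p))) (1 / p)) p
         \<le> ennpowr (ennreal (CP * R) * ennpowr (nn_mean M ?B' (\<lambda>y. ennpowr (?h y) p)) (1 / p)) p"
        using p by (intro ennpowr_mono[of p]) auto
      then have "nn_mean (completion M) ?B (\<lambda>y. ennreal (\<bar>v y - c\<bar> powr p)) \<le>
          ennreal K * nn_mean M ?B' (\<lambda>y. ennpowr (?h y) p)"
        using CP R p by (simp add: ennpowr_ennpowr_inverse ennpowr_mult K_def)
      then have le: "I / emeasure M ?B \<le> ennreal K * ((\<integral>\<^sup>+x\<in>?B'. ennpowr (?h x) p \<partial>M) / emeasure M ?B')"
        by (simp add: nn_mean_def I_def nn_integral_completion)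
      have B0: "emeasure M ?B \<noteq> 0" "emeasure M ?B \<noteq> \<infinity>" using em mpos by auto
      have B0': "emeasure M ?B' \<noteq> 0" using B0(1) BB' by (metis le_zero_eq)
      have "I = I / emeasure M ?B * emeasure M ?B"
        using B0 by (simp add: ennreal_divide_times less_top[symmetric] zero_less_iff_neq_zero)
      also have "\<dots> \<le> ennreal K * ((\<integral>\<^sup>+x\<in>?B'. ennpowr (?h x) p \<partial>M) / emeasure M ?B') * emeasure M ?B'"
        using le BB' by (intro mult_mono) auto
      also have "\<dots> = ennreal K * ((\<integral>\<^sup>+x\<in>?B'. ennpowr (?h x) p \<partial>M) / emeasure M ?B' * emeasure M ?B')"
        by (simp add: mult.assoc)
      also have "(\<integral>\<^sup>+x\<in>?B'. ennpowr (?h x) p \<partial>M) / emeasure M ?B' * emeasure M ?B' = (\<integral>\<^sup>+x\<in>?B'. ennpowr (?h x) p \<partial>M)"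
        using B0' fB by (simp add: ennreal_divide_times)
      also have "(\<integral>\<^sup>+x\<in>?B'. ennpowr (?h x) p \<partial>M) \<le>
          (\<integral>\<^sup>+x. ennreal (2 powr p) * (ennpowr (?g x) p + ennpowr (ennreal e * \<rho> x) p) \<partial>M)"
        using ennpowr_add_le[OF p] by (intro nn_integral_mono) (auto split: split_indicator)
      also have "\<dots> = ennreal (2 powr p) * (Ig + ennreal (e powr p) * ennreal I\<rho>)"
        using e by (simp add: nn_integral_cmult nn_integral_add ennpowr_mult Ig_def I\<rho>)
      finally have "I \<le> ennreal K * (ennreal (2 powr p) * (Ig + ennreal (e powr p) * ennreal I\<rho>))"
        by (simp add: mult_left_mono)
      also have "\<dots> = ennreal (K * 2 powr p) * Ig + ennreal (K * 2 powr p * (e powr p * I\<rho>))"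
        using K I\<rho>(2) by (simp add: ennreal_mult distrib_left mult.assoc)
      finally show ?thesis .
    qed
    have I_le: "I \<le> ennreal (K * 2 powr p) * Ig"
    proof (rule ennreal_le_epsilon)
      fix d :: real assume d: "0 < d"
      let ?Q = "K * 2 powr p * I\<rho>"
      have Q: "0 \<le> ?Q" using K I\<rho>(2) by simp
      let ?e = "(d / (?Q + 1)) powr (1 / p)"
      have e: "0 < ?e" "?e powr p = d / (?Q + 1)" using d Q p by (auto simp: powr_powr)
      have "K * 2 powr p * (?e powr p * I\<rho>) = d * (?Q / (?Q + 1))" unfolding e(2) by simp
      also have "\<dots> \<le> d * 1" using d Q by (intro mult_left_mono) auto
      finally have "ennreal (K * 2 powr p * (?e powr p * I\<rho>)) \<le> ennreal d" by (intro ennreal_leI) simp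
      then show "I \<le> ennreal (K * 2 powr p) * Ig + ennreal d"
        using Ie[OF e(1)] by (auto intro: order.trans add_left_mono)
    qed
    have "ennreal (\<bar>c\<bar> powr p) * ennreal m0 = (\<integral>\<^sup>+x. ennreal (\<bar>c\<bar> powr p) * indicator (?B - \<Omega>) x \<partial>M)"
      by (simp add: nn_integral_cmult_indicator em)
    also have "\<dots> \<le> I"
      unfolding I_def using v0 by (intro nn_integral_mono) (auto split: split_indicator)
    finally have cI: "ennreal (\<bar>c\<bar> powr p) * ennreal m0 \<le> I" .
    have "ennreal (\<bar>c\<bar> powr p) * ennreal m = ennreal (m / m0) * (ennreal (\<bar>c\<bar> powr p) * ennreal m0)"
      using mpos by (simp add: ennreal_mult[symmetric])
    also have "\<dots> \<le> ennreal (m / m0) * I" by (intro mult_left_mono cI) simp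
    finally have cm: "ennreal (\<bar>c\<bar> powr p) * ennreal m \<le> ennreal (m / m0) * I" .
    have "(\<integral>\<^sup>+x. ennreal (\<bar>v x\<bar> powr p) \<partial>completion M) \<le>
      (\<integral>\<^sup>+x. ennreal (2 powr p) * (ennreal (\<bar>v x - c\<bar> powr p) * indicator ?B x + ennreal (\<bar>c\<bar> powr p) * indicator ?B x) \<partial>completion M)"
    proof (rule nn_integral_mono)
      fix x
      show "ennreal (\<bar>v x\<bar> powr p) \<le>
        ennreal (2 powr p) * (ennreal (\<bar>v x - c\<bar> powr p) * indicator ?B x + ennreal (\<bar>c\<bar> powr p) * indicator ?B x)"
      proof (cases "x \<in> ?B")
        case True
        have "\<bar>v x\<bar> powr p \<le> (\<bar>v x - c\<bar> + \<bar>c\<bar>) powr p" using p by (intro powr_mono2) auto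
        also have "\<dots> \<le> 2 powr p * (\<bar>v x - c\<bar> powr p + \<bar>c\<bar> powr p)" using p by (intro powr_add_le) auto
        finally show ?thesis using True
          by (simp add: ennreal_mult[symmetric] ennreal_plus[symmetric] ennreal_leI del: ennreal_plus)
      next
        case False
        then have "v x = 0" using v0 R(2) by blast
        then show ?thesis by simp
      qed
    qed
    also have "\<dots> = ennreal (2 powr p) * (I + ennreal (\<bar>c\<bar> powr p) * ennreal m)"
    proof -
      have "emeasure (completion M) ?B = ennreal m" using em BM by simp
      then show ?thesis
        by (simp add: nn_integral_cmult nn_integral_add nn_integral_cmult_indicator I_def
            nn_integral_completion[of M "\<lambda>x. ennreal (\<bar>v x - c\<bar> powr p) * indicator ?B x"])
    qed
    also have "\<dots> \<le> ennreal (2 powr p) * (I + ennreal (m / m0) * I)"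
      by (intro mult_left_mono add_left_mono cm) simp
    also have "\<dots> = ennreal (2 powr p) * (1 + ennreal (m / m0)) * I"
      by (simp add: distrib_left distrib_right mult.assoc)
    also have "ennreal (2 powr p) * (1 + ennreal (m / m0)) = ennreal (2 powr p * (1 + m / m0))"
      using mpos by (simp only: ennreal_mult[symmetric] ennreal_plus[symmetric] ennreal_1[symmetric]) (simp add: ennreal_mult)
    also have "ennreal (2 powr p * (1 + m / m0)) * I \<le>
        ennreal (2 powr p * (1 + m / m0)) * (ennreal (K * 2 powr p) * Ig)"
      by (intro mult_left_mono I_le) simp
    also have "\<dots> = ennreal (2 powr p * (1 + m / m0) * (K * 2 powr p)) * Ig"
      using mpos K by (subst mult.assoc[symmetric], subst ennreal_mult[symmetric]) auto
    finally show ?thesis unfolding Ig_def nn_integral_completion .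
  qed
  show ?thesis
  proof (intro exI[of _ "2 powr p * (1 + m / m0) * (K * 2 powr p)"] conjI)
    show "0 \<le> 2 powr p * (1 + m / m0) * (K * 2 powr p)" using mpos K by simp
  qed (use main in blast)
qed

end

section \<open>The \<open>p\<close>-Laplacian pairing\<close>

text \<open>The integrand of the \<open>p\<close>-Poisson equation: the flux \<open>|v|\<^sup>p\<^sup>-\<^sup>2v\<close> paired with \<open>w\<close>.\<close>
definition flux_pairing :: "(real^'n \<Rightarrow> real^'n \<Rightarrow> real) \<Rightarrow> real \<Rightarrow> real^'n \<Rightarrow> real^'n \<Rightarrow> real" where
  "flux_pairing b p v w = ip_norm b v powr (p - 2) * b v w"

lemma flux_pairing_diff:
  "is_inner_product b \<Longrightarrow> flux_pairing b p v (w - w') = flux_pairing b p v w - flux_pairing b p v w'"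
  by (simp add: flux_pairing_def inner_productD right_diff_distrib)

lemma powr_minus_2_mult: "0 \<le> x \<Longrightarrow> x powr (p - 2) * x = x powr (p - 1)" for x p :: real
  using powr_add[of x "p - 2" 1] by (cases "x = 0") auto

lemma flux_pairing_le:
  assumes b: "is_inner_product b"
  shows "\<bar>flux_pairing b p v w\<bar> \<le> ip_norm b v powr (p - 1) * ip_norm b w"
proof -
  have "\<bar>flux_pairing b p v w\<bar> = ip_norm b v powr (p - 2) * \<bar>b v w\<bar>"
    by (simp add: flux_pairing_def abs_mult)
  also have "\<dots> \<le> ip_norm b v powr (p - 2) * (ip_norm b v * ip_norm b w)"
    by (intro mult_left_mono inner_product_Cauchy_Schwarz[OF b]) simp
  also have "\<dots> = ip_norm b v powr (p - 1) * ip_norm b w"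
    using powr_minus_2_mult[OF ip_norm_properties(1)[OF b, of v], of p] by (simp add: mult.assoc[symmetric])
  finally show ?thesis .
qed

lemma flux_monotone:
  fixes p \<epsilon> :: real
  assumes p: "1 < p" and \<epsilon>: "0 < \<epsilon>"
  shows "\<exists>C\<ge>0. \<forall>(b :: real^'n \<Rightarrow> real^'n \<Rightarrow> real) v w. is_inner_product b \<longrightarrow>
    ip_norm b (v - w) powr p \<le> \<epsilon> * (ip_norm b v powr p + ip_norm b w powr p) +
      C * (flux_pairing b p v (v - w) - flux_pairing b p w (v - w))"
proof -
  obtain C where C: "C \<ge> 0" and ineq: "\<And>\<alpha> \<beta> \<tau>. 0 \<le> \<alpha> \<Longrightarrow> 0 \<le> \<beta> \<Longrightarrow> \<bar>\<tau>\<bar> \<le> 1 \<Longrightarrow>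
    (\<alpha>\<^sup>2 + \<beta>\<^sup>2 - 2 * \<alpha> * \<beta> * \<tau>) powr (p / 2) \<le> \<epsilon> * (\<alpha> powr p + \<beta> powr p) +
      C * (\<alpha> powr p + \<beta> powr p - (\<alpha> powr (p - 1) * \<beta> + \<alpha> * \<beta> powr (p - 1)) * \<tau>)"
    using monotonicity_compactness[OF p \<epsilon>] by blast
  show ?thesis
  proof (intro exI[of _ C] conjI allI impI C)
    fix b :: "real^'n \<Rightarrow> real^'n \<Rightarrow> real" and v w assume b: "is_inner_product b"
    note D = inner_productD[OF b] and n = ip_norm_properties[OF b]
    define \<alpha> \<beta> where "\<alpha> = ip_norm b v" and "\<beta> = ip_norm b w"
    \<comment> \<open>the cosine of the angle; for a zero vector division by zero gives the value \<open>0\<close>, which is fine\<close>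
    define \<tau> where "\<tau> = b v w / (\<alpha> * \<beta>)"
    have nn: "0 \<le> \<alpha>" "0 \<le> \<beta>" by (simp_all add: \<alpha>_def \<beta>_def n)
    have CS: "\<bar>b v w\<bar> \<le> \<alpha> * \<beta>" unfolding \<alpha>_def \<beta>_def by (rule inner_product_Cauchy_Schwarz[OF b])
    have \<tau>: "\<bar>\<tau>\<bar> \<le> 1"
      using CS nn by (cases "\<alpha> * \<beta> = 0") (auto simp: \<tau>_def abs_mult divide_simps)
    have bvw: "b v w = \<alpha> * \<beta> * \<tau>" using CS by (cases "\<alpha> * \<beta> = 0") (auto simp: \<tau>_def)
    have sq: "b v v = \<alpha>\<^sup>2" "b w w = \<beta>\<^sup>2" by (simp_all add: \<alpha>_def \<beta>_def n)
    have "ip_norm b (v - w) = sqrt (\<alpha>\<^sup>2 + \<beta>\<^sup>2 - 2 * \<alpha> * \<beta> * \<tau>)"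
      using D(9)[of w v] bvw by (simp add: ip_norm_def D sq)
    then have 1: "ip_norm b (v - w) powr p = (\<alpha>\<^sup>2 + \<beta>\<^sup>2 - 2 * \<alpha> * \<beta> * \<tau>) powr (p / 2)"
      using D(11)[of "v - w"] D(9)[of w v] bvw by (simp add: D sq powr_half_sqrt[symmetric] powr_powr)
    have pp: "x powr (p - 2) * x\<^sup>2 = x powr p" if "0 \<le> x" for x
      using that powr_minus_2_mult[of x p] powr_minus_2_mult[of x "p + 1"]
      by (simp add: power2_eq_square mult.assoc[symmetric])
    have "flux_pairing b p v (v - w) = \<alpha> powr (p - 2) * \<alpha>\<^sup>2 - (\<alpha> powr (p - 2) * \<alpha>) * \<beta> * \<tau>"
      by (simp add: flux_pairing_def D sq bvw \<alpha>_def[symmetric] algebra_simps)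
    also have "\<dots> = \<alpha> powr p - \<alpha> powr (p - 1) * \<beta> * \<tau>"
      using nn by (simp add: pp powr_minus_2_mult)
    finally have 2: "flux_pairing b p v (v - w) = \<alpha> powr p - \<alpha> powr (p - 1) * \<beta> * \<tau>" .
    have "flux_pairing b p w (v - w) = (\<beta> powr (p - 2) * \<beta>) * \<alpha> * \<tau> - \<beta> powr (p - 2) * \<beta>\<^sup>2"
      using D(9)[of w v] by (simp add: flux_pairing_def D sq bvw \<beta>_def[symmetric] algebra_simps)
    also have "\<dots> = \<beta> powr (p - 1) * \<alpha> * \<tau> - \<beta> powr p"
      using nn by (simp add: pp powr_minus_2_mult)
    finally have 3: "flux_pairing b p w (v - w) = \<beta> powr (p - 1) * \<alpha> * \<tau> - \<beta> powr p" .
    have 4: "flux_pairing b p v (v - w) - flux_pairing b p w (v - w) =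
        \<alpha> powr p + \<beta> powr p - (\<alpha> powr (p - 1) * \<beta> + \<alpha> * \<beta> powr (p - 1)) * \<tau>"
      unfolding 2 3 by (simp add: algebra_simps)
    show "ip_norm b (v - w) powr p \<le> \<epsilon> * (ip_norm b v powr p + ip_norm b w powr p) +
      C * (flux_pairing b p v (v - w) - flux_pairing b p w (v - w))"
      unfolding 1 4 using ineq[OF nn \<tau>] by (simp add: \<alpha>_def \<beta>_def)
  qed
qed

lemma ip_norm_powr_le:
  assumes b: "is_inner_product b" and p: "0 < p"
  shows "ip_norm b (v + w) powr p \<le> 2 powr p * (ip_norm b v powr p + ip_norm b w powr p)"
    and "ip_norm b (v - w) powr p \<le> 2 powr p * (ip_norm b v powr p + ip_norm b w powr p)"
proof -
  note n = ip_norm_properties[OF b]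
  have s: "(ip_norm b v + ip_norm b w) powr p \<le> 2 powr p * (ip_norm b v powr p + ip_norm b w powr p)"
    using p n(1) by (intro powr_add_le) auto
  show "ip_norm b (v + w) powr p \<le> 2 powr p * (ip_norm b v powr p + ip_norm b w powr p)"
    using powr_mono2[OF less_imp_le[OF p] n(1) n(4), of v w] s by simp
  show "ip_norm b (v - w) powr p \<le> 2 powr p * (ip_norm b v powr p + ip_norm b w powr p)"
    using powr_mono2[OF less_imp_le[OF p] n(1) n(5), of v w] s by simp
qed

section \<open>Energies\<close>

lemma integrable_powr_iff:
  fixes u :: "'a \<Rightarrow> real"
  assumes "u \<in> borel_measurable (completion N)"
  shows "integrable (completion N) (\<lambda>x. \<bar>u x\<bar> powr p) \<longleftrightarrow> (\<integral>\<^sup>+x. ennreal (\<bar>u x\<bar> powr p) \<partial>N) < \<infinity>"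
  using assms by (simp add: integrable_iff_bounded nn_integral_completion)

context cheeger_domain
begin

definition energy :: "('a \<Rightarrow> real) \<Rightarrow> real" where
  "energy u = (LINT x|completion N. fibre_norm ip x (gradient u x) powr p)"

lemma gradient_measurable: "u \<in> newtonian p N \<Longrightarrow> gradient u \<in> borel_measurable (completion N)"
  by (rule gradient_spec(1))

lemma gradient_nn_le:
  assumes u: "u \<in> newtonian p N"
  shows "(\<integral>\<^sup>+x. ennreal (fibre_norm ip x (gradient u x) powr p) \<partial>N) \<le>
    (\<integral>\<^sup>+x. ennpowr (min_upper_gradient p N u x) p \<partial>N)"
proof (rule nn_integral_mono_AE)
  from gradient_le[OF u] ip_AE_N
  show "AE x in N. ennreal (fibre_norm ip x (gradient u x) powr p) \<le> ennpowr (min_upper_gradient p N u x) p"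
  proof eventually_elim
    case (elim x)
    then have "0 \<le> fibre_norm ip x (gradient u x)" by (simp add: fibre_norm_eq ip_norm_properties)
    then show ?case
      using ennpowr_mono[OF less_imp_le[OF p_pos] elim(1)] by simp
  qed
qed

lemma gradient_integrable:
  assumes u: "u \<in> newtonian p N"
  shows "integrable (completion N) (\<lambda>x. fibre_norm ip x (gradient u x) powr p)"
proof -
  note [measurable] = gradient_measurable[OF u]
  have d: "p_weakly_differentiable p N u" using u by (simp add: newtonian_iff[OF p_pos])
  have "(\<integral>\<^sup>+x. ennreal (fibre_norm ip x (gradient u x) powr p) \<partial>N) < \<infinity>"
    using gradient_nn_le[OF u] min_upper_gradient(2)[OF p_pos borel_on_N d]
    by (auto simp: p_integrable_def intro: order.strict_trans1)
  then show ?thesis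
    by (intro integrableI_bounded) (simp_all add: nn_integral_completion)
qed

lemma energy_nn:
  assumes u: "u \<in> newtonian p N"
  shows "(\<integral>\<^sup>+x. ennreal (fibre_norm ip x (gradient u x) powr p) \<partial>N) = ennreal (energy u)"
  unfolding energy_def using nn_integral_eq_integral[OF gradient_integrable[OF u]]
  by (simp add: nn_integral_completion)

lemma energy_nonneg: "0 \<le> energy u"
  unfolding energy_def by (intro integral_nonneg_AE) simp

lemma upper_gradient_energy:
  assumes u: "u \<in> newtonian p N"
  shows "(\<integral>\<^sup>+x. ennpowr (min_upper_gradient p N u x) p \<partial>N) \<le>
    ennreal (sqrt (real CARD('n)) powr p) * ennreal (energy u)"
proof -
  note [measurable] = gradient_measurable[OF u]
  let ?c = "sqrt (real CARD('n))"
  have "(\<integral>\<^sup>+x. ennpowr (min_upper_gradient p N u x) p \<partial>N) \<le>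
      (\<integral>\<^sup>+x. ennreal (?c powr p) * ennreal (fibre_norm ip x (gradient u x) powr p) \<partial>N)"
  proof (rule nn_integral_mono_AE)
    from gradient_ge[OF u] ip_AE_N
    show "AE x in N. ennpowr (min_upper_gradient p N u x) p \<le>
        ennreal (?c powr p) * ennreal (fibre_norm ip x (gradient u x) powr p)"
    proof eventually_elim
      case (elim x)
      then have "0 \<le> fibre_norm ip x (gradient u x)" by (simp add: fibre_norm_eq ip_norm_properties)
      then show ?case
        using ennpowr_mono[OF less_imp_le[OF p_pos] elim(1)] by (simp add: ennpowr_mult ennreal_mult)
    qed
  qed
  also have "\<dots> = (\<integral>\<^sup>+x. ennreal (?c powr p) * ennreal (fibre_norm ip x (gradient u x) powr p) \<partial>completion N)"
    by (simp add: nn_integral_completion)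
  also have "\<dots> = ennreal (?c powr p) * ennreal (energy u)"
    by (subst nn_integral_cmult) (auto simp: nn_integral_completion energy_nn[OF u])
  finally show ?thesis .
qed

lemma energy_diff_le:
  assumes u: "u \<in> newtonian p N" and v: "v \<in> newtonian p N"
  shows "energy (\<lambda>x. u x - v x) \<le> 2 powr p * (energy u + energy v)"
proof -
  have "energy (\<lambda>x. u x - v x) \<le>
      (LINT x|completion N. 2 powr p * (fibre_norm ip x (gradient u x) powr p + fibre_norm ip x (gradient v x) powr p))"
    unfolding energy_def
  proof (rule integral_mono_AE)
    from AE_completion[OF ip_AE_N] AE_completion[OF gradient_diff[OF u v]]
    show "AE x in completion N. fibre_norm ip x (gradient (\<lambda>x. u x - v x) x) powr p \<le>
        2 powr p * (fibre_norm ip x (gradient u x) powr p + fibre_norm ip x (gradient v x) powr p)"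
      by eventually_elim (simp add: ip_norm_powr_le(2) p_pos fibre_norm_eq)
  qed (intro gradient_integrable newtonian_diff p_pos borel_on_N u v Bochner_Integration.integrable_add integrable_mult_right)+
  also have "\<dots> = 2 powr p * (energy u + energy v)"
    using gradient_integrable[OF u] gradient_integrable[OF v] by (simp add: energy_def)
  finally show ?thesis .
qed

lemma energy_triangle:
  assumes u: "u \<in> newtonian p N" and v: "v \<in> newtonian p N"
  shows "energy u \<le> 2 powr p * (energy (\<lambda>x. u x - v x) + energy v)"
proof -
  let ?d = "\<lambda>x. u x - v x"
  have d: "?d \<in> newtonian p N" by (rule newtonian_diff[OF p_pos borel_on_N u v])
  have "energy u \<le>
      (LINT x|completion N. 2 powr p * (fibre_norm ip x (gradient ?d x) powr p + fibre_norm ip x (gradient v x) powr p))"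
    unfolding energy_def
  proof (rule integral_mono_AE)
    from AE_completion[OF ip_AE_N] AE_completion[OF gradient_diff[OF u v]]
    show "AE x in completion N. fibre_norm ip x (gradient u x) powr p \<le>
        2 powr p * (fibre_norm ip x (gradient ?d x) powr p + fibre_norm ip x (gradient v x) powr p)"
    proof eventually_elim
      case (elim x)
      then have "gradient u x = gradient ?d x + gradient v x" by simp
      then show ?case
        using ip_norm_powr_le(1)[OF elim(1) p_pos, of "gradient ?d x" "gradient v x"] by (simp add: fibre_norm_eq)
    qed
  qed (intro gradient_integrable d u v Bochner_Integration.integrable_add integrable_mult_right)+
  also have "\<dots> = 2 powr p * (energy ?d + energy v)"
    using gradient_integrable[OF d] gradient_integrable[OF v] by (simp add: energy_def)
  finally show ?thesis .
qed

lemma Friedrichs_energy: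
  "\<exists>C\<ge>0. \<forall>\<phi> \<in> newtonian0 p M \<Omega>. (\<integral>\<^sup>+x. ennreal (\<bar>\<phi> x\<bar> powr p) \<partial>N) \<le> ennreal (C * energy \<phi>)"
proof -
  obtain C where C: "C \<ge> 0" and F: "\<And>v. v \<in> newtonian p M \<Longrightarrow> (\<forall>x. x \<notin> \<Omega> \<longrightarrow> v x = 0) \<Longrightarrow>
    (\<integral>\<^sup>+x. ennreal (\<bar>v x\<bar> powr p) \<partial>M) \<le> ennreal C * (\<integral>\<^sup>+x. ennpowr (min_upper_gradient p M v x) p \<partial>M)"
    using Friedrichs by blast
  let ?c = "sqrt (real CARD('n))"
  have "(\<integral>\<^sup>+x. ennreal (\<bar>\<phi> x\<bar> powr p) \<partial>N) \<le> ennreal (C * ?c powr p * energy \<phi>)"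
    if \<phi>: "\<phi> \<in> newtonian0 p M \<Omega>" for \<phi>
  proof -
    obtain v where v: "v \<in> newtonian p M" "\<And>x. x \<notin> \<Omega> \<Longrightarrow> v x = 0" "\<And>x. x \<in> \<Omega> \<Longrightarrow> \<phi> x = v x"
      using \<phi> by (auto simp: newtonian0_def)
    note \<phi>N = newtonian0_newtonian[OF \<phi>]
    note [measurable] = gradient_measurable[OF \<phi>N]
    let ?g = "min_upper_gradient p M v"
    have vm: "v \<in> borel_measurable (completion M)" "p_weakly_differentiable p M v"
      using v(1) by (simp_all add: newtonian_iff[OF p_pos])
    have "(\<integral>\<^sup>+x. ennreal (\<bar>\<phi> x\<bar> powr p) \<partial>N) \<le> (\<integral>\<^sup>+x. ennreal (\<bar>v x\<bar> powr p) \<partial>M)"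
      unfolding nn_integral_restrict_space[OF \<Omega>_space_in_M] using v(3)
      by (intro nn_integral_mono) (auto split: split_indicator)
    also have "\<dots> \<le> ennreal C * (\<integral>\<^sup>+x. ennpowr (?g x) p \<partial>M)" using v by (intro F) auto
    also have "(\<integral>\<^sup>+x. ennpowr (?g x) p \<partial>M) = (\<integral>\<^sup>+x. ennpowr (?g x) p * indicator \<Omega> x \<partial>M)"
      using min_upper_gradient_zero_set[OF p_pos borel_on_M vm(2,1)]
      by (intro nn_integral_cong_AE, eventually_elim) (use v(2) in \<open>auto split: split_indicator\<close>)
    also have "\<dots> = (\<integral>\<^sup>+x. ennpowr (?g x) p \<partial>N)"
      by (rule nn_integral_restrict_space[OF \<Omega>_space_in_M, symmetric])
    also have "(\<integral>\<^sup>+x. ennpowr (?g x) p \<partial>N) \<le>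
        (\<integral>\<^sup>+x. ennreal (?c powr p) * ennreal (fibre_norm ip x (gradient \<phi> x) powr p) \<partial>N)"
    proof (rule nn_integral_mono_AE)
      have "AE x in N. gradient \<phi> x = G v x" by (rule gradient_zero_extension) (use v in auto)
      with AE_N[OF G_bounds[OF v(1)]] ip_AE_N
      show "AE x in N. ennpowr (?g x) p \<le> ennreal (?c powr p) * ennreal (fibre_norm ip x (gradient \<phi> x) powr p)"
      proof eventually_elim
        case (elim x)
        have nn: "0 \<le> fibre_norm ip x (gradient \<phi> x)" using elim(2) by (simp add: fibre_norm_eq ip_norm_properties)
        have "?g x \<le> ennreal (?c * fibre_norm ip x (gradient \<phi> x))" using elim(1,3) by simp
        from ennpowr_mono[OF less_imp_le[OF p_pos] this] nn show ?case by (simp add: ennpowr_mult ennreal_mult)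
      qed
    qed
    also have "(\<integral>\<^sup>+x. ennreal (?c powr p) * ennreal (fibre_norm ip x (gradient \<phi> x) powr p) \<partial>N) =
        (\<integral>\<^sup>+x. ennreal (?c powr p) * ennreal (fibre_norm ip x (gradient \<phi> x) powr p) \<partial>completion N)"
      by (simp add: nn_integral_completion)
    also have "\<dots> = ennreal (?c powr p) * ennreal (energy \<phi>)"
      by (subst nn_integral_cmult) (auto simp: nn_integral_completion energy_nn[OF \<phi>N])
    finally show ?thesis
      using C energy_nonneg[of \<phi>] by (simp add: ennreal_mult mult_left_mono mult.assoc)
  qed
  then show ?thesis using C by (intro exI[of _ "C * ?c powr p"]) auto
qed

lemma newtonian0_diff:
  assumes "\<phi> \<in> newtonian0 p M \<Omega>" "\<psi> \<in> newtonian0 p M \<Omega>"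
  shows "(\<lambda>x. \<phi> x - \<psi> x) \<in> newtonian0 p M \<Omega>"
proof -
  obtain v w where v: "v \<in> newtonian p M" "\<forall>x. x \<notin> \<Omega> \<longrightarrow> v x = 0" "\<forall>x\<in>\<Omega>. \<phi> x = v x"
    and w: "w \<in> newtonian p M" "\<forall>x. x \<notin> \<Omega> \<longrightarrow> w x = 0" "\<forall>x\<in>\<Omega>. \<psi> x = w x"
    using assms by (auto simp: newtonian0_def)
  then show ?thesis
    using newtonian_diff[OF p_pos borel_on_M v(1) w(1)]
    by (auto simp: newtonian0_def intro!: bexI[of _ "\<lambda>x. v x - w x"])
qed

section \<open>Stability of solutions\<close>

text \<open>
  Both equations are tested with the difference of the solutions minus the difference of the boundary
  data, which vanishes on the boundary. Its gradient is the difference of the gradients of the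
  solutions up to the gradient of the difference of the boundary data, so the left-hand sides give the
  monotonicity expression and small terms. All products are estimated by Young's inequality with small
  weights on the energies of the solutions.
\<close>
lemma stability_estimate:
  assumes q: "q = p / (p - 1)" and \<eta>: "0 < \<eta>"
  shows "\<exists>K\<ge>0. \<forall>f1 g1 u1 f2 g2 u2.
    poisson_solution p M \<Omega> ip G f1 g1 u1 \<longrightarrow> poisson_solution p M \<Omega> ip G f2 g2 u2 \<longrightarrow>
    f1 \<in> Lp q N \<longrightarrow> f2 \<in> Lp q N \<longrightarrow> g1 \<in> newtonian p N \<longrightarrow> g2 \<in> newtonian p N \<longrightarrow>
    energy (\<lambda>x. u1 x - u2 x) \<le>
      \<eta> * (energy (\<lambda>x. u1 x - u2 x) + energy u2 + energy (\<lambda>x. g1 x - g2 x)) +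
      K * (energy (\<lambda>x. g1 x - g2 x) + (LINT x|completion N. \<bar>f1 x - f2 x\<bar> powr q))"
proof -
  note p = p_gt_1 and p0 = p_pos
  have q0: "0 < q" using q p by simp
  let ?c = "2 powr p :: real"
  have c1: "1 \<le> ?c" using p0 by (intro ge_one_powr_ge_zero) auto
  obtain F where F0: "F \<ge> 0" and F: "\<And>\<phi>. \<phi> \<in> newtonian0 p M \<Omega> \<Longrightarrow>
    (\<integral>\<^sup>+x. ennreal (\<bar>\<phi> x\<bar> powr p) \<partial>N) \<le> ennreal (F * energy \<phi>)"
    using Friedrichs_energy by blast
  \<comment> \<open>\<open>\<epsilon>\<close> is the error in the monotonicity inequality and \<open>\<delta>\<close> the weight in Young's inequality; once
    all energies are expressed by those of the difference, of \<open>u2\<close> and of the difference of the boundary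
    data, the terms with \<open>\<epsilon>\<close> and those with \<open>\<delta>\<close> have a coefficient of at most \<open>\<eta> / 2\<close>\<close>
  define \<epsilon> where "\<epsilon> = \<eta> / (4 * ?c)"
  have \<epsilon>: "0 < \<epsilon>" using \<eta> c1 by (simp add: \<epsilon>_def)
  obtain C where C0: "C \<ge> 0" and C: "\<And>(b :: real^'n \<Rightarrow> real^'n \<Rightarrow> real) v w. is_inner_product b \<Longrightarrow>
    ip_norm b (v - w) powr p \<le> \<epsilon> * (ip_norm b v powr p + ip_norm b w powr p) +
      C * (flux_pairing b p v (v - w) - flux_pairing b p w (v - w))"
    using flux_monotone[OF p \<epsilon>, where 'n = 'n] by blast
  define \<delta> where "\<delta> = \<eta> / (2 * ?c * (F + 2) * (C + 1))"
  have \<delta>: "0 < \<delta>" using \<eta> c1 F0 C0 by (simp add: \<delta>_def)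
  define C1 where "C1 = \<delta> powr (1 - q)"
  define C2 where "C2 = \<delta> powr (1 - p)"
  have C12: "0 \<le> C1" "0 \<le> C2" by (auto simp: C1_def C2_def)
  have small: "\<epsilon> * (?c * Y + ?c * B + B) + C * (\<delta> * (F * (?c * (Y + E))) + \<delta> * (?c * Y + ?c * B + B)) \<le> \<eta> * (Y + B + E)"
    if "0 \<le> Y" "0 \<le> B" "0 \<le> E" for Y B E
  proof -
    have BcB: "B \<le> ?c * B" using mult_right_mono[OF c1 that(2)] by simp
    have "0 \<le> ?c * Y" "0 \<le> ?c * E" using that by simp_all
    moreover have "2 * ?c * (Y + B + E) = 2 * (?c * Y) + 2 * (?c * B) + 2 * (?c * E)"
      by (simp add: algebra_simps)
    ultimately have 1: "?c * Y + ?c * B + B \<le> 2 * ?c * (Y + B + E)" using BcB by linarith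
    have 2: "F * (?c * (Y + E)) \<le> F * (?c * (Y + B + E))" using that F0 c1 by (intro mult_left_mono) auto
    have "\<epsilon> * (?c * Y + ?c * B + B) \<le> \<epsilon> * (2 * ?c * (Y + B + E))" using \<epsilon> 1 by (intro mult_left_mono) auto
    also have "\<dots> = \<eta> / 2 * (Y + B + E)" using c1 by (simp add: \<epsilon>_def)
    finally have I: "\<epsilon> * (?c * Y + ?c * B + B) \<le> \<eta> / 2 * (Y + B + E)" .
    have "C * (\<delta> * (F * (?c * (Y + E))) + \<delta> * (?c * Y + ?c * B + B)) \<le>
        C * (\<delta> * (F * (?c * (Y + B + E))) + \<delta> * (2 * ?c * (Y + B + E)))"
      using 1 2 \<delta> C0 F0 that by (intro mult_left_mono add_mono) auto
    also have "\<dots> = C * (\<delta> * ?c * (F + 2)) * (Y + B + E)" by (simp add: algebra_simps)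
    also have "\<dots> \<le> (C + 1) * (\<delta> * ?c * (F + 2)) * (Y + B + E)"
      using that \<delta> F0 c1 by (intro mult_right_mono) auto
    also have "(C + 1) * (\<delta> * ?c * (F + 2)) = \<eta> / 2"
    proof -
      define Z where "Z = ?c * (F + 2) * (C + 1)"
      have "0 < Z" using F0 C0 c1 by (simp add: Z_def)
      moreover have "\<delta> = \<eta> / (2 * Z)" by (simp add: \<delta>_def Z_def mult.assoc)
      ultimately have "\<delta> * Z = \<eta> / 2" by simp
      then show ?thesis by (simp add: Z_def mult.commute mult.left_commute)
    qed
    finally show ?thesis using I by (simp add: algebra_simps)
  qed
  show ?thesis
  proof (intro exI[of _ "C * (C1 + 2 * C2)"] conjI allI impI)
    show "0 \<le> C * (C1 + 2 * C2)" using C0 C12 by simp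
    fix f1 g1 u1 f2 g2 u2
    assume s1: "poisson_solution p M \<Omega> ip G f1 g1 u1" and s2: "poisson_solution p M \<Omega> ip G f2 g2 u2"
      and f: "f1 \<in> Lp q N" "f2 \<in> Lp q N" and g: "g1 \<in> newtonian p N" "g2 \<in> newtonian p N"
    have u: "u1 \<in> newtonian p N" "u2 \<in> newtonian p N" using s1 s2 by (auto simp: poisson_solution_def)
    define d where "d = (\<lambda>x. g1 x - g2 x)"
    define z where "z = (\<lambda>x. u1 x - u2 x)"
    define \<phi> where "\<phi> = (\<lambda>x. z x - d x)"
    have dN: "d \<in> newtonian p N" and zN: "z \<in> newtonian p N"
      unfolding d_def z_def by (intro newtonian_diff p0 borel_on_N g u)+
    have \<phi>0: "\<phi> \<in> newtonian0 p M \<Omega>"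
    proof -
      have "(\<lambda>x. (u1 x - g1 x) - (u2 x - g2 x)) \<in> newtonian0 p M \<Omega>"
        by (rule newtonian0_diff) (use s1 s2 in \<open>auto simp: poisson_solution_def\<close>)
      moreover have "(\<lambda>x. (u1 x - g1 x) - (u2 x - g2 x)) = \<phi>" by (auto simp: \<phi>_def z_def d_def)
      ultimately show ?thesis by simp
    qed
    note \<phi>N = newtonian0_newtonian[OF \<phi>0]
    let ?N = "completion N"
    let ?n = "\<lambda>v x. fibre_norm ip x (gradient v x)"
    let ?P = "\<lambda>v w x. flux_pairing (ip x) p (gradient v x) (gradient w x)"
    note gm [measurable] = gradient_measurable[OF u(1)] gradient_measurable[OF u(2)] gradient_measurable[OF dN]
      gradient_measurable[OF zN] gradient_measurable[OF \<phi>N]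
    have P_eq: "?P v w = (\<lambda>x. fibre_norm ip x (gradient v x) powr (p - 2) * ip x (gradient v x) (gradient w x))" for v w
      by (simp add: flux_pairing_def fibre_norm_eq)
    have Pm [measurable]: "?P v w \<in> borel_measurable ?N" if "v \<in> newtonian p N" "w \<in> newtonian p N" for v w
    proof -
      note [measurable] = gradient_measurable[OF that(1)] gradient_measurable[OF that(2)]
      show ?thesis unfolding P_eq by measurable
    qed
    have ipN: "AE x in ?N. is_inner_product (ip x)" by (rule AE_completion[OF ip_AE_N])
    have n_int: "integrable ?N (\<lambda>x. ?n v x powr p)" if "v \<in> newtonian p N" for v
      by (rule gradient_integrable[OF that])
    have P_int: "integrable ?N (?P v w)" if vw: "v \<in> newtonian p N" "w \<in> newtonian p N" for v w
    proof (rule Bochner_Integration.integrable_bound)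
      show "integrable ?N (\<lambda>x. 1 * ?n v x powr p + 1 powr (1 - p) * ?n w x powr p)"
        by (intro Bochner_Integration.integrable_add integrable_mult_right n_int vw)
      show "AE x in ?N. norm (?P v w x) \<le> norm (1 * ?n v x powr p + 1 powr (1 - p) * ?n w x powr p)"
        using ipN
      proof eventually_elim
        case (elim x)
        have "\<bar>?P v w x\<bar> \<le> ?n v x powr (p - 1) * ?n w x"
          using flux_pairing_le[OF elim] by (simp add: fibre_norm_eq)
        also have "\<dots> \<le> 1 * ?n v x powr p + 1 powr (1 - p) * ?n w x powr p"
          by (rule Young_powr_le[OF p]) (auto simp: fibre_norm_eq ip_norm_properties[OF elim])
        finally show ?case by simp
      qed
    qed (rule Pm[OF vw])
    have fm [measurable]: "f1 \<in> borel_measurable ?N" "f2 \<in> borel_measurable ?N"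
      using f by (simp_all add: Lp_iff[OF q0])
    have \<phi>m [measurable]: "\<phi> \<in> borel_measurable ?N" and \<phi>fin: "(\<integral>\<^sup>+x. ennreal (\<bar>\<phi> x\<bar> powr p) \<partial>N) < \<infinity>"
      using \<phi>N by (simp_all add: newtonian_iff[OF p0])
    have \<phi>_int: "integrable ?N (\<lambda>x. \<bar>\<phi> x\<bar> powr p)" using \<phi>fin by (simp add: integrable_powr_iff)
    have f_int: "integrable ?N (\<lambda>x. \<bar>f1 x\<bar> powr q)" "integrable ?N (\<lambda>x. \<bar>f2 x\<bar> powr q)"
      using f by (simp_all add: integrable_powr_iff Lp_iff[OF q0])
    have fd_int: "integrable ?N (\<lambda>x. \<bar>f1 x - f2 x\<bar> powr q)"
    proof (rule Bochner_Integration.integrable_bound)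
      show "integrable ?N (\<lambda>x. 2 powr q * (\<bar>f1 x\<bar> powr q + \<bar>f2 x\<bar> powr q))"
        by (intro integrable_mult_right Bochner_Integration.integrable_add f_int)
      show "AE x in ?N. norm (\<bar>f1 x - f2 x\<bar> powr q) \<le> norm (2 powr q * (\<bar>f1 x\<bar> powr q + \<bar>f2 x\<bar> powr q))"
      proof (rule AE_I2)
        fix x
        have "\<bar>f1 x - f2 x\<bar> powr q \<le> (\<bar>f1 x\<bar> + \<bar>f2 x\<bar>) powr q" using q0 by (intro powr_mono2) auto
        also have "\<dots> \<le> 2 powr q * (\<bar>f1 x\<bar> powr q + \<bar>f2 x\<bar> powr q)" using q0 by (intro powr_add_le) auto
        finally show "norm (\<bar>f1 x - f2 x\<bar> powr q) \<le> norm (2 powr q * (\<bar>f1 x\<bar> powr q + \<bar>f2 x\<bar> powr q))" by simp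
      qed
    qed measurable
    have f\<phi>_int: "integrable ?N (\<lambda>x. h x * \<phi> x)" if [measurable]: "h \<in> borel_measurable ?N"
      and h: "integrable ?N (\<lambda>x. \<bar>h x\<bar> powr q)" for h
    proof (rule Bochner_Integration.integrable_bound)
      show "integrable ?N (\<lambda>x. 1 * \<bar>\<phi> x\<bar> powr p + 1 powr (1 - q) * \<bar>h x\<bar> powr q)"
        by (intro Bochner_Integration.integrable_add integrable_mult_right \<phi>_int h)
      show "AE x in ?N. norm (h x * \<phi> x) \<le> norm (1 * \<bar>\<phi> x\<bar> powr p + 1 powr (1 - q) * \<bar>h x\<bar> powr q)"
        using Young_conjugate_powr_le[OF p q, of 1] by (intro AE_I2) (simp add: abs_mult)
    qed measurable
    have test1: "(LINT x|?N. ?P u1 \<phi> x) = (LINT x|?N. f1 x * \<phi> x)"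
      and test2: "(LINT x|?N. ?P u2 \<phi> x) = (LINT x|?N. f2 x * \<phi> x)"
      using s1 s2 \<phi>0 unfolding P_eq poisson_solution_def by blast+
    define Y where "Y = energy z"
    define B where "B = energy u2"
    define E where "E = energy d"
    define A where "A = energy u1"
    define \<Phi> where "\<Phi> = (LINT x|?N. \<bar>f1 x - f2 x\<bar> powr q)"
    define W where "W = (LINT x|?N. \<bar>\<phi> x\<bar> powr p)"
    have nn: "0 \<le> Y" "0 \<le> B" "0 \<le> E" by (simp_all add: Y_def B_def E_def energy_nonneg)
    have grads: "AE x in ?N. gradient z x = gradient u1 x - gradient u2 x \<and> gradient \<phi> x = gradient z x - gradient d x"
      unfolding AE_completion_iff
      using gradient_diff[OF u] gradient_diff[OF zN dN] by (auto simp: z_def[symmetric] \<phi>_def[symmetric] elim: eventually_elim2)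
    have A_le: "A \<le> ?c * (Y + B)"
      unfolding A_def Y_def B_def z_def by (rule energy_triangle[OF u])
    have W_le: "W \<le> F * (?c * (Y + E))"
    proof -
      have "ennreal W = (\<integral>\<^sup>+x. ennreal (\<bar>\<phi> x\<bar> powr p) \<partial>N)"
        unfolding W_def using nn_integral_eq_integral[OF \<phi>_int] by (simp add: nn_integral_completion)
      also have "\<dots> \<le> ennreal (F * energy \<phi>)" by (rule F[OF \<phi>0])
      finally have "W \<le> F * energy \<phi>" using F0 energy_nonneg[of \<phi>] by (simp add: ennreal_le_iff)
      also have "\<dots> \<le> F * (?c * (Y + E))"
        unfolding \<phi>_def Y_def E_def using F0 by (intro mult_left_mono energy_diff_le zN dN)
      finally show ?thesis .
    qed
    have f\<phi>_le: "(LINT x|?N. (f1 x - f2 x) * \<phi> x) \<le> \<delta> * W + C1 * \<Phi>"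
    proof -
      have "(LINT x|?N. (f1 x - f2 x) * \<phi> x) \<le> (LINT x|?N. \<delta> * \<bar>\<phi> x\<bar> powr p + C1 * \<bar>f1 x - f2 x\<bar> powr q)"
      proof (rule integral_mono)
        show "integrable ?N (\<lambda>x. (f1 x - f2 x) * \<phi> x)" by (rule f\<phi>_int[OF _ fd_int]) measurable
        show "integrable ?N (\<lambda>x. \<delta> * \<bar>\<phi> x\<bar> powr p + C1 * \<bar>f1 x - f2 x\<bar> powr q)"
          by (intro Bochner_Integration.integrable_add integrable_mult_right \<phi>_int fd_int)
        fix x
        have "(f1 x - f2 x) * \<phi> x \<le> \<bar>f1 x - f2 x\<bar> * \<bar>\<phi> x\<bar>" by (metis abs_ge_self abs_mult)
        also have "\<dots> \<le> \<delta> * \<bar>\<phi> x\<bar> powr p + C1 * \<bar>f1 x - f2 x\<bar> powr q"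
          unfolding C1_def by (rule Young_conjugate_powr_le[OF p q \<delta>]) auto
        finally show "(f1 x - f2 x) * \<phi> x \<le> \<delta> * \<bar>\<phi> x\<bar> powr p + C1 * \<bar>f1 x - f2 x\<bar> powr q" .
      qed
      also have "\<dots> = \<delta> * W + C1 * \<Phi>" using \<phi>_int fd_int by (simp add: W_def \<Phi>_def)
      finally show ?thesis .
    qed
    have diff: "(LINT x|?N. ?P u1 \<phi> x - ?P u2 \<phi> x) = (LINT x|?N. (f1 x - f2 x) * \<phi> x)"
      using P_int[OF u(1) \<phi>N] P_int[OF u(2) \<phi>N] f\<phi>_int[OF fm(1) f_int(1)] f\<phi>_int[OF fm(2) f_int(2)] test1 test2
      by (simp add: left_diff_distrib)
    let ?R = "\<lambda>x. \<epsilon> * (?n u1 x powr p + ?n u2 x powr p) +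
        C * ((?P u1 \<phi> x - ?P u2 \<phi> x) + (\<delta> * (?n u1 x powr p + ?n u2 x powr p) + 2 * C2 * ?n d x powr p))"
    have R_int: "integrable ?N ?R"
      by (intro Bochner_Integration.integrable_add Bochner_Integration.integrable_diff integrable_mult_right n_int P_int u \<phi>N dN)
    have "Y \<le> (LINT x|?N. ?R x)"
      unfolding Y_def energy_def
    proof (rule integral_mono_AE[OF n_int[OF zN] R_int])
      from ipN grads show "AE x in ?N. ?n z x powr p \<le> ?R x"
      proof eventually_elim
        case (elim x)
        note b = elim(1)
        have young: "\<bar>?P v d x\<bar> \<le> \<delta> * ?n v x powr p + C2 * ?n d x powr p" for v
        proof -
          have "\<bar>?P v d x\<bar> \<le> ?n v x powr (p - 1) * ?n d x"
            using flux_pairing_le[OF b] by (simp add: fibre_norm_eq)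
          also have "\<dots> \<le> \<delta> * ?n v x powr p + C2 * ?n d x powr p"
            unfolding C2_def by (rule Young_powr_le[OF p \<delta>]) (auto simp: fibre_norm_eq ip_norm_properties[OF b])
          finally show ?thesis .
        qed
        have P\<phi>: "?P v z x = ?P v \<phi> x + ?P v d x" for v
          using elim(2) by (simp add: flux_pairing_diff[OF b])
        have "?n z x powr p \<le> \<epsilon> * (?n u1 x powr p + ?n u2 x powr p) + C * (?P u1 z x - ?P u2 z x)"
          using C[OF b, of "gradient u1 x" "gradient u2 x"] elim(2) by (simp add: fibre_norm_eq)
        also have "\<dots> \<le> ?R x"
          unfolding P\<phi> using young[of u1] young[of u2] C0
          by (intro add_left_mono mult_left_mono) (auto simp: algebra_simps abs_le_iff)
        finally show ?case .
      qed
    qed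
    also have "(LINT x|?N. ?R x) = \<epsilon> * (A + B) + C * ((LINT x|?N. (f1 x - f2 x) * \<phi> x) + (\<delta> * (A + B) + 2 * C2 * E))"
      unfolding diff[symmetric]
      using n_int[OF u(1)] n_int[OF u(2)] n_int[OF dN] P_int[OF u(1) \<phi>N] P_int[OF u(2) \<phi>N]
      by (simp add: A_def B_def E_def energy_def)
    also have "\<dots> \<le> \<epsilon> * (?c * Y + ?c * B + B) +
        C * ((\<delta> * (F * (?c * (Y + E))) + C1 * \<Phi>) + (\<delta> * (?c * Y + ?c * B + B) + 2 * C2 * E))"
    proof -
      have AB: "A + B \<le> ?c * Y + ?c * B + B" using A_le by (simp add: algebra_simps)
      have "\<delta> * W \<le> \<delta> * (F * (?c * (Y + E)))" using W_le \<delta> by (intro mult_left_mono) auto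
      then have L: "(LINT x|?N. (f1 x - f2 x) * \<phi> x) \<le> \<delta> * (F * (?c * (Y + E))) + C1 * \<Phi>"
        using f\<phi>_le by linarith
      show ?thesis
        using AB L \<epsilon> \<delta> C0 C12 nn by (intro add_mono mult_left_mono) auto
    qed
    also have "\<dots> \<le> \<eta> * (Y + B + E) + C * (C1 + 2 * C2) * (E + \<Phi>)"
    proof -
      have \<Phi>0: "0 \<le> \<Phi>" unfolding \<Phi>_def by (intro integral_nonneg_AE) simp
      have "C * (C1 * \<Phi> + 2 * C2 * E) \<le> C * ((C1 + 2 * C2) * (E + \<Phi>))"
        using C0 C12 nn \<Phi>0 by (intro mult_left_mono) (auto simp: algebra_simps)
      then show ?thesis using small[OF nn] by (simp add: algebra_simps)
    qed
    finally show "energy (\<lambda>x. u1 x - u2 x) \<le>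
      \<eta> * (energy (\<lambda>x. u1 x - u2 x) + energy u2 + energy (\<lambda>x. g1 x - g2 x)) +
      C * (C1 + 2 * C2) * (energy (\<lambda>x. g1 x - g2 x) + (LINT x|completion N. \<bar>f1 x - f2 x\<bar> powr q))"
      by (simp add: Y_def B_def E_def \<Phi>_def z_def d_def)
  qed
qed

end

section \<open>Convergence of the solutions\<close>

lemma tendsto_ennpowr_zero:
  assumes "0 < r" "(f \<longlongrightarrow> 0) F"
  shows "((\<lambda>k. ennpowr (f k) r) \<longlongrightarrow> 0) F"
proof (rule order_tendstoI)
  fix a :: ennreal assume a: "0 < a"
  then have "0 < ennpowr a (1 / r)" by (simp add: zero_less_iff_neq_zero)
  then have "eventually (\<lambda>k. f k < ennpowr a (1 / r)) F" using assms(2) by (rule order_tendstoD(2)[rotated])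
  then show "eventually (\<lambda>k. ennpowr (f k) r < a) F"
  proof eventually_elim
    case (elim k)
    show ?case
    proof (rule ccontr)
      assume "\<not> ennpowr (f k) r < a"
      then have "ennpowr a (1 / r) \<le> ennpowr (ennpowr (f k) r) (1 / r)"
        using assms(1) by (intro ennpowr_mono[of "1 / r"]) auto
      then show False using elim by (simp add: ennpowr_ennpowr_inverse(2)[OF assms(1)])
    qed
  qed
qed simp

lemma newtonian_norm_eq:
  assumes "0 < p" "borel_on N" "u \<in> newtonian p N"
  shows "newtonian_norm p N u = ennpowr ((\<integral>\<^sup>+x. ennreal (\<bar>u x\<bar> powr p) \<partial>N) +
    (\<integral>\<^sup>+x. ennpowr (min_upper_gradient p N u x) p \<partial>N)) (1 / p)"
proof -
  have u: "u \<in> borel_measurable (completion N)" "p_weakly_differentiable p N u"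
    using assms(3) by (simp_all add: newtonian_iff[OF assms(1)])
  have "min_upper_gradient p N u \<in> borel_measurable (completion N)"
    using min_upper_gradient(2)[OF assms(1,2) u(2)] by (intro measurable_completion) (simp add: p_integrable_def)
  then show ?thesis
    using u(1) unfolding newtonian_norm_def by (subst nn_integral_add) (auto simp: nn_integral_completion)
qed

context cheeger_domain
begin

lemma newtonian_norm_tendstoD:
  assumes u: "eventually (\<lambda>k. u k \<in> newtonian p N) sequentially"
    and lim: "(\<lambda>k. newtonian_norm p N (u k)) \<longlonglongrightarrow> 0"
  shows "(\<lambda>k. \<integral>\<^sup>+x. ennreal (\<bar>u k x\<bar> powr p) \<partial>N) \<longlonglongrightarrow> 0" "(\<lambda>k. energy (u k)) \<longlonglongrightarrow> 0"
proof -
  let ?X = "\<lambda>k. ennpowr (newtonian_norm p N (u k)) p"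
  have X: "?X \<longlonglongrightarrow> 0" by (rule tendsto_ennpowr_zero[OF p_pos lim])
  have eq: "eventually (\<lambda>k. (\<integral>\<^sup>+x. ennreal (\<bar>u k x\<bar> powr p) \<partial>N) \<le> ?X k \<and> ennreal (energy (u k)) \<le> ?X k) sequentially"
    using u
  proof eventually_elim
    case (elim k)
    have "?X k = (\<integral>\<^sup>+x. ennreal (\<bar>u k x\<bar> powr p) \<partial>N) + (\<integral>\<^sup>+x. ennpowr (min_upper_gradient p N (u k) x) p \<partial>N)"
      by (simp add: newtonian_norm_eq[OF p_pos borel_on_N elim] ennpowr_ennpowr_inverse(1)[OF p_pos])
    moreover have "ennreal (energy (u k)) \<le> (\<integral>\<^sup>+x. ennpowr (min_upper_gradient p N (u k) x) p \<partial>N)"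
      using gradient_nn_le[OF elim] by (simp add: energy_nn[OF elim])
    ultimately show ?case by (simp add: add_increasing add_increasing2)
  qed
  show "(\<lambda>k. \<integral>\<^sup>+x. ennreal (\<bar>u k x\<bar> powr p) \<partial>N) \<longlonglongrightarrow> 0"
    by (rule tendsto_sandwich[OF _ _ tendsto_const X]) (use eq in \<open>auto elim: eventually_mono\<close>)
  have "(\<lambda>k. ennreal (energy (u k))) \<longlonglongrightarrow> ennreal 0"
    unfolding ennreal_0 by (rule tendsto_sandwich[OF _ _ tendsto_const X]) (use eq in \<open>auto elim: eventually_mono\<close>)
  then show "(\<lambda>k. energy (u k)) \<longlonglongrightarrow> 0"
    using energy_nonneg by (subst (asm) tendsto_ennreal_iff) auto
qed

text \<open>For \<open>\<eta> \<le> 1/2\<close> the energy of the difference on the right-hand side of the stability estimate is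
  absorbed, and the remaining limit is at most \<open>2\<eta>\<close> times the energy of \<open>u\<close>.\<close>
lemma solutions_converge:
  assumes q: "q = p / (p - 1)"
    and fs: "\<And>k. k \<ge> 1 \<Longrightarrow> fs k \<in> Lp q N" and f: "f \<in> Lp q N"
    and f_lim: "(\<lambda>k. Lp_norm q N (\<lambda>x. fs k x - f x)) \<longlonglongrightarrow> 0"
    and gs: "\<And>k. k \<ge> 1 \<Longrightarrow> gs k \<in> newtonian p N" and g: "g \<in> newtonian p N"
    and g_lim: "(\<lambda>k. newtonian_norm p N (\<lambda>x. gs k x - g x)) \<longlonglongrightarrow> 0"
    and us: "\<And>k. k \<ge> 1 \<Longrightarrow> poisson_solution p M \<Omega> ip G (fs k) (gs k) (us k)"
    and u: "poisson_solution p M \<Omega> ip G f g u"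
  shows "(\<lambda>k. newtonian_norm p N (\<lambda>x. us k x - u x)) \<longlonglongrightarrow> 0"
proof -
  have q0: "0 < q" using q p_gt_1 by simp
  let ?d = "\<lambda>k x. gs k x - g x" and ?z = "\<lambda>k x. us k x - u x"
  define Y where "Y k = energy (?z k)" for k
  define E where "E k = energy (?d k)" for k
  define B where "B = energy u"
  define \<Phi> where "\<Phi> k = (LINT x|completion N. \<bar>fs k x - f x\<bar> powr q)" for k
  have usN: "us k \<in> newtonian p N" if "k \<ge> 1" for k
    using us[OF that] by (simp add: poisson_solution_def)
  have uN: "u \<in> newtonian p N" using u by (simp add: poisson_solution_def)
  have dN: "?d k \<in> newtonian p N" and zN: "?z k \<in> newtonian p N" if "k \<ge> 1" for k
    by (intro newtonian_diff p_pos borel_on_N gs g usN uN that)+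
  have ev1: "eventually (\<lambda>k::nat. k \<ge> 1) sequentially" by (rule eventually_ge_at_top)
  have evd: "eventually (\<lambda>k. ?d k \<in> newtonian p N) sequentially"
    using ev1 by eventually_elim (rule dN)
  have dlim: "(\<lambda>k. \<integral>\<^sup>+x. ennreal (\<bar>?d k x\<bar> powr p) \<partial>N) \<longlonglongrightarrow> 0" and Elim: "E \<longlonglongrightarrow> 0"
    unfolding E_def by (rule newtonian_norm_tendstoD[OF evd g_lim])+
  have \<Phi>lim: "\<Phi> \<longlonglongrightarrow> 0"
  proof -
    have "(\<lambda>k. ennpowr (Lp_norm q N (\<lambda>x. fs k x - f x)) q) \<longlonglongrightarrow> ennreal 0"
      unfolding ennreal_0 by (rule tendsto_ennpowr_zero[OF q0 f_lim])
    then have "(\<lambda>k. enn2real (ennpowr (Lp_norm q N (\<lambda>x. fs k x - f x)) q)) \<longlonglongrightarrow> 0"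
      by (rule tendsto_enn2real) simp
    moreover have "eventually (\<lambda>k. enn2real (ennpowr (Lp_norm q N (\<lambda>x. fs k x - f x)) q) = \<Phi> k) sequentially"
      using ev1
    proof eventually_elim
      case (elim k)
      have [measurable]: "fs k \<in> borel_measurable (completion N)" "f \<in> borel_measurable (completion N)"
        using fs[OF elim] f by (simp_all add: Lp_iff[OF q0])
      have "\<Phi> k = enn2real (\<integral>\<^sup>+x. ennreal (\<bar>fs k x - f x\<bar> powr q) \<partial>completion N)"
        unfolding \<Phi>_def by (rule integral_eq_nn_integral) auto
      then show ?case by (simp add: Lp_norm_def ennpowr_ennpowr_inverse(1)[OF q0])
    qed
    ultimately show ?thesis by (rule Lim_transform_eventually)
  qed
  have nn: "0 \<le> Y k" "0 \<le> E k" "0 \<le> B" for k by (simp_all add: Y_def E_def B_def energy_nonneg)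
  have Ylim: "Y \<longlonglongrightarrow> 0"
  proof (rule order_tendstoI)
    fix e :: real assume e: "0 < e"
    \<comment> \<open>the first bound allows absorbing, the second makes \<open>2\<eta>B\<close> smaller than \<open>e\<close>\<close>
    define \<eta> where "\<eta> = min (1 / 2) (e / (4 * (B + 1)))"
    have "0 < \<eta>" using e nn(3) by (simp add: \<eta>_def)
    moreover have "\<eta> \<le> 1 / 2" unfolding \<eta>_def by (rule min.cobounded1)
    moreover have "\<eta> \<le> e / (4 * (B + 1))" unfolding \<eta>_def by (rule min.cobounded2)
    ultimately have \<eta>: "0 < \<eta>" "\<eta> \<le> 1 / 2" "\<eta> \<le> e / (4 * (B + 1))" by auto
    have \<eta>B: "2 * \<eta> * B < e"
    proof -
      have "2 * \<eta> * B \<le> 2 * (e / (4 * (B + 1))) * (B + 1)"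
        using nn e \<eta> by (intro mult_mono) auto
      also have "\<dots> = e / 2" using nn(3) by (simp add: field_simps)
      finally show ?thesis using e by simp
    qed
    from stability_estimate[OF q \<eta>(1)]
    obtain K where est: "\<forall>f1 g1 u1 f2 g2 u2.
      poisson_solution p M \<Omega> ip G f1 g1 u1 \<longrightarrow> poisson_solution p M \<Omega> ip G f2 g2 u2 \<longrightarrow>
      f1 \<in> Lp q N \<longrightarrow> f2 \<in> Lp q N \<longrightarrow> g1 \<in> newtonian p N \<longrightarrow> g2 \<in> newtonian p N \<longrightarrow>
      energy (\<lambda>x. u1 x - u2 x) \<le>
        \<eta> * (energy (\<lambda>x. u1 x - u2 x) + energy u2 + energy (\<lambda>x. g1 x - g2 x)) +
        K * (energy (\<lambda>x. g1 x - g2 x) + (LINT x|completion N. \<bar>f1 x - f2 x\<bar> powr q))"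
      by (elim exE conjE)
    have K: "Y k \<le> \<eta> * (Y k + B + E k) + K * (E k + \<Phi> k)" if "k \<ge> 1" for k
      using est[rule_format, OF us[OF that] u fs[OF that] f gs[OF that] g]
      by (simp add: Y_def B_def E_def \<Phi>_def)
    have "(\<lambda>k. 2 * \<eta> * B + 2 * \<eta> * E k + 2 * K * (E k + \<Phi> k)) \<longlonglongrightarrow> 2 * \<eta> * B + 2 * \<eta> * 0 + 2 * K * (0 + 0)"
      by (intro tendsto_intros Elim \<Phi>lim)
    then have "eventually (\<lambda>k. 2 * \<eta> * B + 2 * \<eta> * E k + 2 * K * (E k + \<Phi> k) < e) sequentially"
      using \<eta>B by (intro order_tendstoD(2)) auto
    then show "eventually (\<lambda>k. Y k < e) sequentially"
      using ev1
    proof eventually_elim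
      case (elim k)
      have "\<eta> * Y k \<le> 1 / 2 * Y k" using \<eta> nn by (intro mult_right_mono) auto
      then have "Y k \<le> 2 * \<eta> * B + 2 * \<eta> * E k + 2 * K * (E k + \<Phi> k)"
        using K[OF elim(2)] by (simp add: algebra_simps)
      then show ?case using elim(1) by simp
    qed
  next
    fix a :: real assume "a < 0"
    then show "eventually (\<lambda>k. a < Y k) sequentially" using nn(1) by (auto intro: always_eventually less_le_trans)
  qed
  obtain F where F0: "F \<ge> 0" and F: "\<And>\<phi>. \<phi> \<in> newtonian0 p M \<Omega> \<Longrightarrow>
    (\<integral>\<^sup>+x. ennreal (\<bar>\<phi> x\<bar> powr p) \<partial>N) \<le> ennreal (F * energy \<phi>)"
    using Friedrichs_energy by blast
  let ?c = "2 powr p :: real" and ?s = "sqrt (real CARD('n)) powr p"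
  have bound: "(\<integral>\<^sup>+x. ennreal (\<bar>?z k x\<bar> powr p) \<partial>N) + (\<integral>\<^sup>+x. ennpowr (min_upper_gradient p N (?z k) x) p \<partial>N) \<le>
      ennreal ?c * (ennreal (F * (?c * (Y k + E k))) + (\<integral>\<^sup>+x. ennreal (\<bar>?d k x\<bar> powr p) \<partial>N)) + ennreal (?s * Y k)"
    if k: "k \<ge> 1" for k
  proof -
    let ?\<phi> = "\<lambda>x. ?z k x - ?d k x"
    have "(\<lambda>x. (us k x - gs k x) - (u x - g x)) \<in> newtonian0 p M \<Omega>"
      by (rule newtonian0_diff) (use us[OF k] u in \<open>auto simp: poisson_solution_def\<close>)
    moreover have "(\<lambda>x. (us k x - gs k x) - (u x - g x)) = ?\<phi>" by auto
    ultimately have \<phi>: "?\<phi> \<in> newtonian0 p M \<Omega>" by simp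
    have [measurable]: "?\<phi> \<in> borel_measurable (completion N)" "?d k \<in> borel_measurable (completion N)"
      using newtonian0_newtonian[OF \<phi>] dN[OF k] by (simp_all add: newtonian_iff[OF p_pos])
    have "(\<integral>\<^sup>+x. ennreal (\<bar>?\<phi> x + ?d k x\<bar> powr p) \<partial>N) \<le>
        ennreal ?c * ((\<integral>\<^sup>+x. ennreal (\<bar>?\<phi> x\<bar> powr p) \<partial>N) + (\<integral>\<^sup>+x. ennreal (\<bar>?d k x\<bar> powr p) \<partial>N))"
      by (rule nn_integral_powr_add_le[OF p_pos]) measurable
    also have "(\<integral>\<^sup>+x. ennreal (\<bar>?\<phi> x\<bar> powr p) \<partial>N) \<le> ennreal (F * (?c * (Y k + E k)))"
    proof -
      have "energy ?\<phi> \<le> ?c * (Y k + E k)"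
        unfolding Y_def E_def by (rule energy_diff_le[OF zN[OF k] dN[OF k]])
      then show ?thesis using F[OF \<phi>] F0 by (auto intro: order.trans ennreal_leI mult_left_mono)
    qed
    finally have 1: "(\<integral>\<^sup>+x. ennreal (\<bar>?z k x\<bar> powr p) \<partial>N) \<le>
      ennreal ?c * (ennreal (F * (?c * (Y k + E k))) + (\<integral>\<^sup>+x. ennreal (\<bar>?d k x\<bar> powr p) \<partial>N))"
      by (simp add: mult_left_mono add_right_mono)
    have "(\<integral>\<^sup>+x. ennpowr (min_upper_gradient p N (?z k) x) p \<partial>N) \<le> ennreal (?s * Y k)"
      using upper_gradient_energy[OF zN[OF k]] nn by (simp add: Y_def ennreal_mult)
    with 1 show ?thesis by (rule add_mono)
  qed
  have "(\<lambda>k. ennreal ?c * (ennreal (F * (?c * (Y k + E k))) + (\<integral>\<^sup>+x. ennreal (\<bar>?d k x\<bar> powr p) \<partial>N)) + ennreal (?s * Y k))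
      \<longlonglongrightarrow> ennreal ?c * (ennreal (F * (?c * (0 + 0))) + 0) + ennreal (?s * 0)"
    by (intro tendsto_add ennreal_tendsto_cmult tendsto_ennrealI tendsto_mult tendsto_const Ylim Elim dlim) auto
  then have lim0: "(\<lambda>k. ennreal ?c * (ennreal (F * (?c * (Y k + E k))) + (\<integral>\<^sup>+x. ennreal (\<bar>?d k x\<bar> powr p) \<partial>N)) + ennreal (?s * Y k)) \<longlonglongrightarrow> 0"
    by simp
  have "(\<lambda>k. (\<integral>\<^sup>+x. ennreal (\<bar>?z k x\<bar> powr p) \<partial>N) + (\<integral>\<^sup>+x. ennpowr (min_upper_gradient p N (?z k) x) p \<partial>N)) \<longlonglongrightarrow> 0"
    by (rule tendsto_sandwich[OF _ _ tendsto_const lim0]) (use eventually_mono[OF ev1 bound] in auto)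
  then have "(\<lambda>k. ennpowr ((\<integral>\<^sup>+x. ennreal (\<bar>?z k x\<bar> powr p) \<partial>N) +
      (\<integral>\<^sup>+x. ennpowr (min_upper_gradient p N (?z k) x) p \<partial>N)) (1 / p)) \<longlonglongrightarrow> 0"
    using p_pos by (intro tendsto_ennpowr_zero) auto
  moreover have "eventually (\<lambda>k. ennpowr ((\<integral>\<^sup>+x. ennreal (\<bar>?z k x\<bar> powr p) \<partial>N) +
      (\<integral>\<^sup>+x. ennpowr (min_upper_gradient p N (?z k) x) p \<partial>N)) (1 / p) = newtonian_norm p N (?z k)) sequentially"
    using ev1 by eventually_elim (simp add: newtonian_norm_eq[OF p_pos borel_on_N zN])
  ultimately show ?thesis by (rule Lim_transform_eventually)
qed

end

theorem theorem5p14: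
  fixes p p' :: real
    and M :: "'a::metric_space measure"
    and \<Omega> :: "'a set"
    and A :: "nat set"
    and U :: "nat \<Rightarrow> 'a set"
    and J :: "nat \<Rightarrow> 'n::finite set"
    and F :: "nat \<Rightarrow> 'n \<Rightarrow> 'a \<Rightarrow> real"
    and D :: "nat \<Rightarrow> ('a \<Rightarrow> real) \<Rightarrow> 'a \<Rightarrow> real^'n"
    and ip :: "'a \<Rightarrow> real^'n \<Rightarrow> real^'n \<Rightarrow> real"
    and G :: "('a \<Rightarrow> real) \<Rightarrow> 'a \<Rightarrow> real^'n"
    and fs gs us :: "nat \<Rightarrow> 'a \<Rightarrow> real"
    and f g u :: "'a \<Rightarrow> real"
  assumes "1 < p" and "p' = p / (p - 1)"
    and "complete (UNIV :: 'a set)" and "geodesic_space TYPE('a)"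
    and "sets M = sets borel" and "doubling M" and "poincare_inequality p M"
    and "\<Omega> \<noteq> {}" and "bounded \<Omega>" and "open \<Omega>" and "connected \<Omega>"
    and "emeasure M (UNIV - \<Omega>) > 0"
    and "cheeger_charts p M A U J F D" and "cheeger_gradient p M A U D ip G"
    and "\<And>k. k \<ge> 1 \<Longrightarrow> fs k \<in> Lp p' (restrict_space M \<Omega>)"
    and "f \<in> Lp p' (restrict_space M \<Omega>)"
    and "(\<lambda>k. Lp_norm p' (restrict_space M \<Omega>) (\<lambda>x. fs k x - f x)) \<longlonglongrightarrow> 0"
    and "\<And>k. k \<ge> 1 \<Longrightarrow> gs k \<in> newtonian p (restrict_space M \<Omega>)"
    and "g \<in> newtonian p (restrict_space M \<Omega>)"
    and "(\<lambda>k. newtonian_norm p (restrict_space M \<Omega>) (\<lambda>x. gs k x - g x)) \<longlonglongrightarrow> 0"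
    and "\<And>k. k \<ge> 1 \<Longrightarrow> poisson_solution p M \<Omega> ip G (fs k) (gs k) (us k)"
    and "poisson_solution p M \<Omega> ip G f g u"
  shows "(\<lambda>k. newtonian_norm p (restrict_space M \<Omega>) (\<lambda>x. us k x - u x)) \<longlonglongrightarrow> 0"
proof -
  interpret cheeger_domain p M \<Omega> ip G
    using assms(1,3,5-7,9,10,12,14) unfolding cheeger_gradient_def by unfold_locales blast+
  show ?thesis
    by (rule solutions_converge[OF assms(2,15-22)])
qed

end
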